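(* Let $d\ge 3$ be an integer, $p\ge 1$ real, and let $(X_i)_{i\ge 1}$ be i.i.d. uniform random variables on $[0,1]^d$. Then $$\lim_{n\to\infty} n^{\frac pd}\,\mathbb{E}\left[W^p_{[0,1]^d}\left(\frac1n\sum_{i=1}^n\delta_{X_i},\,1\right)\right]=f^{\mathrm{ref}}_\infty,$$ where $f^{\mathrm{ref}}_\infty\in(0,\infty)$ is the constant $$f^{\mathrm{ref}}_\infty=\lim_{L\to\infty}\mathbb{E}\left[\frac{1}{|Q_L|}W^p_{Q_L}\left(\mu,\frac{\mu(Q_L)}{|Q_L|}\right)\right],$$ with $\mu$ a Poisson point process on $\mathbb{R}^d$ of intensity one (this limit exists and is finite and strictly positive).
   Context: $|A|$ is the Lebesgue measure of a Borel set $A\subseteq\mathbb{R}^d$, and $Q_L=[0,L]^d$. For finite positive Borel measures $\mu,\lambda$ and a Borel set $\Omega\subseteq\mathbb{R}^d$ with $\mu(\Omega)=\lambda(\Omega)$, the transportation cost is $$W^p_\Omega(\mu,\lambda)=\min_{\pi}\int_{\mathbb{R}^d\times\mathbb{R}^d}|x-y|^p\,d\pi(x,y),$$ the minimum being over all couplings $\pi$ of the restrictions of $\mu$ and $\lambda$ to $\Omega$ (nonnegative measures on $\mathbb{R}^d\times\mathbb{R}^d$ with these marginals); it is $0$ if $\mu(\Omega)=\lambda(\Omega)=0$. When a measure is absolutely continuous with respect to Lebesgue measure, only its density is written: the second argument $1$ denotes Lebesgue measure on $[0,1]^d$, and $W^p_{Q_L}(\mu,\mu(Q_L)/|Q_L|)$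 is the cost between $\mu$ restricted to $Q_L$ and the uniform measure on $Q_L$ of total mass $\mu(Q_L)$. A Poisson point process of intensity one is a random locally finite atomic measure $\mu=\sum_i\delta_{Z_i}$ such that for disjoint Borel sets $A_1,\dots,A_k$ the variables $\mu(A_1),\dots,\mu(A_k)$ are independent and $\mu(A_i)$ is Poisson with parameter $|A_i|$. *)

theory Defs
  imports "HOL-Probability.Probability"
begin

definition Q :: "real \<Rightarrow> (real ^ 'd) set"
  where "Q L = cbox 0 (\<chi> i. L)"

definition couplings ::
    "(real ^ 'd) measure \<Rightarrow> (real ^ 'd) measure \<Rightarrow> ((real ^ 'd) \<times> (real ^ 'd)) measure set"
  where "couplings \<mu> \<nu> =
    {\<pi>. sets \<pi> = sets (borel \<Otimes>\<^sub>M borel) \<and> distr \<pi> borel fst = \<mu> \<and> distr \<pi> borel snd = \<nu>}"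

text \<open>
  The restriction of a measure to \<open>\<Omega>\<close> is kept as a measure on the whole space, by means of
  the density \<open>indicator \<Omega>\<close>. The minimum over couplings is written as an infimum
  in \<open>[0, \<infinity>]\<close>; the two agree because the minimum is attained
  for finite measures of equal mass.
\<close>

definition transport_cost ::
    "real \<Rightarrow> (real ^ 'd) set \<Rightarrow> (real ^ 'd) measure \<Rightarrow> (real ^ 'd) measure \<Rightarrow> ennreal"
  where "transport_cost p \<Omega> \<mu> \<nu> =
    (INF \<pi> \<in> couplings (density \<mu> (indicator \<Omega>)) (density \<nu> (indicator \<Omega>)).
       \<integral>\<^sup>+ z. ennreal (norm (fst z - snd z) powr p) \<partial>\<pi>)"

text \<open>
  The sum of the Dirac masses at \<open>Z i\<close>, \<open>i \<in> I\<close>, counted with multiplicity: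
  a Borel set \<open>A\<close> has as its measure the number of \<open>i \<in> I\<close> with \<open>Z i \<in> A\<close>.
\<close>

definition dirac_sum :: "nat set \<Rightarrow> (nat \<Rightarrow> real ^ 'd) \<Rightarrow> (real ^ 'd) measure"
  where "dirac_sum I Z = distr (count_space I) borel Z"

text \<open>
  Borel sets of infinite Lebesgue measure need no separate clause for the Poisson law: by
  countable additivity and independence, their counts are almost surely infinite.
  The formula for the law includes the case of rate \<open>0\<close>, which is not
  covered by \<open>poisson_pmf\<close>.
\<close>

definition poisson_point_process :: "'w measure \<Rightarrow> ('w \<Rightarrow> (real ^ 'd) measure) \<Rightarrow> bool"
  where "poisson_point_process M N \<longleftrightarrow>
    prob_space M \<and>
    (\<forall>\<omega>\<in>space M. (\<exists>I Z. N \<omega> = dirac_sum I Z) \<and> (\<forall>K. compact K \<longrightarrow> emeasure (N \<omega>) K < \<infinity>)) \<and>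
    (\<forall>A\<in>sets borel. (\<lambda>\<omega>. emeasure (N \<omega>) A) \<in> borel_measurable M) \<and>
    (\<forall>(k::nat) A. (\<forall>i<k. A i \<in> sets borel) \<and> disjoint_family_on A {..<k} \<longrightarrow>
       prob_space.indep_vars M (\<lambda>_. borel) (\<lambda>i \<omega>. emeasure (N \<omega>) (A i)) {..<k}) \<and>
    (\<forall>A\<in>sets borel. emeasure lborel A < \<infinity> \<longrightarrow>
       (\<forall>k::nat. measure M {\<omega>\<in>space M. emeasure (N \<omega>) A = of_nat k} =
          measure lborel A ^ k / fact k * exp (- measure lborel A)))"

definition iid_uniform :: "'v measure \<Rightarrow> (nat \<Rightarrow> 'v \<Rightarrow> real ^ 'd) \<Rightarrow> bool"
  where "iid_uniform P X \<longleftrightarrow>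
    prob_space P \<and>
    prob_space.indep_vars P (\<lambda>_. borel) X {1..} \<and>
    (\<forall>i\<ge>1. distr P borel (X i) = uniform_measure lborel (Q 1))"

definition empirical_measure :: "nat \<Rightarrow> (nat \<Rightarrow> real ^ 'd) \<Rightarrow> (real ^ 'd) measure"
  where "empirical_measure n x = scale_measure (1 / of_nat n) (dirac_sum {1..n} x)"

end

theory Submission
  imports Defs "HOL-Combinatorics.Multiset_Permutations"
begin

text \<open>
  Let \<open>a n\<close> be the mean cost between \<open>n\<close> independent uniform points and \<open>n\<close> times Lebesgue measure
  on the unit cube. On a cube of side \<open>L\<close> a Poisson process is a Poisson number of independent
  uniform points, so its mean cost per unit volume is \<open>h L = L powr (p - d) * E (a Z)\<close>, where
  \<open>Z\<close> has the Poisson law with mean \<open>L ^ d\<close>; in particular \<open>h\<close> is continuous.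

  Cut a box of longest side \<open>s\<close> and volume \<open>V\<close> in two. Couple the points of each half with the
  uniform measure of that half, then move the two uniform densities to the common one by an affine
  stretch of each half. The displacement is \<open>s\<close> times the deviation of the fraction of points in
  the first half from its mean, of order \<open>V powr (- 1 / 2)\<close> by the Poisson moments. If \<open>s\<close> is
  comparable to \<open>V powr (1 / d)\<close>, the loss per unit volume is of order \<open>s powr (p * (1 - d / 2))\<close>,
  which is summable over geometrically growing scales because \<open>d \<ge> 3\<close>. Cutting a cube of side
  \<open>m * L\<close> into cubes of side \<open>L\<close> therefore gives
  \<open>h (m * L) \<le> (1 + \<epsilon>) * h L + C * L powr (p * (1 - d / 2))\<close>, and \<open>h\<close> converges.

  By convexity of the cost, \<open>a n / n\<close> is nonincreasing in \<open>n\<close>, so that the concentration of the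
  Poisson law transfers the limit to a deterministic number of points. The limit is positive since
  small balls around \<open>n\<close> points leave half of the unit cube uncovered if their radius is
  \<open>c * n powr (- 1 / d)\<close>.
\<close>

section \<open>Transport cost and couplings\<close>

text \<open>The spaces \<open>M\<close> and \<open>P\<close> are unrelated and \<open>N\<close> is
  known only through its counts on Borel sets, so the two point sets have no common construction,
  and it is not evident that the cost is measurable in \<open>\<omega>\<close>. Rounding the points
  to a grid removes both obstacles: rounded configurations take countably many values with explicit
  laws, and rounding changes a cost by a factor \<open>K1 p e\<close> and an error proportional to
  the number of points, which has finite mean.

  The same kind of comparison is paid at every cut. A cube of many cells needs logarithmically many
  generations of cuts, so a fixed \<open>e\<close> would let the product of the factors diverge.
  Hence \<open>e\<close> decreases geometrically with the generation; large boxes have relatively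
  small errors and can afford the large \<open>K2 p e\<close>.

  Monotonicity holds for the cost per point, whereas the Poisson mean is that of the total cost. The
  identity E (Z b(Z)) = \<theta> E b(Z + 1) for a Poisson variable Z of mean \<theta> links the
  two.\<close>

definition ot :: "real \<Rightarrow> (real ^ 'd) measure \<Rightarrow> (real ^ 'd) measure \<Rightarrow> ennreal"
  where "ot p \<mu> \<nu> = (INF \<pi> \<in> couplings \<mu> \<nu>. \<integral>\<^sup>+ z. ennreal (norm (fst z - snd z) powr p) \<partial>\<pi>)"

lemma transport_cost_eq_ot:
  "transport_cost p \<Omega> \<mu> \<nu> = ot p (density \<mu> (indicator \<Omega>)) (density \<nu> (indicator \<Omega>))"
  by (simp add: transport_cost_def ot_def)

text \<open>These constants replace Minkowski's inequality: costs are compared up to a factor close to \<open>1\<close>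
  and a large multiple of the \<open>p\<close>-th power of a small displacement.\<close>

definition K1 :: "real \<Rightarrow> real \<Rightarrow> real" where "K1 p e = (1 + e) powr p"
definition K2 :: "real \<Rightarrow> real \<Rightarrow> real" where "K2 p e = (1 + 1 / e) powr p"

lemma K1_pos: "e > 0 \<Longrightarrow> 0 < K1 p e" and K2_pos: "e > 0 \<Longrightarrow> 0 < K2 p e"
proof -
  assume "e > 0"
  then show "0 < K1 p e" by (simp add: K1_def)
next
  assume "e > 0"
  then have "1 + 1 / e > 0" by (simp add: add_pos_pos)
  then show "0 < K2 p e" by (simp add: K2_def)
qed

text \<open>Either \<open>b \<le> e * a\<close> or \<open>a < b / e\<close>, and in each case a
  single term of the right-hand side dominates. \<open>K1 p e\<close> tends to 1 as \<open>e\<close>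
  tends to 0, at the price of a large \<open>K2 p e\<close>.\<close>

lemma powr_add_le_K1_K2:
  fixes a b e p :: real
  assumes "a \<ge> 0" "b \<ge> 0" "e > 0" "p \<ge> 0"
  shows "(a + b) powr p \<le> K1 p e * a powr p + K2 p e * b powr p"
proof (cases "b \<le> e * a")
  case True
  then have "(a + b) powr p \<le> ((1 + e) * a) powr p"
    using assms by (intro powr_mono2) (auto simp: algebra_simps)
  also have "\<dots> = K1 p e * a powr p"
    using assms by (simp add: K1_def powr_mult)
  finally show ?thesis
    using assms K2_pos[of e p] by (simp add: add_increasing2)
next
  case False
  then have "a \<le> b / e"
    using assms by (simp add: field_simps)
  then have "(a + b) powr p \<le> ((1 + 1 / e) * b) powr p"
    using assms by (intro powr_mono2) (auto simp: algebra_simps)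
  also have "\<dots> = K2 p e * b powr p"
    using assms by (subst powr_mult) (auto simp: K2_def)
  finally show ?thesis
    using assms K1_pos[of e p] by (simp add: add_increasing)
qed

section \<open>Couplings and their marginals\<close>

lemma couplings_sets: "\<pi> \<in> couplings \<mu> \<nu> \<Longrightarrow> sets \<pi> = sets (borel \<Otimes>\<^sub>M borel)"
  by (simp add: couplings_def)

lemma couplings_space: "\<pi> \<in> couplings \<mu> \<nu> \<Longrightarrow> space \<pi> = UNIV"
  using sets_eq_imp_space_eq[OF couplings_sets] by (auto simp: space_pair_measure)

lemma couplings_measurable:
  assumes "\<pi> \<in> couplings \<mu> \<nu>" shows "measurable \<pi> M = measurable (borel \<Otimes>\<^sub>M borel) M"
  by (intro measurable_cong_sets couplings_sets[OF assms] refl)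

lemma
  assumes \<pi>: "\<pi> \<in> couplings \<mu> \<nu>" and A: "A \<in> sets borel"
  shows couplings_fst: "emeasure \<pi> (A \<times> UNIV) = emeasure \<mu> A"
    and couplings_snd: "emeasure \<pi> (UNIV \<times> A) = emeasure \<nu> A"
proof -
  have "distr \<pi> borel fst = \<mu>" "distr \<pi> borel snd = \<nu>" using \<pi> by (simp_all add: couplings_def)
  moreover have "fst -` A \<inter> space \<pi> = A \<times> UNIV" "snd -` A \<inter> space \<pi> = UNIV \<times> A"
    by (auto simp: couplings_space[OF \<pi>])
  ultimately show "emeasure \<pi> (A \<times> UNIV) = emeasure \<mu> A" "emeasure \<pi> (UNIV \<times> A) = emeasure \<nu> A"
    using emeasure_distr[of fst \<pi> borel A] emeasure_distr[of snd \<pi> borel A] A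
    by (simp_all add: couplings_measurable[OF \<pi>])
qed

lemma couplings_fst_sets: "\<pi> \<in> couplings \<mu> \<nu> \<Longrightarrow> sets \<mu> = sets borel"
  and couplings_snd_sets: "\<pi> \<in> couplings \<mu> \<nu> \<Longrightarrow> sets \<nu> = sets borel"
  by (auto simp: couplings_def)

lemma couplingsI:
  fixes \<mu> \<nu> :: "(real ^ 'd) measure"
  assumes s: "sets \<pi> = sets (borel \<Otimes>\<^sub>M borel)" "sets \<mu> = sets borel" "sets \<nu> = sets borel"
    and f: "\<And>A. A \<in> sets borel \<Longrightarrow> emeasure \<pi> (A \<times> UNIV) = emeasure \<mu> A"
    and g: "\<And>A. A \<in> sets borel \<Longrightarrow> emeasure \<pi> (UNIV \<times> A) = emeasure \<nu> A"
  shows "\<pi> \<in> couplings \<mu> \<nu>"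
proof -
  have sp: "space \<pi> = UNIV"
    using sets_eq_imp_space_eq[OF s(1)] by (auto simp: space_pair_measure)
  have m: "measurable \<pi> M = measurable (borel \<Otimes>\<^sub>M borel) M" for M :: "(real ^ 'd) measure"
    by (intro measurable_cong_sets s refl)
  have v: "fst -` A \<inter> space \<pi> = A \<times> UNIV" "snd -` A \<inter> space \<pi> = UNIV \<times> A" for A
    by (auto simp: sp)
  have "distr \<pi> borel fst = \<mu>" "distr \<pi> borel snd = \<nu>"
    by (rule measure_eqI; simp add: s f g m v emeasure_distr)+
  then show ?thesis using s by (simp add: couplings_def)
qed

lemma distr_couplings:
  fixes \<mu> \<nu> :: "(real ^ 'd) measure" and S T :: "real ^ 'd \<Rightarrow> real ^ 'd"
  assumes \<pi>: "\<pi> \<in> couplings \<mu> \<nu>" and S: "S \<in> borel \<rightarrow>\<^sub>M borel" and T: "T \<in> borel \<rightarrow>\<^sub>M borel"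
  shows "distr \<pi> (borel \<Otimes>\<^sub>M borel) (\<lambda>z. (S (fst z), T (snd z))) \<in> couplings (distr \<mu> borel S) (distr \<nu> borel T)"
proof -
  let ?F = "\<lambda>z. (S (fst z), T (snd z))"
  note m = couplings_measurable[OF \<pi>]
  have F: "?F \<in> measurable \<pi> (borel \<Otimes>\<^sub>M borel)" unfolding m using S T by measurable
  have "distr \<pi> borel fst = \<mu>" "distr \<pi> borel snd = \<nu>" using \<pi> by (simp_all add: couplings_def)
  moreover have "distr (distr \<pi> (borel \<Otimes>\<^sub>M borel) ?F) borel fst = distr (distr \<pi> borel fst) borel S"
    "distr (distr \<pi> (borel \<Otimes>\<^sub>M borel) ?F) borel snd = distr (distr \<pi> borel snd) borel T"
    using F S T by (simp_all add: distr_distr m comp_def)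
  ultimately show ?thesis by (simp add: couplings_def)
qed

lemma ot_le: "\<pi> \<in> couplings \<mu> \<nu> \<Longrightarrow> ot p \<mu> \<nu> \<le> (\<integral>\<^sup>+ z. ennreal (norm (fst z - snd z) powr p) \<partial>\<pi>)"
  unfolding ot_def by (rule INF_lower)

text \<open>Replaces the choice of an optimal coupling: an affine bound valid for every coupling
  passes to the infimum. Isolating the infimum takes a subtraction and a division in
  [0, \<infinity>], hence the separate case of infinite \<open>c\<close> and the positive finite
  \<open>K\<close>.\<close>

lemma ot_greatest:
  assumes "\<And>\<pi>. \<pi> \<in> couplings \<mu> \<nu> \<Longrightarrow> x \<le> K * (\<integral>\<^sup>+ z. ennreal (norm (fst z - snd z) powr p) \<partial>\<pi>) + c"
    and K: "0 < K" "K < \<top>"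
  shows "x \<le> K * ot p \<mu> \<nu> + c"
proof (cases "c = \<top>")
  case False
  have "(x - c) / K \<le> ot p \<mu> \<nu>"
    unfolding ot_def
  proof (rule INF_greatest)
    fix \<pi> assume "\<pi> \<in> couplings \<mu> \<nu>"
    from assms(1)[OF this] show "(x - c) / K \<le> (\<integral>\<^sup>+ z. ennreal (norm (fst z - snd z) powr p) \<partial>\<pi>)"
      using K False by (intro divide_le_posI_ennreal) (auto simp: ennreal_minus_le_iff add.commute)
  qed
  then have "K * ((x - c) / K) \<le> K * ot p \<mu> \<nu>"
    by (intro mult_left_mono) auto
  moreover have "K * ((x - c) / K) = x - c"
    using K mult_divide_eq_ennreal[of K "x - c"] by (auto simp: ennreal_times_divide mult.commute)
  ultimately show ?thesis
    using False by (simp add: ennreal_minus_le_iff add.commute)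
qed simp

section \<open>Weighted sums of measures and joint convexity of the cost\<close>

definition wsum :: "'i set \<Rightarrow> ('i \<Rightarrow> ennreal) \<Rightarrow> ('i \<Rightarrow> 'a measure) \<Rightarrow> 'a measure \<Rightarrow> 'a measure"
  where "wsum I c \<pi> M = measure_of (space M) (sets M) (\<lambda>B. \<Sum>i\<in>I. c i * emeasure (\<pi> i) B)"

lemma sets_wsum [simp]: "sets (wsum I c \<pi> M) = sets M"
  and space_wsum [simp]: "space (wsum I c \<pi> M) = space M"
  by (simp_all add: wsum_def sets.space_closed)

lemma emeasure_wsum:
  assumes "finite I" and s: "\<And>i. i \<in> I \<Longrightarrow> sets (\<pi> i) = sets M" and B: "B \<in> sets M"
  shows "emeasure (wsum I c \<pi> M) B = (\<Sum>i\<in>I. c i * emeasure (\<pi> i) B)"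
  unfolding wsum_def
proof (rule emeasure_measure_of_sigma)
  show "sigma_algebra (space M) (sets M)" by (rule sets.sigma_algebra_axioms)
  show "positive (sets M) (\<lambda>B. \<Sum>i\<in>I. c i * emeasure (\<pi> i) B)"
    by (simp add: positive_def)
  show "countably_additive (sets M) (\<lambda>B. \<Sum>i\<in>I. c i * emeasure (\<pi> i) B)"
  proof (rule countably_additiveI)
    fix A :: "nat \<Rightarrow> _" assume A: "range A \<subseteq> sets M" "disjoint_family A"
    have "(\<Sum>n. \<Sum>i\<in>I. c i * emeasure (\<pi> i) (A n)) = (\<Sum>i\<in>I. \<Sum>n. c i * emeasure (\<pi> i) (A n))"
      by (intro suminf_sum) simp
    also have "\<dots> = (\<Sum>i\<in>I. c i * emeasure (\<pi> i) (\<Union>n. A n))"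
      using A s by (intro sum.cong refl) (subst suminf_emeasure[symmetric], auto)
    finally show "(\<Sum>n. \<Sum>i\<in>I. c i * emeasure (\<pi> i) (A n)) = (\<Sum>i\<in>I. c i * emeasure (\<pi> i) (\<Union>n. A n))" .
  qed
qed (use B in simp)

lemma nn_integral_wsum:
  assumes I: "finite I" and s: "\<And>i. i \<in> I \<Longrightarrow> sets (\<pi> i) = sets M" and f: "f \<in> borel_measurable M"
  shows "(\<integral>\<^sup>+x. f x \<partial>wsum I c \<pi> M) = (\<Sum>i\<in>I. c i * (\<integral>\<^sup>+x. f x \<partial>\<pi> i))"
proof -
  have m: "measurable (wsum I c \<pi> M) N = measurable M N" "\<And>i. i \<in> I \<Longrightarrow> measurable (\<pi> i) N = measurable M N" for N
    by (auto intro!: measurable_cong_sets simp: s)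
  have sp: "\<And>i. i \<in> I \<Longrightarrow> space (\<pi> i) = space M"
    using s by (rule sets_eq_imp_space_eq)
  show ?thesis
    using f
  proof (induction rule: borel_measurable_induct)
    case (cong f g)
    then show ?case
      by (smt (verit, best) nn_integral_cong sp space_wsum sum.cong)
  next
    case (set A)
    then show ?case by (simp add: emeasure_wsum[OF I s] s)
  next
    case (mult u k)
    then show ?case
      by (simp add: nn_integral_cmult m sum_distrib_left mult_ac)
  next
    case (add u v)
    then show ?case
      by (simp add: nn_integral_add m sum.distrib algebra_simps)
  next
    case (seq U)
    have "(\<integral>\<^sup>+x. (SUP i. U i) x \<partial>wsum I c \<pi> M) = (SUP n. \<integral>\<^sup>+x. U n x \<partial>wsum I c \<pi> M)"
      unfolding SUP_apply using seq by (intro nn_integral_monotone_convergence_SUP) (auto simp: m)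
    also have "\<dots> = (SUP n. \<Sum>i\<in>I. c i * (\<integral>\<^sup>+x. U n x \<partial>\<pi> i))"
      using seq by simp
    also have "\<dots> = (\<Sum>i\<in>I. SUP n. c i * (\<integral>\<^sup>+x. U n x \<partial>\<pi> i))"
      using seq by (intro ennreal_SUP_sum)
        (auto simp: incseq_def le_fun_def intro!: mult_left_mono nn_integral_mono)
    also have "\<dots> = (\<Sum>i\<in>I. c i * (\<integral>\<^sup>+x. (SUP i. U i) x \<partial>\<pi> i))"
      unfolding SUP_apply SUP_mult_left_ennreal
      using seq by (intro sum.cong refl) (subst nn_integral_monotone_convergence_SUP, auto simp: m SUP_mult_left_ennreal)
    finally show ?case .
  qed
qed

text \<open>A weighted sum of couplings of the pairs is a coupling of the weighted sums. This gives
  convexity, homogeneity (one index) and subadditivity (all weights 1).\<close>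

lemma ot_wsum_le:
  fixes \<mu> \<nu> :: "(real ^ 'd) measure"
  assumes I: "finite I" and s: "sets \<mu> = sets borel" "sets \<nu> = sets borel"
    and \<mu>: "\<And>A. A \<in> sets borel \<Longrightarrow> emeasure \<mu> A = (\<Sum>i\<in>I. c i * emeasure (\<mu>' i) A)"
    and \<nu>: "\<And>A. A \<in> sets borel \<Longrightarrow> emeasure \<nu> A = (\<Sum>i\<in>I. c i * emeasure (\<nu>' i) A)"
    and c: "\<And>i. i \<in> I \<Longrightarrow> 0 < c i" "\<And>i. i \<in> I \<Longrightarrow> c i < \<top>"
  shows "ot p \<mu> \<nu> \<le> (\<Sum>i\<in>I. c i * ot p (\<mu>' i) (\<nu>' i))"
proof -
  let ?C = "\<lambda>\<pi>. \<integral>\<^sup>+ z. ennreal (norm (fst z - snd z) powr p) \<partial>\<pi>"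
  \<comment> \<open>Arbitrary couplings are replaced by infima one index at a time: \<open>J\<close>
    holds the indices already treated, and the couplings \<open>\<pi> i\<close> of the others are
    still free.\<close>
  have "ot p \<mu> \<nu> \<le> (\<Sum>i\<in>J. c i * ot p (\<mu>' i) (\<nu>' i)) + (\<Sum>i\<in>I-J. c i * ?C (\<pi> i))"
    if "J \<subseteq> I" "\<And>i. i \<in> I - J \<Longrightarrow> \<pi> i \<in> couplings (\<mu>' i) (\<nu>' i)" for J \<pi>
    using finite_subset[OF that(1) I] that
  proof (induction J arbitrary: \<pi> rule: finite_induct)
    case empty
    have \<pi>: "\<And>i. i \<in> I \<Longrightarrow> sets (\<pi> i) = sets (borel \<Otimes>\<^sub>M borel)"
      using empty by (intro couplings_sets) auto
    have "wsum I c \<pi> (borel \<Otimes>\<^sub>M borel) \<in> couplings \<mu> \<nu>"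
    proof (rule couplingsI)
      fix A :: "(real ^ 'd) set" assume A: "A \<in> sets borel"
      show "emeasure (wsum I c \<pi> (borel \<Otimes>\<^sub>M borel)) (A \<times> UNIV) = emeasure \<mu> A"
        using A empty.prems(2) by (simp add: emeasure_wsum[OF I \<pi>] \<mu>) (intro sum.cong refl arg_cong2[where f="(*)"] couplings_fst; auto)
      show "emeasure (wsum I c \<pi> (borel \<Otimes>\<^sub>M borel)) (UNIV \<times> A) = emeasure \<nu> A"
        using A empty.prems(2) by (simp add: emeasure_wsum[OF I \<pi>] \<nu>) (intro sum.cong refl arg_cong2[where f="(*)"] couplings_snd; auto)
    qed (simp_all add: s)
    from ot_le[OF this] show ?case
      by (simp add: nn_integral_wsum[OF I \<pi>])
  next
    case (insert j J)
    have j: "j \<in> I" "j \<notin> J" using insert by auto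
    let ?S = "(\<Sum>i\<in>J. c i * ot p (\<mu>' i) (\<nu>' i)) + (\<Sum>i\<in>I-insert j J. c i * ?C (\<pi> i))"
    have "ot p \<mu> \<nu> \<le> c j * ot p (\<mu>' j) (\<nu>' j) + ?S"
    proof (rule ot_greatest)
      fix \<pi>' assume "\<pi>' \<in> couplings (\<mu>' j) (\<nu>' j)"
      then have "ot p \<mu> \<nu> \<le> (\<Sum>i\<in>J. c i * ot p (\<mu>' i) (\<nu>' i)) + (\<Sum>i\<in>I-J. c i * ?C ((\<pi>(j := \<pi>')) i))"
        using insert by (intro insert.IH) auto
      also have "I - J = insert j (I - insert j J)" using j by auto
      also have "(\<Sum>i\<in>insert j (I - insert j J). c i * ?C ((\<pi>(j := \<pi>')) i)) =
          c j * ?C \<pi>' + (\<Sum>i\<in>I-insert j J. c i * ?C ((\<pi>(j := \<pi>')) i))"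
        using I by (subst sum.insert) auto
      also have "(\<Sum>i\<in>I-insert j J. c i * ?C ((\<pi>(j := \<pi>')) i)) = (\<Sum>i\<in>I-insert j J. c i * ?C (\<pi> i))"
        by (intro sum.cong) auto
      finally show "ot p \<mu> \<nu> \<le> c j * ?C \<pi>' + ?S" by (simp add: add_ac)
    qed (use c j in auto)
    then show ?case using insert by (simp add: add_ac)
  qed
  from this[of I] show ?thesis by simp
qed

lemma emeasure_coupling_UNIV:
  "\<pi> \<in> couplings \<mu> \<nu> \<Longrightarrow> emeasure \<pi> UNIV = emeasure \<mu> UNIV"
  "\<pi> \<in> couplings \<mu> \<nu> \<Longrightarrow> emeasure \<pi> UNIV = emeasure \<nu> UNIV"
  using couplings_fst[of \<pi> \<mu> \<nu> UNIV] couplings_snd[of \<pi> \<mu> \<nu> UNIV] by auto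

section \<open>Stability of the cost under displacement and scaling\<close>

lemma cost_triangle:
  fixes x y z :: "real ^ 'd"
  assumes "norm (x - y) \<le> \<delta>" "e > 0" "p \<ge> 0"
  shows "ennreal (norm (x - z) powr p) \<le> ennreal (K1 p e) * ennreal (norm (y - z) powr p) + ennreal (K2 p e * \<delta> powr p)"
proof -
  have "norm (x - z) \<le> norm (y - z) + \<delta>"
    using norm_triangle_ineq[of "x - y" "y - z"] assms by simp
  moreover have \<delta>: "\<delta> \<ge> 0" using norm_ge_zero assms(1) by (rule order_trans)
  ultimately have "norm (x - z) powr p \<le> (norm (y - z) + \<delta>) powr p"
    using assms by (intro powr_mono2) auto
  also have "\<dots> \<le> K1 p e * norm (y - z) powr p + K2 p e * \<delta> powr p"
    using \<delta> assms by (intro powr_add_le_K1_K2) auto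
  finally have "ennreal (norm (x - z) powr p) \<le> ennreal (K1 p e * norm (y - z) powr p + K2 p e * \<delta> powr p)"
    by (rule ennreal_leI)
  also have "\<dots> = ennreal (K1 p e) * ennreal (norm (y - z) powr p) + ennreal (K2 p e * \<delta> powr p)"
    using K1_pos[of e p] K2_pos[of e p] assms by (simp add: ennreal_mult' ennreal_plus)
  finally show ?thesis .
qed

text \<open>A coupling pushed forward by \<open>T\<close> in its second coordinate is a coupling
  with the pushed target. The additive error is that of one displacement times the total mass
  displaced.\<close>

lemma ot_distr_right_le:
  fixes \<mu> \<nu> :: "(real ^ 'd) measure"
  assumes T[measurable]: "T \<in> borel \<rightarrow>\<^sub>M borel" and s: "sets \<nu> = sets borel"
    and d: "AE y in \<nu>. norm (T y - y) \<le> \<delta>" and p: "p \<ge> 0" and e: "e > 0"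
  shows "ot p \<mu> (distr \<nu> borel T) \<le> ennreal (K1 p e) * ot p \<mu> \<nu> + ennreal (K2 p e * \<delta> powr p) * emeasure \<nu> UNIV"
proof (rule ot_greatest)
  fix \<pi> assume \<pi>: "\<pi> \<in> couplings \<mu> \<nu>"
  have m [simp]: "measurable \<pi> N = measurable (borel \<Otimes>\<^sub>M borel) N" for N :: "'c measure"
    by (rule couplings_measurable[OF \<pi>])
  have "distr \<pi> (borel \<Otimes>\<^sub>M borel) (\<lambda>z. (fst z, T (snd z))) \<in> couplings \<mu> (distr \<nu> borel T)"
    using distr_couplings[OF \<pi> measurable_ident_sets[OF refl] T] couplings_fst_sets[OF \<pi>] by (simp add: distr_id2)
  from ot_le[OF this, of p]
  have "ot p \<mu> (distr \<nu> borel T) \<le> (\<integral>\<^sup>+ z. ennreal (norm (fst z - T (snd z)) powr p) \<partial>\<pi>)"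
    by (subst (asm) nn_integral_distr) auto
  also have "\<dots> \<le> (\<integral>\<^sup>+ z. ennreal (K1 p e) * ennreal (norm (fst z - snd z) powr p) + ennreal (K2 p e * \<delta> powr p) \<partial>\<pi>)"
  proof (rule nn_integral_mono_AE)
    have "AE z in \<pi>. norm (T (snd z) - snd z) \<le> \<delta>"
    proof -
      have "AE y in distr \<pi> borel snd. norm (T y - y) \<le> \<delta>"
        using d \<pi> by (metis (mono_tags, lifting) couplings_def mem_Collect_eq)
      then show ?thesis
        by (subst (asm) AE_distr_iff) auto
    qed
    then show "AE z in \<pi>. ennreal (norm (fst z - T (snd z)) powr p) \<le>
      ennreal (K1 p e) * ennreal (norm (fst z - snd z) powr p) + ennreal (K2 p e * \<delta> powr p)"
    proof eventually_elim
      case (elim z)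
      from cost_triangle[OF elim e p, of "fst z"] show ?case
        by (simp add: norm_minus_commute)
    qed
  qed
  also have "\<dots> = ennreal (K1 p e) * (\<integral>\<^sup>+ z. ennreal (norm (fst z - snd z) powr p) \<partial>\<pi>)
     + ennreal (K2 p e * \<delta> powr p) * emeasure \<nu> UNIV"
    by (subst nn_integral_add; simp add: nn_integral_cmult couplings_space[OF \<pi>] emeasure_coupling_UNIV(2)[OF \<pi>])
  finally show "ot p \<mu> (distr \<nu> borel T) \<le> \<dots>" .
qed (use K1_pos[OF e, of p] in auto)

lemma ot_affine_le:
  fixes \<mu> \<nu> :: "(real ^ 'd) measure" and a :: "real ^ 'd"
  assumes L: "L > 0"
  shows "ot p (distr \<mu> borel (\<lambda>x. a + L *\<^sub>R x)) (distr \<nu> borel (\<lambda>x. a + L *\<^sub>R x)) \<le> ennreal (L powr p) * ot p \<mu> \<nu>"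
proof -
  let ?\<phi> = "\<lambda>x::real^'d. a + L *\<^sub>R x"
  have "ot p (distr \<mu> borel ?\<phi>) (distr \<nu> borel ?\<phi>) \<le> ennreal (L powr p) * ot p \<mu> \<nu> + 0"
  proof (rule ot_greatest)
    fix \<pi> assume \<pi>: "\<pi> \<in> couplings \<mu> \<nu>"
    have m [simp]: "measurable \<pi> N = measurable (borel \<Otimes>\<^sub>M borel) N" for N :: "'c measure"
      by (rule couplings_measurable[OF \<pi>])
    have \<phi>[measurable]: "?\<phi> \<in> borel \<rightarrow>\<^sub>M borel" by measurable
    note distr_couplings[OF \<pi> \<phi> \<phi>]
    from ot_le[OF this, of p]
    have "ot p (distr \<mu> borel ?\<phi>) (distr \<nu> borel ?\<phi>) \<le> (\<integral>\<^sup>+ z. ennreal (norm (?\<phi> (fst z) - ?\<phi> (snd z)) powr p) \<partial>\<pi>)"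
      by (subst (asm) nn_integral_distr) auto
    also have "\<dots> = (\<integral>\<^sup>+ z. ennreal (L powr p) * ennreal (norm (fst z - snd z) powr p) \<partial>\<pi>)"
      using L by (intro nn_integral_cong)
        (simp add: scaleR_diff_right[symmetric] powr_mult ennreal_mult)
    finally show "ot p (distr \<mu> borel ?\<phi>) (distr \<nu> borel ?\<phi>)
      \<le> ennreal (L powr p) * (\<integral>\<^sup>+ z. ennreal (norm (fst z - snd z) powr p) \<partial>\<pi>) + 0"
      by (simp add: nn_integral_cmult)
  qed (use L in auto)
  then show ?thesis by simp
qed

section \<open>Finite atomic measures\<close>

lemma emeasure_dirac_sum:
  "A \<in> sets borel \<Longrightarrow> emeasure (dirac_sum I Z) A = emeasure (count_space I) (Z -` A \<inter> I)"
  by (simp add: dirac_sum_def emeasure_distr)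

text \<open>Indexed by multisets, because the points of the Poisson process carry no labels and
  there are only countably many multisets over a finite set of grid points. The list behind the
  choice is arbitrary; \<open>emeasure_atoms\<close> shows that it has no influence.\<close>

definition atoms :: "(real ^ 'd) multiset \<Rightarrow> (real ^ 'd) measure"
  where "atoms B = dirac_sum {..<size B} (nth (SOME xs. mset xs = B))"

lemma sets_dirac_sum [simp]: "sets (dirac_sum I Z) = sets borel"
  by (simp add: dirac_sum_def)

lemma space_dirac_sum [simp]: "space (dirac_sum I Z) = UNIV"
  by (simp add: dirac_sum_def)

lemma sets_atoms [simp]: "sets (atoms B) = sets borel" and space_atoms [simp]: "space (atoms B) = UNIV"
  by (simp_all add: atoms_def)

lemma emeasure_dirac_sum_finite:
  assumes "A \<in> sets borel" "finite I"
  shows "emeasure (dirac_sum I Z) A = of_nat (size (filter_mset (\<lambda>x. x \<in> A) (image_mset Z (mset_set I))))"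
proof -
  have "size (filter_mset (\<lambda>x. x \<in> A) (image_mset Z (mset_set I))) = card (Z -` A \<inter> I)"
    using assms by (simp add: filter_mset_image_mset filter_mset_mset_set vimage_def Int_def conj_commute)
  then show ?thesis
    using assms by (simp add: emeasure_dirac_sum emeasure_count_space)
qed

lemma image_mset_nth: "image_mset ((!) xs) (mset_set {..<length xs}) = mset xs"
  by (simp only: lessThan_atLeast0 mset_upt[symmetric] mset_map[symmetric] map_nth)

lemma emeasure_atoms:
  assumes "A \<in> sets borel"
  shows "emeasure (atoms B) A = of_nat (size (filter_mset (\<lambda>x. x \<in> A) B))"
proof -
  define xs where "xs = (SOME xs. mset xs = B)"
  have xs: "mset xs = B"
    unfolding xs_def by (rule someI_ex) (rule ex_mset)
  then have "size B = length xs" by auto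
  then show ?thesis
    using emeasure_dirac_sum_finite[OF assms, of "{..<length xs}" "(!) xs"]
    by (simp add: atoms_def xs_def[symmetric] image_mset_nth xs)
qed

lemma dirac_sum_finite: "finite I \<Longrightarrow> dirac_sum I Z = atoms (image_mset Z (mset_set I))"
  by (rule measure_eqI) (simp_all add: emeasure_dirac_sum_finite emeasure_atoms)

lemma emeasure_atoms_UNIV [simp]: "emeasure (atoms B) UNIV = of_nat (size B)"
  by (subst emeasure_atoms) auto

lemma emeasure_atoms_list:
  "A \<in> sets borel \<Longrightarrow> emeasure (atoms (mset xs)) A = (\<Sum>i<length xs. indicator A (xs ! i))"
proof (simp add: emeasure_atoms, induction xs)
  case (Cons x xs)
  then show ?case
    by (simp add: sum.lessThan_Suc_shift del: sum.lessThan_Suc)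
qed simp

text \<open>The coupling is the image of \<open>\<nu>\<close> under
  \<open>z \<mapsto> (y, z)\<close>: all mass starts at \<open>y\<close>.\<close>

lemma ot_single_le:
  fixes y :: "real ^ 'd"
  assumes s: "sets \<nu> = sets borel" and m: "emeasure \<nu> UNIV = 1"
  shows "ot p (atoms {#y#}) \<nu> \<le> (\<integral>\<^sup>+ z. ennreal (norm (y - z) powr p) \<partial>\<nu>)"
proof -
  have [simp]: "measurable \<nu> N = measurable borel N" for N :: "'c measure"
    by (intro measurable_cong_sets s refl)
  have sp: "space \<nu> = UNIV" using sets_eq_imp_space_eq[OF s] by simp
  let ?S = "\<lambda>z. (y, z)"
  have S: "?S \<in> borel \<rightarrow>\<^sub>M borel \<Otimes>\<^sub>M borel" by simp
  have "distr \<nu> (borel \<Otimes>\<^sub>M borel) ?S \<in> couplings (atoms {#y#}) \<nu>"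
  proof (rule couplingsI)
    fix A :: "(real ^ 'd) set" assume A [measurable]: "A \<in> sets borel"
    have "emeasure (distr \<nu> (borel \<Otimes>\<^sub>M borel) ?S) (A \<times> UNIV) = emeasure \<nu> (?S -` (A \<times> UNIV) \<inter> space \<nu>)"
      by (intro emeasure_distr) auto
    also have "?S -` (A \<times> UNIV) \<inter> space \<nu> = (if y \<in> A then UNIV else {})" by (auto simp: sp)
    finally show "emeasure (distr \<nu> (borel \<Otimes>\<^sub>M borel) ?S) (A \<times> UNIV) = emeasure (atoms {#y#}) A"
      using m by (simp add: emeasure_atoms)
    have "emeasure (distr \<nu> (borel \<Otimes>\<^sub>M borel) ?S) (UNIV \<times> A) = emeasure \<nu> (?S -` (UNIV \<times> A) \<inter> space \<nu>)"
      by (intro emeasure_distr) auto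
    also have "?S -` (UNIV \<times> A) \<inter> space \<nu> = A" by (auto simp: sp)
    finally show "emeasure (distr \<nu> (borel \<Otimes>\<^sub>M borel) ?S) (UNIV \<times> A) = emeasure \<nu> A" .
  qed (simp_all add: s)
  from ot_le[OF this, of p] show ?thesis
    by (subst (asm) nn_integral_distr) auto
qed

text \<open>Positions are grouped by value; the value \<open>v\<close> occurs at
  \<open>count (mset xs) v\<close> positions, which cancels the denominator.\<close>

lemma sum_div_count:
  fixes f :: "'a \<Rightarrow> ennreal"
  shows "(\<Sum>i<length xs. f (xs ! i) / of_nat (count (mset xs) (xs ! i))) = (\<Sum>v\<in>set xs. f v)"
proof -
  let ?g = "\<lambda>x. f x / of_nat (count (mset xs) x)"
  have "(\<Sum>i<length xs. ?g (xs ! i)) = (\<Sum>v\<in>set xs. \<Sum>i | i \<in> {..<length xs} \<and> xs ! i = v. ?g (xs ! i))"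
    by (intro sum.group[symmetric]) auto
  also have "\<dots> = (\<Sum>v\<in>set xs. of_nat (count (mset xs) v) * ?g v)"
  proof (intro sum.cong refl)
    fix v
    have "count (mset xs) v = card {i. i < length xs \<and> v = xs ! i}"
      by (simp add: count_mset count_list_eq_length_filter length_filter_conv_card)
    also have "{i. i < length xs \<and> v = xs ! i} = {i. i \<in> {..<length xs} \<and> xs ! i = v}" by auto
    finally show "(\<Sum>i | i \<in> {..<length xs} \<and> xs ! i = v. ?g (xs ! i)) = of_nat (count (mset xs) v) * ?g v"
      by simp
  qed
  also have "\<dots> = (\<Sum>v\<in>set xs. f v)"
  proof (intro sum.cong refl)
    fix v assume "v \<in> set xs"
    then have c: "count (mset xs) v \<noteq> 0" by (metis count_eq_zero_iff set_mset_mset)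
    then show "of_nat (count (mset xs) v) * ?g v = f v"
      using mult_divide_eq_ennreal[of "of_nat (count (mset xs) v)" "f v"]
      by (simp add: ennreal_times_divide mult.commute ennreal_of_nat_eq_real_of_nat)
  qed
  finally show ?thesis .
qed

section \<open>Atomic and uniform measures\<close>

text \<open>Several points may sit at the same atom; the mass leaving the atom is then divided equally
  among them, whence the division by the multiplicity.\<close>

lemma ot_atoms_perturb:
  fixes xs ys :: "(real ^ 'd) list"
  assumes len: "length xs = length ys" and d: "\<And>i. i < length xs \<Longrightarrow> norm (ys ! i - xs ! i) \<le> \<delta>"
    and p: "p \<ge> 0" and e: "e > 0"
  shows "ot p (atoms (mset ys)) \<nu> \<le> ennreal (K1 p e) * ot p (atoms (mset xs)) \<nu> + ennreal (K2 p e * \<delta> powr p) * of_nat (length xs)"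
proof (rule ot_greatest)
  fix \<pi> assume \<pi>: "\<pi> \<in> couplings (atoms (mset xs)) \<nu>"
  have m [simp]: "measurable \<pi> N = measurable (borel \<Otimes>\<^sub>M borel) N" for N :: "'c measure"
    by (rule couplings_measurable[OF \<pi>])
  have sp: "space \<pi> = UNIV" by (rule couplings_space[OF \<pi>])
  have s\<pi>: "sets \<pi> = sets (borel \<Otimes>\<^sub>M borel)" by (rule couplings_sets[OF \<pi>])
  have s\<nu>: "sets \<nu> = sets borel" by (rule couplings_snd_sets[OF \<pi>])
  define c where "c v = (of_nat (count (mset xs) v) :: ennreal)" for v
  have c: "c (xs ! i) \<noteq> 0" "c (xs ! i) \<noteq> \<top>" if "i < length xs" for i
  proof -
    have "xs ! i \<in># mset xs" using that by simp
    then show "c (xs ! i) \<noteq> 0" by (simp add: c_def count_greater_zero_iff)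
    show "c (xs ! i) \<noteq> \<top>" by (simp add: c_def ennreal_of_nat_eq_real_of_nat)
  qed
  \<comment> \<open>\<open>\<rho> i\<close> is the share of the target that \<open>\<pi>\<close>
    assigns to point number \<open>i\<close>. Each share has mass one and the shares add up to
    \<open>\<nu>\<close>, so the moved point \<open>ys ! i\<close> can be coupled with its own
    share.\<close>
  define \<rho> where "\<rho> i = distr (density \<pi> (\<lambda>z. indicator {xs ! i} (fst z) / c (xs ! i))) borel snd" for i
  have s\<rho> [simp]: "sets (\<rho> i) = sets borel" for i by (simp add: \<rho>_def)
  have \<rho>_int: "(\<integral>\<^sup>+ z. f z \<partial>\<rho> i) = (\<integral>\<^sup>+ z. indicator {xs ! i} (fst z) * f (snd z) \<partial>\<pi>) / c (xs ! i)"
    if [measurable]: "f \<in> borel_measurable borel" for f i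
  proof -
    have "(\<integral>\<^sup>+ z. f z \<partial>\<rho> i) = (\<integral>\<^sup>+ z. indicator {xs ! i} (fst z) / c (xs ! i) * f (snd z) \<partial>\<pi>)"
      unfolding \<rho>_def by (subst nn_integral_distr; (subst nn_integral_density)?) auto
    also have "\<dots> = (\<integral>\<^sup>+ z. (indicator {xs ! i} (fst z) * f (snd z)) / c (xs ! i) \<partial>\<pi>)"
      by (intro nn_integral_cong) (simp add: divide_ennreal_def mult_ac)
    also have "\<dots> = (\<integral>\<^sup>+ z. indicator {xs ! i} (fst z) * f (snd z) \<partial>\<pi>) / c (xs ! i)"
      by (intro nn_integral_divide) auto
    finally show ?thesis .
  qed
  have \<rho>_em: "emeasure (\<rho> i) A = emeasure \<pi> ({xs ! i} \<times> A) / c (xs ! i)" if A [measurable]: "A \<in> sets borel" for A i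
  proof -
    have "emeasure (\<rho> i) A = (\<integral>\<^sup>+ z. indicator A z \<partial>\<rho> i)" using A by simp
    also have "\<dots> = (\<integral>\<^sup>+ z. indicator {xs ! i} (fst z) * indicator A (snd z) \<partial>\<pi>) / c (xs ! i)"
      by (intro \<rho>_int) simp
    also have "(\<integral>\<^sup>+ z. indicator {xs ! i} (fst z) * indicator A (snd z) \<partial>\<pi>) = (\<integral>\<^sup>+ z. indicator ({xs ! i} \<times> A) z \<partial>\<pi>)"
      by (intro nn_integral_cong) (auto simp: indicator_def)
    also have "\<dots> = emeasure \<pi> ({xs ! i} \<times> A)"
      by (intro nn_integral_indicator) (simp add: s\<pi>)
    finally show ?thesis .
  qed
  have bx: "- set xs \<in> sets borel"
    by (intro borel_comp borel_closed finite_imp_closed) simp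
  have offx: "emeasure \<pi> ((- set xs) \<times> UNIV) = 0"
    by (subst couplings_fst[OF \<pi> bx]) (auto simp: emeasure_atoms[OF bx] filter_mset_eq_mempty_iff)
  have AEx: "AE z in \<pi>. fst z \<in> set xs"
    by (rule AE_I[OF _ offx]) (use bx in \<open>auto simp: sp s\<pi>\<close>)
  have sum_A: "(\<Sum>v\<in>set xs. (\<integral>\<^sup>+ z. indicator {v} (fst z) * f z \<partial>\<pi>)) = (\<integral>\<^sup>+ z. f z \<partial>\<pi>)"
    if [measurable]: "f \<in> borel_measurable (borel \<Otimes>\<^sub>M borel)" for f
  proof -
    have "(\<Sum>v\<in>set xs. (\<integral>\<^sup>+ z. indicator {v} (fst z) * f z \<partial>\<pi>)) = (\<integral>\<^sup>+ z. (\<Sum>v\<in>set xs. indicator {v} (fst z) * f z) \<partial>\<pi>)"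
      by (intro nn_integral_sum[symmetric]) auto
    also have "\<dots> = (\<integral>\<^sup>+ z. f z \<partial>\<pi>)"
    proof (rule nn_integral_cong_AE, use AEx in eventually_elim)
      fix z :: "(real ^ 'd) \<times> (real ^ 'd)" assume z: "fst z \<in> set xs"
      have "(\<Sum>v\<in>set xs. indicator {v} (fst z) * f z) = (\<Sum>v\<in>set xs. if v = fst z then f z else 0)"
        by (intro sum.cong) (auto simp: indicator_def)
      also have "\<dots> = f z" using z by simp
      finally show "(\<Sum>v\<in>set xs. indicator {v} (fst z) * f z) = f z" .
    qed
    finally show ?thesis .
  qed
  have tot: "emeasure \<nu> A = (\<Sum>i<length xs. emeasure (\<rho> i) A)" if A [measurable]: "A \<in> sets borel" for A
  proof -
    have "(\<Sum>i<length xs. emeasure (\<rho> i) A) = (\<Sum>i<length xs. emeasure \<pi> ({xs ! i} \<times> A) / c (xs ! i))"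
      by (simp add: \<rho>_em)
    also have "\<dots> = (\<Sum>v\<in>set xs. emeasure \<pi> ({v} \<times> A))"
      unfolding c_def by (rule sum_div_count)
    also have "\<dots> = (\<Sum>v\<in>set xs. (\<integral>\<^sup>+ z. indicator {v} (fst z) * indicator (UNIV \<times> A) z \<partial>\<pi>))"
    proof (intro sum.cong refl)
      fix v
      have "emeasure \<pi> ({v} \<times> A) = (\<integral>\<^sup>+ z. indicator ({v} \<times> A) z \<partial>\<pi>)"
        by (intro nn_integral_indicator[symmetric]) (simp add: s\<pi>)
      also have "\<dots> = (\<integral>\<^sup>+ z. indicator {v} (fst z) * indicator (UNIV \<times> A) z \<partial>\<pi>)"
        by (intro nn_integral_cong) (auto simp: indicator_def)
      finally show "emeasure \<pi> ({v} \<times> A) = (\<integral>\<^sup>+ z. indicator {v} (fst z) * indicator (UNIV \<times> A) z \<partial>\<pi>)" .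
    qed
    also have "\<dots> = (\<integral>\<^sup>+ z. indicator (UNIV \<times> A) z \<partial>\<pi>)"
      by (intro sum_A) simp
    also have "\<dots> = emeasure \<pi> (UNIV \<times> A)"
      by (intro nn_integral_indicator) (simp add: s\<pi>)
    finally show ?thesis using couplings_snd[OF \<pi> A] by simp
  qed
  have \<rho>1: "emeasure (\<rho> i) UNIV = 1" if "i < length xs" for i
  proof -
    have "emeasure (\<rho> i) UNIV = emeasure (atoms (mset xs)) {xs ! i} / c (xs ! i)"
      using couplings_fst[OF \<pi>, of "{xs ! i}"] by (simp add: \<rho>_em)
    also have "emeasure (atoms (mset xs)) {xs ! i} = c (xs ! i)"
      by (simp add: emeasure_atoms c_def) (metis count_mset_gt_0 filter_eq_replicate_mset size_replicate_mset)
    finally show ?thesis using c[OF that] by (simp add: ennreal_divide_self less_top)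
  qed
  let ?g = "\<lambda>z. ennreal (K1 p e) * ennreal (norm (fst z - snd z) powr p) + ennreal (K2 p e * \<delta> powr p)"
  have "ot p (atoms (mset ys)) \<nu> \<le> (\<Sum>i<length xs. 1 * ot p (atoms {#ys ! i#}) (\<rho> i))"
  proof (rule ot_wsum_le)
    fix A :: "(real ^ 'd) set" assume A: "A \<in> sets borel"
    show "emeasure (atoms (mset ys)) A = (\<Sum>i<length xs. 1 * emeasure (atoms {#ys ! i#}) A)"
      using emeasure_atoms_list[OF A, of ys] emeasure_atoms_list[OF A, of "[_]"] by (simp add: len del: sum_indicator_eq_card)
    show "emeasure \<nu> A = (\<Sum>i<length xs. 1 * emeasure (\<rho> i) A)"
      using tot[OF A] by simp
  qed (simp_all add: s\<nu>)
  also have "\<dots> \<le> (\<Sum>i<length xs. (\<integral>\<^sup>+ z. indicator {xs ! i} (fst z) * ?g z \<partial>\<pi>) / c (xs ! i))"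
  proof (rule sum_mono)
    fix i assume "i \<in> {..<length xs}"
    then have i: "i < length xs" by simp
    have "1 * ot p (atoms {#ys ! i#}) (\<rho> i) \<le> (\<integral>\<^sup>+ z. ennreal (norm (ys ! i - z) powr p) \<partial>\<rho> i)"
      using ot_single_le[OF s\<rho> \<rho>1[OF i]] by simp
    also have "\<dots> = (\<integral>\<^sup>+ z. indicator {xs ! i} (fst z) * ennreal (norm (ys ! i - snd z) powr p) \<partial>\<pi>) / c (xs ! i)"
      by (intro \<rho>_int) measurable
    also have "\<dots> \<le> (\<integral>\<^sup>+ z. indicator {xs ! i} (fst z) * ?g z \<partial>\<pi>) / c (xs ! i)"
    proof (intro divide_right_mono_ennreal nn_integral_mono)
      fix z :: "(real ^ 'd) \<times> (real ^ 'd)"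
      show "indicator {xs ! i} (fst z) * ennreal (norm (ys ! i - snd z) powr p) \<le> indicator {xs ! i} (fst z) * ?g z"
        using cost_triangle[OF d[OF i] e p, of "snd z"] by (auto simp: indicator_def)
    qed
    finally show "1 * ot p (atoms {#ys ! i#}) (\<rho> i) \<le> (\<integral>\<^sup>+ z. indicator {xs ! i} (fst z) * ?g z \<partial>\<pi>) / c (xs ! i)" .
  qed
  also have "\<dots> = (\<Sum>v\<in>set xs. (\<integral>\<^sup>+ z. indicator {v} (fst z) * ?g z \<partial>\<pi>))"
    unfolding c_def by (rule sum_div_count)
  also have "\<dots> = (\<integral>\<^sup>+ z. ?g z \<partial>\<pi>)"
    by (intro sum_A) measurable
  also have "\<dots> = ennreal (K1 p e) * (\<integral>\<^sup>+ z. ennreal (norm (fst z - snd z) powr p) \<partial>\<pi>) + ennreal (K2 p e * \<delta> powr p) * of_nat (length xs)"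
    by (subst nn_integral_add; simp add: nn_integral_cmult sp emeasure_coupling_UNIV(1)[OF \<pi>])
  finally show "ot p (atoms (mset ys)) \<nu> \<le> \<dots>" .
qed (use K1_pos[OF e, of p] in auto)

section \<open>Uniform measures on sets\<close>

definition unif :: "(real ^ 'd) set \<Rightarrow> ennreal \<Rightarrow> (real ^ 'd) measure"
  where "unif B c = density lborel (\<lambda>x. c * indicator B x)"

lemma sets_unif [simp]: "sets (unif B c) = sets borel" and space_unif [simp]: "space (unif B c) = UNIV"
  by (simp_all add: unif_def)

lemma emeasure_unif:
  assumes [measurable]: "A \<in> sets borel" "B \<in> sets borel"
  shows "emeasure (unif B c) A = c * emeasure lborel (A \<inter> B)"
proof -
  have "emeasure (unif B c) A = (\<integral>\<^sup>+ x. c * indicator B x * indicator A x \<partial>lborel)"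
    unfolding unif_def by (intro emeasure_density) auto
  also have "\<dots> = (\<integral>\<^sup>+ x. c * indicator (A \<inter> B) x \<partial>lborel)"
    by (intro nn_integral_cong) (auto simp: indicator_def)
  also have "\<dots> = c * emeasure lborel (A \<inter> B)"
    by (intro nn_integral_cmult_indicator) auto
  finally show ?thesis .
qed

lemma density_const_indicator:
  "B \<in> sets borel \<Longrightarrow> density (density lborel (\<lambda>_. c)) (indicator B) = unif B c"
  unfolding unif_def by (subst density_density_eq) auto

lemma emeasure_cbox_cart:
  fixes a b :: "real ^ 'd"
  assumes "\<And>k. a $ k \<le> b $ k"
  shows "emeasure lborel (cbox a b) = ennreal (\<Prod>k\<in>UNIV. b $ k - a $ k)"
proof -
  have "cbox a b \<noteq> {}" using assms by (auto simp: interval_ne_empty_cart)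
  then have "measure lborel (cbox a b) = (\<Prod>k\<in>UNIV. b $ k - a $ k)"
    by (rule content_cbox_cart)
  then show ?thesis
    using emeasure_lborel_cbox_finite[of a b] by (simp add: emeasure_eq_ennreal_measure)
qed

lemma ot_null:
  assumes "sets \<mu> = sets borel" "sets \<nu> = sets borel" "emeasure \<mu> UNIV = 0" "emeasure \<nu> UNIV = 0"
  shows "ot p \<mu> \<nu> = 0"
proof -
  have z: "emeasure \<mu> A = 0" "emeasure \<nu> A = 0" if "A \<in> sets borel" for A
    using emeasure_mono[of A UNIV \<mu>] emeasure_mono[of A UNIV \<nu>] assms that by auto
  have "null_measure (borel \<Otimes>\<^sub>M borel) \<in> couplings \<mu> \<nu>"
    using assms z by (intro couplingsI) auto
  from ot_le[OF this, of p] show ?thesis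
    by simp
qed

section \<open>Cutting a box\<close>

lemma prod_Basis_cart:
  fixes s :: "real ^ 'd"
  shows "(\<Prod>j\<in>Basis. f (s \<bullet> j)) = (\<Prod>k\<in>UNIV. f (s $ k))"
proof -
  have B: "(Basis :: (real ^ 'd) set) = range (\<lambda>k. axis k 1)"
    by (auto simp: Basis_vec_def)
  have "inj (\<lambda>k::'d. axis k (1::real))"
    by (auto simp: inj_on_def axis_eq_axis)
  then show ?thesis
    unfolding B by (subst prod.reindex) (auto simp: inner_axis)
qed

definition aff :: "real ^ 'd \<Rightarrow> real ^ 'd \<Rightarrow> real ^ 'd \<Rightarrow> real ^ 'd"
  where "aff t s x = (\<chi> k. t $ k + s $ k * x $ k)"

lemma aff_nth [simp]: "aff t s x $ k = t $ k + s $ k * x $ k"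
  by (simp add: aff_def)

text \<open>This is the shape of the maps in the change of variables formula
  \<open>lborel_affine_euclidean\<close>, and one whose measurability is automatic.\<close>

lemma aff_eq_sum:
  fixes t s x :: "real ^ 'd"
  shows "aff t s x = t + (\<Sum>j\<in>Basis. ((s \<bullet> j) * (x \<bullet> j)) *\<^sub>R j)"
proof (rule euclidean_eqI)
  fix b :: "real ^ 'd" assume b: "b \<in> Basis"
  then obtain k where k: "b = axis k 1" by (auto simp: Basis_vec_def)
  have "(t + (\<Sum>j\<in>Basis. ((s \<bullet> j) * (x \<bullet> j)) *\<^sub>R j)) \<bullet> b = t \<bullet> b + (s \<bullet> b) * (x \<bullet> b)"
    using b by (simp add: inner_add_left inner_sum_left_Basis)
  then show "aff t s x \<bullet> b = (t + (\<Sum>j\<in>Basis. ((s \<bullet> j) * (x \<bullet> j)) *\<^sub>R j)) \<bullet> b"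
    by (simp add: k inner_axis)
qed

lemma aff_measurable [measurable]: "aff t s \<in> borel \<rightarrow>\<^sub>M borel"
  unfolding aff_eq_sum[abs_def] by measurable

lemma emeasure_aff_vimage:
  fixes t s :: "real ^ 'd"
  assumes s: "\<And>k. s $ k > 0" and A [measurable]: "A \<in> sets borel"
  shows "emeasure lborel A = ennreal (\<Prod>k\<in>UNIV. s $ k) * emeasure lborel (aff t s -` A)"
proof -
  have nz: "s \<bullet> j \<noteq> 0" if j: "j \<in> Basis" for j
  proof -
    obtain k where "j = axis k 1" using j by (auto simp: Basis_vec_def)
    then show ?thesis using s[of k] by (simp add: inner_axis)
  qed
  have "lborel = density (distr lborel borel (aff t s)) (\<lambda>_. ennreal (\<Prod>k\<in>UNIV. \<bar>s $ k\<bar>))"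
    using lborel_affine_euclidean[of "\<lambda>j. s \<bullet> j" t] nz
    unfolding aff_eq_sum[abs_def] by (simp add: prod_Basis_cart[of abs s])
  then have "emeasure lborel A = emeasure (density (distr lborel borel (aff t s)) (\<lambda>_. ennreal (\<Prod>k\<in>UNIV. \<bar>s $ k\<bar>))) A"
    by simp
  also have "\<dots> = ennreal (\<Prod>k\<in>UNIV. \<bar>s $ k\<bar>) * emeasure (distr lborel borel (aff t s)) A"
    by (simp add: emeasure_density_const)
  also have "\<dots> = ennreal (\<Prod>k\<in>UNIV. s $ k) * emeasure lborel (aff t s -` A)"
    using s by (simp add: emeasure_distr less_imp_le)
  finally show ?thesis .
qed

lemma aff_mem_cbox_iff:
  assumes s: "\<And>k. s $ k > 0"
  shows "aff t s x \<in> cbox (aff t s a) (aff t s b) \<longleftrightarrow> x \<in> cbox a b"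
  using s by (simp add: mem_box_cart)

lemma distr_unif_aff:
  fixes t s :: "real ^ 'd"
  assumes s: "\<And>k. s $ k > 0"
  shows "distr (unif (cbox a b) c) borel (aff t s) = unif (cbox (aff t s a) (aff t s b)) (c / ennreal (\<Prod>k\<in>UNIV. s $ k))"
proof (rule measure_eqI)
  fix A assume "A \<in> sets (distr (unif (cbox a b) c) borel (aff t s))"
  then have A [measurable]: "A \<in> sets borel" by simp
  have m: "aff t s \<in> measurable (unif (cbox a b) c) borel"
    using aff_measurable by (subst measurable_cong_sets[OF sets_unif refl])
  have v: "aff t s -` A \<in> sets borel"
    using measurable_sets[OF aff_measurable A] by simp
  let ?P = "ennreal (\<Prod>k\<in>UNIV. s $ k)"
  have P: "?P \<noteq> 0" "?P \<noteq> \<top>"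
    using s by (auto simp: prod_pos ennreal_eq_0_iff not_le)
  have "emeasure (distr (unif (cbox a b) c) borel (aff t s)) A = c * emeasure lborel (aff t s -` A \<inter> cbox a b)"
    by (simp add: emeasure_distr[OF m] emeasure_unif v)
  also have "aff t s -` A \<inter> cbox a b = aff t s -` (A \<inter> cbox (aff t s a) (aff t s b))"
    using aff_mem_cbox_iff[OF s] by auto
  also have "c * emeasure lborel \<dots> = (c / ?P) * (?P * emeasure lborel (aff t s -` (A \<inter> cbox (aff t s a) (aff t s b))))"
    using P by (simp add: divide_ennreal_def mult.assoc) (simp add: ennreal_divide_self mult.assoc[symmetric] mult.commute divide_ennreal_def[symmetric])
  also have "\<dots> = (c / ?P) * emeasure lborel (A \<inter> cbox (aff t s a) (aff t s b))"
    by (subst (2) emeasure_aff_vimage[OF s, of _ t]) auto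
  also have "\<dots> = emeasure (unif (cbox (aff t s a) (aff t s b)) (c / ?P)) A"
    by (simp add: emeasure_unif)
  finally show "emeasure (distr (unif (cbox a b) c) borel (aff t s)) A = emeasure (unif (cbox (aff t s a) (aff t s b)) (c / ?P)) A" .
qed simp

section \<open>Boxes and cuts by a hyperplane\<close>

abbreviation vol :: "real ^ 'd \<Rightarrow> real ^ 'd \<Rightarrow> real"
  where "vol a b \<equiv> (\<Prod>k\<in>UNIV. b $ k - a $ k)"

definition upd :: "real ^ 'd \<Rightarrow> 'd \<Rightarrow> real \<Rightarrow> real ^ 'd"
  where "upd a i c = (\<chi> k. if k = i then c else a $ k)"

lemma upd_nth [simp]: "upd a i c $ k = (if k = i then c else a $ k)"
  by (simp add: upd_def)

lemma vol_split: "vol a b = (b $ i - a $ i) * (\<Prod>k\<in>UNIV - {i}. b $ k - a $ k)"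
  by (subst prod.remove[of UNIV i]) auto

lemma vol_upd:
  "vol a (upd b i c) = (c - a $ i) * (\<Prod>k\<in>UNIV - {i}. b $ k - a $ k)"
  "vol (upd a i c) b = (b $ i - c) * (\<Prod>k\<in>UNIV - {i}. b $ k - a $ k)"
  unfolding vol_split[where a = a and i = i] vol_split[where b = b and i = i] by (auto intro!: prod.cong)

text \<open>The target is moved by an affine map, so that no two couplings have to be glued.\<close>

lemma ot_stretch:
  fixes a b :: "real ^ 'd"
  assumes ab: "\<And>k. a $ k < b $ k" and lu: "l < u" and d: "\<bar>l - a $ i\<bar> \<le> \<delta>" "\<bar>u - b $ i\<bar> \<le> \<delta>"
    and m: "m \<ge> 0" and p: "p \<ge> 0" and e: "e > 0"
  shows "ot p \<mu> (unif (cbox (upd a i l) (upd b i u)) (ennreal (m / vol (upd a i l) (upd b i u)))) \<le>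
    ennreal (K1 p e) * ot p \<mu> (unif (cbox a b) (ennreal (m / vol a b))) + ennreal (K2 p e * \<delta> powr p) * ennreal m"
proof -
  define r where "r = (u - l) / (b $ i - a $ i)"
  have r: "r > 0" using ab lu by (simp add: r_def)
  \<comment> \<open>Only coordinate \<open>i\<close> is changed: the interval from
    \<open>a $ i\<close> to \<open>b $ i\<close> is mapped affinely onto the one from
    \<open>l\<close> to \<open>u\<close>.\<close>
  define s :: "real ^ 'd" where "s = upd 1 i r"
  define t :: "real ^ 'd" where "t = upd 0 i (l - r * a $ i)"
  have s: "s $ k > 0" for k using r by (simp add: s_def)
  have ra: "r * (b $ i - a $ i) = u - l" using ab[of i] by (simp add: r_def)
  have Ta: "aff t s a = upd a i l" "aff t s b = upd b i u"
    using ra by (auto simp: vec_eq_iff s_def t_def algebra_simps)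
  have ps: "(\<Prod>k\<in>UNIV. s $ k) = r"
    by (subst prod.remove[of UNIV i]) (auto simp: s_def)
  have V: "vol a b > 0" using ab by (intro prod_pos) simp
  have vr: "vol (upd a i l) (upd b i u) = r * vol a b"
    unfolding vol_upd(1)[where a = "upd a i l"] vol_split[where a = a and b = b and i = i] using ra by (auto intro!: prod.cong)
  have "distr (unif (cbox a b) (ennreal (m / vol a b))) borel (aff t s) =
      unif (cbox (upd a i l) (upd b i u)) (ennreal (m / vol a b) / ennreal r)"
    by (subst distr_unif_aff[OF s]) (simp add: Ta ps)
  also have "ennreal (m / vol a b) / ennreal r = ennreal (m / vol (upd a i l) (upd b i u))"
    unfolding vr using m r V by (subst divide_ennreal) (auto simp: mult.commute)
  finally have D: "unif (cbox (upd a i l) (upd b i u)) (ennreal (m / vol (upd a i l) (upd b i u))) =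
      distr (unif (cbox a b) (ennreal (m / vol a b))) borel (aff t s)" ..
  have disp: "norm (aff t s y - y) \<le> \<delta>" if y: "y \<in> cbox a b" for y
  proof -
    have "aff t s y - y = axis i (l + r * (y $ i - a $ i) - y $ i)"
      by (auto simp: vec_eq_iff axis_def s_def t_def algebra_simps)
    then have n: "norm (aff t s y - y) = \<bar>l + r * (y $ i - a $ i) - y $ i\<bar>"
      using norm_scaleR[of _ "axis i (1 :: real)"] by (simp add: norm_eq_sqrt_inner inner_axis_axis)
    \<comment> \<open>The displacement is affine in \<open>y $ i\<close>, hence it is the convex
      combination, with weights \<open>1 - \<theta>\<close> and \<open>\<theta>\<close>, of the
      displacements of the two end faces.\<close>
    define \<theta> where "\<theta> = (y $ i - a $ i) / (b $ i - a $ i)"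
    have \<theta>: "0 \<le> \<theta>" "\<theta> \<le> 1" using y ab[of i] by (auto simp: \<theta>_def mem_box_cart divide_simps)
    have yi: "y $ i = a $ i + \<theta> * (b $ i - a $ i)" using ab[of i] by (simp add: \<theta>_def)
    have "l + r * (y $ i - a $ i) - y $ i = (1 - \<theta>) * (l - a $ i) + \<theta> * (u - b $ i)"
      using ra by (simp add: yi algebra_simps) (metis (no_types, opaque_lifting) distrib_left mult.left_commute right_diff_distrib)
    also have "\<bar>\<dots>\<bar> \<le> (1 - \<theta>) * \<bar>l - a $ i\<bar> + \<theta> * \<bar>u - b $ i\<bar>"
      using \<theta> by (intro order_trans[OF abs_triangle_ineq]) (simp add: abs_mult)
    also have "\<dots> \<le> (1 - \<theta>) * \<delta> + \<theta> * \<delta>"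
      using \<theta> d by (intro add_mono mult_left_mono) auto
    finally show ?thesis using n by (simp add: algebra_simps)
  qed
  have "AE y in unif (cbox a b) (ennreal (m / vol a b)). norm (aff t s y - y) \<le> \<delta>"
    unfolding unif_def by (subst AE_density) (auto intro!: AE_I2 disp simp: indicator_def)
  then have "ot p \<mu> (distr (unif (cbox a b) (ennreal (m / vol a b))) borel (aff t s)) \<le>
     ennreal (K1 p e) * ot p \<mu> (unif (cbox a b) (ennreal (m / vol a b))) + ennreal (K2 p e * \<delta> powr p) *
      emeasure (unif (cbox a b) (ennreal (m / vol a b))) UNIV"
    by (intro ot_distr_right_le p e) auto
  also have "emeasure (unif (cbox a b) (ennreal (m / vol a b))) UNIV = ennreal m"
  proof -
    have q: "m / v * v = m" if "v > 0" for v :: real using that by simp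
    have "emeasure (unif (cbox a b) (ennreal (m / vol a b))) UNIV = ennreal (m / vol a b) * ennreal (vol a b)"
      using ab by (simp add: emeasure_unif emeasure_cbox_cart less_imp_le)
    also have "\<dots> = ennreal (m / vol a b * vol a b)"
      using V m by (intro ennreal_mult[symmetric]) (simp_all add: less_imp_le)
    finally show ?thesis by (simp only: q[OF V])
  qed
  finally show ?thesis unfolding D .
qed

definition box_cost :: "real \<Rightarrow> (real ^ 'd) measure \<Rightarrow> (real ^ 'd) set \<Rightarrow> ennreal"
  where "box_cost p \<mu> B = transport_cost p B \<mu> (density lborel (\<lambda>_. emeasure \<mu> B / emeasure lborel B))"

lemma box_cost_eq: "B \<in> sets borel \<Longrightarrow> box_cost p \<mu> B = ot p (density \<mu> (indicator B)) (unif B (emeasure \<mu> B / emeasure lborel B))"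
  by (simp add: box_cost_def transport_cost_eq_ot density_const_indicator)

lemma emeasure_density_indicator':
  assumes "sets \<mu> = sets borel" "A \<in> sets borel" "B \<in> sets borel"
  shows "emeasure (density \<mu> (indicator B)) A = emeasure \<mu> (A \<inter> B)"
proof -
  have "emeasure (density \<mu> (indicator B)) A = (\<integral>\<^sup>+ x. indicator B x * indicator A x \<partial>\<mu>)"
    using assms by (intro emeasure_density) (auto simp: measurable_cong_sets[OF assms(1) refl])
  also have "\<dots> = (\<integral>\<^sup>+ x. indicator (A \<inter> B) x \<partial>\<mu>)"
    by (intro nn_integral_cong) (auto simp: indicator_def)
  also have "\<dots> = emeasure \<mu> (A \<inter> B)"
    using assms by simp
  finally show ?thesis .
qed

lemma box_cost_box:
  fixes a b :: "real ^ 'd"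
  assumes ab: "\<And>k. a $ k < b $ k" and m: "emeasure \<mu> (cbox a b) = ennreal m" "m \<ge> 0"
  shows "box_cost p \<mu> (cbox a b) = ot p (density \<mu> (indicator (cbox a b))) (unif (cbox a b) (ennreal (m / vol a b)))"
proof -
  have V: "vol a b > 0" using ab by (intro prod_pos) simp
  then show ?thesis using ab m
    by (simp add: box_cost_eq emeasure_cbox_cart less_imp_le divide_ennreal)
qed

lemma mem_cbox_upd:
  fixes a b :: "real ^ 'd"
  assumes c: "a $ i \<le> c" "c \<le> b $ i"
  shows "x \<in> cbox a (upd b i c) \<longleftrightarrow> x \<in> cbox a b \<and> x $ i \<le> c"
    and "x \<in> cbox (upd a i c) b \<longleftrightarrow> x \<in> cbox a b \<and> c \<le> x $ i"
    and "x \<in> cbox (upd a i c) (upd b i c) \<longleftrightarrow> x \<in> cbox a b \<and> x $ i = c"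
proof -
  have *: "(\<forall>k. P k \<and> (if k = i then A k else B k)) \<longleftrightarrow> (\<forall>k. P k \<and> B k) \<and> A i" if "A i \<Longrightarrow> B i" for P A B :: "'d \<Rightarrow> bool"
    using that by metis
  have if_le: "y \<le> (if k = i then u else v) \<longleftrightarrow> (if k = i then y \<le> u else y \<le> v)"
    "(if k = i then u else v) \<le> y \<longleftrightarrow> (if k = i then u \<le> y else v \<le> y)" for k and y u v :: real
    by auto
  show "x \<in> cbox a (upd b i c) \<longleftrightarrow> x \<in> cbox a b \<and> x $ i \<le> c"
    unfolding mem_box_cart upd_nth if_le using c by (subst *) auto
  have **: "(\<forall>k. (if k = i then A k else B k) \<and> P k) \<longleftrightarrow> (\<forall>k. B k \<and> P k) \<and> A i" if "A i \<Longrightarrow> B i" for P A B :: "'d \<Rightarrow> bool"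
    using that by metis
  show "x \<in> cbox (upd a i c) b \<longleftrightarrow> x \<in> cbox a b \<and> c \<le> x $ i"
    unfolding mem_box_cart upd_nth if_le using c by (subst **) auto
  have ***: "(\<forall>k. (if k = i then A k else B k) \<and> (if k = i then A' k else B' k)) \<longleftrightarrow> (\<forall>k. B k \<and> B' k) \<and> A i \<and> A' i"
    if "A i \<and> A' i \<Longrightarrow> B i \<and> B' i" for A B A' B' :: "'d \<Rightarrow> bool"
    using that by metis
  show "x \<in> cbox (upd a i c) (upd b i c) \<longleftrightarrow> x \<in> cbox a b \<and> x $ i = c"
    unfolding mem_box_cart upd_nth if_le using c by (subst ***) auto
qed

lemma cbox_cut:
  fixes a b :: "real ^ 'd"
  assumes "a $ i \<le> c" "c \<le> b $ i"
  shows "cbox a b = cbox a (upd b i c) \<union> cbox (upd a i c) b"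
    and "cbox a (upd b i c) \<inter> cbox (upd a i c) b = cbox (upd a i c) (upd b i c)"
  using mem_cbox_upd[OF assms] by (auto intro: linear)

lemma emeasure_hyperplane_slab:
  fixes a b :: "real ^ 'd" shows "emeasure lborel (cbox (upd a i c) (upd b i c)) = 0"
proof (cases "\<forall>k. upd a i c $ k \<le> upd b i c $ k")
  case True
  then have "emeasure lborel (cbox (upd a i c) (upd b i c)) = ennreal (vol (upd a i c) (upd b i c))"
    by (intro emeasure_cbox_cart) blast
  also have "vol (upd a i c) (upd b i c) = 0"
    by (auto intro!: prod_zero exI[of _ i])
  finally show ?thesis by simp
next
  case False
  then have "cbox (upd a i c) (upd b i c) = {}"
    by (metis interval_ne_empty_cart(1))
  then show ?thesis by (simp only: emeasure_empty)
qed

text \<open>The closed halves overlap in a face, so additivity needs that face to be null. For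
  Lebesgue measure it always is; for a Poisson process this holds almost surely.\<close>

lemma emeasure_cut:
  fixes a b :: "real ^ 'd"
  assumes c: "a $ i \<le> c" "c \<le> b $ i" and s: "sets \<mu> = sets borel" and A: "A \<in> sets borel"
    and 0: "emeasure \<mu> (cbox (upd a i c) (upd b i c)) = 0"
  shows "emeasure \<mu> (A \<inter> cbox a b) = emeasure \<mu> (A \<inter> cbox a (upd b i c)) + emeasure \<mu> (A \<inter> cbox (upd a i c) b)"
proof -
  let ?H = "A \<inter> cbox a (upd b i c) \<inter> cbox (upd a i c) b"
  have "A \<inter> cbox a b = A \<inter> cbox a (upd b i c) \<union> (A \<inter> cbox (upd a i c) b - ?H)"
    using cbox_cut(1)[OF c] by auto
  then have "emeasure \<mu> (A \<inter> cbox a b) = emeasure \<mu> (A \<inter> cbox a (upd b i c)) + emeasure \<mu> (A \<inter> cbox (upd a i c) b - ?H)"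
    using A s by (simp only:) (intro plus_emeasure[symmetric]; auto)
  also have "emeasure \<mu> (A \<inter> cbox (upd a i c) b - ?H) = emeasure \<mu> (A \<inter> cbox (upd a i c) b)"
  proof (rule emeasure_Diff_null_set)
    have "?H \<subseteq> cbox (upd a i c) (upd b i c)" using cbox_cut(2)[OF c] by auto
    moreover have "cbox (upd a i c) (upd b i c) \<in> null_sets \<mu>"
      using 0 s by (simp add: null_sets_def)
    moreover have "?H \<in> sets \<mu>"
      unfolding s using A by (intro sets.Int) simp_all
    ultimately show "?H \<in> null_sets \<mu>"
      using null_sets_subset by blast
  qed (use A s in simp)
  finally show ?thesis .
qed

text \<open>The uniform target on the whole box is cut at the hyperplane \<open>c'\<close> that
  leaves on each side exactly the number of points in the corresponding half. Each half then pays
  its own cost plus the stretch that moves the inner face from \<open>c\<close> to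
  \<open>c'\<close>, and \<open>\<bar>c' - c\<bar>\<close> is the side length times the deviation of
  the fraction of points.\<close>

lemma box_cost_split:
  fixes a b :: "real ^ 'd"
  assumes ab: "\<And>k. a $ k < b $ k" and c: "a $ i < c" "c < b $ i" and s: "sets \<mu> = sets borel"
    and 0: "emeasure \<mu> (cbox (upd a i c) (upd b i c)) = 0"
    and n1: "emeasure \<mu> (cbox a (upd b i c)) = ennreal n1" "n1 \<ge> 0"
    and n2: "emeasure \<mu> (cbox (upd a i c) b) = ennreal n2" "n2 \<ge> 0"
    and p: "p \<ge> 1" and e: "e > 0"
  shows "box_cost p \<mu> (cbox a b) \<le> ennreal (K1 p e) * (box_cost p \<mu> (cbox a (upd b i c)) + box_cost p \<mu> (cbox (upd a i c) b))
     + ennreal (K2 p e * (((b $ i - a $ i) * \<bar>n1 / (n1 + n2) - (c - a $ i) / (b $ i - a $ i)\<bar>) powr p * (n1 + n2)))"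
proof -
  define R1 R2 where "R1 = cbox a (upd b i c)" and "R2 = cbox (upd a i c) b"
  define N where "N = n1 + n2"
  have N: "emeasure \<mu> (cbox a b) = ennreal N" "N \<ge> 0"
    using emeasure_cut[of a i c b \<mu> UNIV] c s 0 n1 n2 by (auto simp: N_def)
  show ?thesis
  proof (cases "N = 0")
    case True
    then have "box_cost p \<mu> (cbox a b) = 0"
      using N s by (subst box_cost_eq, simp) (intro ot_null; simp add: emeasure_density_indicator' emeasure_unif)
    then show ?thesis by simp
  next
    case False
    then have N0: "N > 0" using N by simp
    define S where "S = b $ i - a $ i"
    have S: "S > 0" using ab[of i] by (simp add: S_def)
    \<comment> \<open>The uniform measure of total mass \<open>N\<close> has mass \<open>n1\<close>
      to the left of \<open>c'\<close>.\<close>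
    define c' where "c' = a $ i + S * (n1 / N)"
    define \<delta> where "\<delta> = S * \<bar>n1 / N - (c - a $ i) / S\<bar>"
    have \<delta>: "\<bar>c' - c\<bar> = \<delta>" "\<delta> \<ge> 0"
    proof -
      have "c' - c = S * (n1 / N - (c - a $ i) / S)" using S by (simp add: c'_def field_simps)
      then show "\<bar>c' - c\<bar> = \<delta>" using S by (simp add: \<delta>_def abs_mult)
    qed (use S in \<open>simp add: \<delta>_def\<close>)
    have frac: "0 \<le> n1 / N" "n1 / N \<le> 1" using n1 n2 N0 by (auto simp: N_def)
    have c'b: "a $ i \<le> c'" "c' \<le> b $ i"
      using mult_nonneg_nonneg[of S "n1 / N"] mult_left_le[of "n1 / N" S] S frac unfolding c'_def by (auto simp: S_def)
    define W where "W = (\<Prod>k\<in>UNIV - {i}. b $ k - a $ k)"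
    have W: "W > 0" using ab by (auto simp: W_def intro!: prod_pos)
    have VR: "vol a b = S * W" by (simp add: W_def S_def vol_split[where a = a and b = b and i = i])
    have ab1: "a $ k < upd b i c $ k" "upd a i c $ k < b $ k" for k using ab c by auto
    define \<kappa> where "\<kappa> = ennreal (N / vol a b)"
    let ?L1 = "cbox a (upd b i c')" and ?L2 = "cbox (upd a i c') b"
    have null: "emeasure (unif B \<kappa>) UNIV = 0" if "B \<in> sets borel" "emeasure lborel B = 0" for B :: "(real^'d) set"
      using that by (simp add: emeasure_unif)
    have one: "ot p (density \<mu> (indicator R1)) (unif ?L1 \<kappa>) \<le> ennreal (K1 p e) * box_cost p \<mu> R1 + ennreal (K2 p e * \<delta> powr p) * ennreal n1"
    proof (cases "n1 = 0")
      \<comment> \<open>Without points in the first half, \<open>c'\<close> is the outer face: the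
        target piece is a slab of volume zero, and both measures are null. \<open>ot_stretch\<close>
        does not cover this case, since it needs a nondegenerate image.\<close>
      case True
      then have "c' = a $ i" by (simp add: c'_def)
      then have "upd a i c' = a" by (simp add: vec_eq_iff)
      then have "?L1 = cbox (upd a i c') (upd b i c')" by simp
      then have "emeasure lborel ?L1 = 0" by (simp only: emeasure_hyperplane_slab)
      then have "ot p (density \<mu> (indicator R1)) (unif ?L1 \<kappa>) = 0"
        using True n1 s by (intro ot_null null) (simp_all add: R1_def emeasure_density_indicator')
      then show ?thesis by simp
    next
      case False
      then have lt: "a $ i < c'" using n1 N0 S by (simp add: c'_def)
      have "c' - a $ i > 0" using lt by simp
      have "upd a i (a $ i) = a" "upd (upd b i c) i c' = upd b i c'" by (auto simp: vec_eq_iff)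
      moreover have "\<kappa> = ennreal (n1 / vol a (upd b i c'))"
        unfolding \<kappa>_def VR vol_upd W_def[symmetric] using False n1 N0 S W by (auto simp: c'_def)
      ultimately show ?thesis
        using ot_stretch[of a "upd b i c" "a $ i" c' i \<delta> n1 p e "density \<mu> (indicator R1)"] ab1 lt \<delta> n1 p e
        by (simp add: box_cost_box R1_def)
    qed
    have two: "ot p (density \<mu> (indicator R2)) (unif ?L2 \<kappa>) \<le> ennreal (K1 p e) * box_cost p \<mu> R2 + ennreal (K2 p e * \<delta> powr p) * ennreal n2"
    proof (cases "n2 = 0")
      case True
      then have "c' = b $ i" using N0 by (simp add: c'_def N_def S_def)
      then have "upd b i c' = b" by (simp add: vec_eq_iff)
      then have "?L2 = cbox (upd a i c') (upd b i c')" by simp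
      then have "emeasure lborel ?L2 = 0" by (simp only: emeasure_hyperplane_slab)
      then have "ot p (density \<mu> (indicator R2)) (unif ?L2 \<kappa>) = 0"
        using True n2 s by (intro ot_null null) (simp_all add: R2_def emeasure_density_indicator')
      then show ?thesis by simp
    next
      case False
      have bc: "b $ i - c' = S * (n2 / N)" using N0 by (simp add: c'_def N_def S_def field_simps)
      then have lt: "c' < b $ i" using False n2 N0 S by (smt (verit) divide_pos_pos mult_pos_pos)
      have "upd b i (b $ i) = b" "upd (upd a i c) i c' = upd a i c'" by (auto simp: vec_eq_iff)
      moreover have "\<kappa> = ennreal (n2 / vol (upd a i c') b)"
        unfolding \<kappa>_def VR vol_upd W_def[symmetric] bc using False n2 N0 S W by auto
      ultimately show ?thesis
        using ot_stretch[of "upd a i c" b c' "b $ i" i \<delta> n2 p e "density \<mu> (indicator R2)"] ab1 lt \<delta> n2 p e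
        by (simp add: box_cost_box R2_def)
    qed
    have "box_cost p \<mu> (cbox a b) = ot p (density \<mu> (indicator (cbox a b))) (unif (cbox a b) \<kappa>)"
      unfolding \<kappa>_def by (intro box_cost_box ab N)
    \<comment> \<open>The points are cut at \<open>c\<close>, the target at \<open>c'\<close>; the
      masses of the pieces agree by the choice of \<open>c'\<close>.\<close>
    also have "\<dots> \<le> (\<Sum>j\<in>{True, False}. 1 * ot p (if j then density \<mu> (indicator R1) else density \<mu> (indicator R2))
       (if j then unif ?L1 \<kappa> else unif ?L2 \<kappa>))"
    proof (rule ot_wsum_le)
      fix A :: "(real ^ 'd) set" assume A: "A \<in> sets borel"
      show "emeasure (density \<mu> (indicator (cbox a b))) A =
         (\<Sum>j\<in>{True, False}. 1 * emeasure (if j then density \<mu> (indicator R1) else density \<mu> (indicator R2)) A)"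
        using emeasure_cut[of a i c b \<mu> A] c s 0 A
        by (simp add: emeasure_density_indicator' R1_def R2_def)
      show "emeasure (unif (cbox a b) \<kappa>) A = (\<Sum>j\<in>{True, False}. 1 * emeasure (if j then unif ?L1 \<kappa> else unif ?L2 \<kappa>) A)"
        using emeasure_cut[of a i c' b lborel A] c'b A
        by (simp add: emeasure_unif emeasure_hyperplane_slab distrib_left)
    qed (use s in simp_all)
    also have "\<dots> = ot p (density \<mu> (indicator R1)) (unif ?L1 \<kappa>) + ot p (density \<mu> (indicator R2)) (unif ?L2 \<kappa>)"
      by simp
    also have "\<dots> \<le> (ennreal (K1 p e) * box_cost p \<mu> R1 + ennreal (K2 p e * \<delta> powr p) * ennreal n1)
      + (ennreal (K1 p e) * box_cost p \<mu> R2 + ennreal (K2 p e * \<delta> powr p) * ennreal n2)"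
      by (intro add_mono one two)
    also have "\<dots> = ennreal (K1 p e) * (box_cost p \<mu> R1 + box_cost p \<mu> R2) + ennreal (K2 p e * \<delta> powr p) * (ennreal n1 + ennreal n2)"
      by (simp add: distrib_left add_ac)
    also have "ennreal (K2 p e * \<delta> powr p) * (ennreal n1 + ennreal n2) = ennreal (K2 p e * (\<delta> powr p * N))"
      using n1 n2 K2_pos[OF e, of p]
      by (simp add: N_def ennreal_plus[symmetric] ennreal_mult[symmetric] mult.assoc del: ennreal_plus)
    finally show ?thesis unfolding R1_def R2_def \<delta>_def S_def N_def .
  qed
qed

section \<open>Lower bound and Poisson moments\<close>

lemma emeasure_Q: "L \<ge> 0 \<Longrightarrow> emeasure lborel (Q L :: (real ^ 'd) set) = ennreal (L ^ CARD('d))"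
  unfolding Q_def by (subst emeasure_cbox_cart) simp_all

text \<open>The part of the cube outside all the small cubes around the points has volume at least
  1/2, hence target mass at least \<open>n / 2\<close>, and all of it is at distance at least
  \<open>r\<close> from every point.\<close>

lemma ot_atoms_lower_bound:
  fixes B :: "(real ^ 'd) multiset"
  assumes n: "size B = n" "n \<ge> 1" and p: "p \<ge> 0"
  shows "ennreal (real n / 2 * ((2 * real n) powr (- 1 / CARD('d)) / 2) powr p) \<le> ot p (atoms B) (unif (Q 1) (of_nat n))"
proof -
  \<comment> \<open>A sup-norm ball of this radius has volume \<open>1 / (2 * n)\<close>, so
    \<open>n\<close> of them have total volume at most 1/2. Sup-norm balls are boxes, and the sup
    norm is at most the Euclidean norm.\<close>
  define r where "r = (2 * real n) powr (- 1 / CARD('d)) / 2"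
  have r: "r > 0" using n by (simp add: r_def)
  have rd: "(2 * r) ^ CARD('d) = 1 / (2 * real n)"
  proof -
    have "(2 * r) ^ CARD('d) = (2 * r) powr real CARD('d)"
      using r by (simp add: powr_realpow)
    also have "\<dots> = ((2 * real n) powr (- 1 / CARD('d))) powr real CARD('d)"
      by (simp add: r_def)
    also have "\<dots> = (2 * real n) powr (- 1)"
      by (simp add: powr_powr)
    finally show ?thesis using n by (simp add: powr_minus_divide)
  qed
  define E where "E = (\<Union>x\<in>set_mset B. cbox (x - vec r) (x + vec r))"
  have Em [measurable]: "E \<in> sets borel" unfolding E_def by (intro sets.finite_UN) auto
  have "emeasure lborel E \<le> (\<Sum>x\<in>set_mset B. emeasure lborel (cbox (x - vec r) (x + vec r)))"
    unfolding E_def by (intro emeasure_subadditive_finite) auto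
  also have "\<dots> = (\<Sum>x\<in>set_mset B. ennreal (1 / (2 * real n)))"
    using r by (intro sum.cong refl) (simp add: emeasure_cbox_cart rd[symmetric])
  also have "\<dots> = of_nat (card (set_mset B)) * ennreal (1 / (2 * real n))"
    by simp
  also have "\<dots> \<le> of_nat n * ennreal (1 / (2 * real n))"
  proof (intro mult_right_mono)
    have "card (set_mset B) \<le> size B"
      by (metis card_length ex_mset set_mset_mset size_mset)
    then show "of_nat (card (set_mset B)) \<le> (of_nat n :: ennreal)"
      using n by simp
  qed simp
  also have "\<dots> = ennreal (1 / 2)"
    using n by (simp add: ennreal_of_nat_eq_real_of_nat ennreal_mult[symmetric])
  finally have E2: "emeasure lborel E \<le> ennreal (1 / 2)" .
  have half: "ennreal (1 / 2) \<le> emeasure lborel (- E \<inter> Q 1)"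
  proof -
    have Qm: "(Q 1 :: (real ^ 'd) set) \<in> sets borel" by (simp add: Q_def)
    have "1 = emeasure lborel (Q 1 :: (real ^ 'd) set)" by (simp add: emeasure_Q)
    also have "\<dots> \<le> emeasure lborel (E \<union> (- E \<inter> Q 1))"
      using Qm by (intro emeasure_mono) auto
    also have "\<dots> \<le> emeasure lborel E + emeasure lborel (- E \<inter> Q 1)"
      using Qm by (intro emeasure_subadditive) auto
    also have "\<dots> \<le> ennreal (1 / 2) + emeasure lborel (- E \<inter> Q 1)"
      using E2 by (intro add_right_mono)
    finally have "1 - ennreal (1 / 2) \<le> emeasure lborel (- E \<inter> Q 1)"
      by (subst ennreal_minus_le_iff) auto
    moreover have "1 - ennreal (1 / 2) = ennreal (1 / 2)"
      by (subst ennreal_1[symmetric], subst ennreal_minus) auto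
    ultimately show ?thesis by simp
  qed
  have "ennreal (real n / 2 * r powr p) \<le> 1 * ot p (atoms B) (unif (Q 1) (of_nat n)) + 0"
  proof (rule ot_greatest)
    fix \<pi> assume \<pi>: "\<pi> \<in> couplings (atoms B) (unif (Q 1) (of_nat n))"
    have [simp]: "measurable \<pi> N = measurable (borel \<Otimes>\<^sub>M borel) N" for N :: "'c measure"
      by (rule couplings_measurable[OF \<pi>])
    have sp: "space \<pi> = UNIV" by (rule couplings_space[OF \<pi>])
    have s\<pi>: "sets \<pi> = sets (borel \<Otimes>\<^sub>M borel)" by (rule couplings_sets[OF \<pi>])
    have bx: "- set_mset B \<in> sets borel"
      by (intro borel_comp borel_closed finite_imp_closed) simp
    have offx: "emeasure \<pi> ((- set_mset B) \<times> UNIV) = 0"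
      by (subst couplings_fst[OF \<pi> bx]) (simp add: emeasure_atoms[OF bx])
    have AEx: "AE z in \<pi>. fst z \<in> set_mset B"
      by (rule AE_I[OF _ offx]) (use bx in \<open>auto simp: sp s\<pi>\<close>)
    have far: "r \<le> norm (x - y)" if "x \<in># B" "y \<notin> E" for x y
    proof -
      have "y \<notin> cbox (x - vec r) (x + vec r)" using that by (auto simp: E_def)
      then obtain k where "\<not> (x $ k - r \<le> y $ k \<and> y $ k \<le> x $ k + r)"
        by (auto simp: mem_box_cart)
      then have "r \<le> \<bar>(x - y) $ k\<bar>" by auto
      also have "\<dots> \<le> norm (x - y)" by (rule component_le_norm_cart)
      finally show ?thesis .
    qed
    have "ennreal (real n / 2 * r powr p) = ennreal (r powr p) * (of_nat n * ennreal (1 / 2))"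
    proof -
      have "real n / 2 * r powr p = r powr p * (real n * (1 / 2))" by simp
      then show ?thesis
        by (simp only: ennreal_mult powr_ge_zero of_nat_0_le_iff ennreal_of_nat_eq_real_of_nat
          mult_nonneg_nonneg zero_le_divide_1_iff zero_le_numeral)
    qed
    also have "\<dots> \<le> ennreal (r powr p) * (of_nat n * emeasure lborel (- E \<inter> Q 1))"
      using half by (intro mult_left_mono) auto
    also have "of_nat n * emeasure lborel (- E \<inter> Q 1) = emeasure \<pi> (UNIV \<times> - E)"
      by (subst couplings_snd[OF \<pi>]) (auto simp: emeasure_unif Q_def)
    also have "ennreal (r powr p) * emeasure \<pi> (UNIV \<times> - E) = (\<integral>\<^sup>+ z. ennreal (r powr p) * indicator (UNIV \<times> - E) z \<partial>\<pi>)"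
      by (intro nn_integral_cmult_indicator[symmetric]) (simp add: s\<pi>)
    also have "\<dots> \<le> (\<integral>\<^sup>+ z. ennreal (norm (fst z - snd z) powr p) \<partial>\<pi>)"
    proof (rule nn_integral_mono_AE, use AEx in eventually_elim)
      fix z :: "(real ^ 'd) \<times> (real ^ 'd)" assume z: "fst z \<in># B"
      show "ennreal (r powr p) * indicator (UNIV \<times> - E) z \<le> ennreal (norm (fst z - snd z) powr p)"
        using far[OF z, of "snd z"] r p
        by (cases "snd z \<in> E") (auto simp: indicator_def intro!: ennreal_leI powr_mono2)
    qed
    finally show "ennreal (real n / 2 * r powr p) \<le> 1 * (\<integral>\<^sup>+ z. ennreal (norm (fst z - snd z) powr p) \<partial>\<pi>) + 0"
      by simp
  qed auto
  then show ?thesis by (simp add: r_def)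
qed

section \<open>Poisson weights and their moments\<close>

text \<open>A real formula defined for every rate, including zero; averages against it are
  \<open>exp (- \<theta>)\<close> times a power series in the rate.\<close>

definition pois :: "real \<Rightarrow> nat \<Rightarrow> real"
  where "pois \<theta> k = \<theta> ^ k / fact k * exp (- \<theta>)"

lemma pois_nonneg: "\<theta> \<ge> 0 \<Longrightarrow> pois \<theta> k \<ge> 0"
  by (simp add: pois_def)

text \<open>The centred moment generating function. The value \<open>u = 0\<close> gives the total
  mass, and \<open>u\<close> of size \<open>1 / sqrt \<theta>\<close> controls all central
  moments.\<close>

lemma pois_exp_sums: "(\<lambda>k. pois \<theta> k * exp (u * (real k - \<theta>))) sums exp (\<theta> * (exp u - 1 - u))"
proof -
  have "(\<lambda>k. (\<theta> * exp u) ^ k /\<^sub>R fact k) sums exp (\<theta> * exp u)"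
    by (rule exp_converges)
  then have "(\<lambda>k. (\<theta> * exp u) ^ k /\<^sub>R fact k * exp (- \<theta> - u * \<theta>)) sums (exp (\<theta> * exp u) * exp (- \<theta> - u * \<theta>))"
    by (rule sums_mult2)
  also have "exp (\<theta> * exp u) * exp (- \<theta> - u * \<theta>) = exp (\<theta> * (exp u - 1 - u))"
    by (simp add: exp_add[symmetric] algebra_simps)
  also have "(\<lambda>k. (\<theta> * exp u) ^ k /\<^sub>R fact k * exp (- \<theta> - u * \<theta>)) = (\<lambda>k. pois \<theta> k * exp (u * (real k - \<theta>)))"
    by (auto simp: pois_def power_mult_distrib exp_of_nat_mult[symmetric] exp_add[symmetric] field_simps exp_diff exp_minus)
  finally show ?thesis .
qed

lemma pois_sums: "pois \<theta> sums 1"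
  using pois_exp_sums[of \<theta> 0] by simp

lemma pois_mean: "(\<lambda>k. pois \<theta> k * real k) sums \<theta>"
proof -
  have "(\<lambda>k. pois \<theta> (Suc k) * real (Suc k)) = (\<lambda>k. \<theta> * pois \<theta> k)"
    unfolding pois_def power_Suc fact_Suc of_nat_mult by (simp add: field_simps del: of_nat_Suc)
  moreover have "(\<lambda>k. \<theta> * pois \<theta> k) sums (\<theta> * 1)"
    by (intro sums_mult pois_sums)
  ultimately have "(\<lambda>k. pois \<theta> (Suc k) * real (Suc k)) sums \<theta>" by simp
  then show ?thesis by (subst (asm) sums_Suc_iff) simp
qed

lemma exp_quadratic_bound:
  fixes u :: real assumes "\<bar>u\<bar> \<le> 1" shows "exp u - 1 - u \<le> u\<^sup>2"
proof (cases "u \<ge> 0")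
  case True
  then show ?thesis using exp_bound[of u] assms by simp
next
  case False
  define v where "v = - u"
  have v: "0 \<le> v" "v \<le> 1" using False assms by (auto simp: v_def)
  \<comment> \<open>The product of \<open>1 - v + v\<^sup>2\<close> with the second Taylor
    polynomial of \<open>exp v\<close> is at least 1; division by \<open>exp v\<close> gives the
    bound for negative \<open>u\<close>.\<close>
  have "1 \<le> 1 + v\<^sup>2 * (1 + v + v\<^sup>2) / 2"
    using v by simp
  also have "\<dots> = (1 - v + v\<^sup>2) * (1 + v + v\<^sup>2 / 2)"
    by (simp add: field_simps power2_eq_square)
  also have "\<dots> \<le> (1 - v + v\<^sup>2) * exp v"
    using exp_lower_Taylor_quadratic[OF v(1)] v by (intro mult_left_mono) auto
  finally have "exp (- v) \<le> 1 - v + v\<^sup>2" by (simp add: exp_minus field_simps)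
  then show ?thesis by (simp add: v_def)
qed

lemma powr_le_exp:
  fixes y p :: real assumes "y \<ge> 0" "p \<ge> 0"
  shows "y powr p \<le> fact (nat \<lceil>p\<rceil>) * exp y"
proof (cases "y \<le> 1")
  case True
  then have "y powr p \<le> 1" using assms powr_mono2[of p y 1] by simp
  also have "1 \<le> fact (nat \<lceil>p\<rceil>) * exp y"
    using assms mult_mono[of 1 "fact (nat \<lceil>p\<rceil>)" 1 "exp y"] by simp
  finally show ?thesis .
next
  case False
  define n where "n = nat \<lceil>p\<rceil>"
  have "p \<le> real n" by (simp add: n_def real_nat_ceiling_ge)
  then have "y powr p \<le> y powr real n" using False by (intro powr_mono) auto
  also have "\<dots> = y ^ n" using False by (intro powr_realpow) auto
  also have "y ^ n /\<^sub>R fact n \<le> exp y"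
  proof -
    have "(\<Sum>k\<in>{n}. y ^ k /\<^sub>R fact k) \<le> (\<Sum>k. y ^ k /\<^sub>R fact k)"
      using assms by (intro sum_le_suminf summable_exp_generic) auto
    then show ?thesis by (simp add: exp_def)
  qed
  then have "y ^ n \<le> fact n * exp y" by (simp add: field_simps)
  finally show ?thesis by (simp add: n_def)
qed

text \<open>Deviations are measured in units of \<open>sqrt \<theta>\<close>: with
  \<open>u = 1 / sqrt \<theta>\<close> and \<open>y = u * \<bar>k - \<theta>\<bar>\<close>, the
  moment is \<open>\<theta> powr (p / 2)\<close> times that of \<open>y powr p\<close>. The latter
  is dominated by \<open>exp y\<close>, hence by the sum of the two exponentials in
  \<open>u * (k - \<theta>)\<close> and its negative, each of mean at most \<open>exp 1\<close>
  because \<open>\<theta> * u\<^sup>2 = 1\<close>. The hypothesis \<open>\<theta> \<ge> 1\<close>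
  keeps \<open>u\<close> in the range of \<open>exp_quadratic_bound\<close>.\<close>

lemma poisson_central_moment:
  fixes \<theta> p :: real
  assumes \<theta>: "\<theta> \<ge> 1" and p: "p \<ge> 0"
  defines "C \<equiv> 2 * exp 1 * fact (nat \<lceil>p\<rceil>)"
  shows "summable (\<lambda>k. pois \<theta> k * \<bar>real k - \<theta>\<bar> powr p)"
    and "(\<Sum>k. pois \<theta> k * \<bar>real k - \<theta>\<bar> powr p) \<le> C * \<theta> powr (p / 2)"
proof -
  define u where "u = 1 / sqrt \<theta>"
  have u: "u > 0" "u \<le> 1" "u\<^sup>2 * \<theta> = 1" using \<theta> by (auto simp: u_def power_divide)
  let ?c = "fact (nat \<lceil>p\<rceil>) :: real"
  define g where "g k = ?c * \<theta> powr (p / 2) * (pois \<theta> k * exp (u * (real k - \<theta>)) + pois \<theta> k * exp (- u * (real k - \<theta>)))" for k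
  have gs: "g sums (?c * \<theta> powr (p / 2) * (exp (\<theta> * (exp u - 1 - u)) + exp (\<theta> * (exp (- u) - 1 - (- u)))))"
    unfolding g_def by (intro sums_mult sums_add pois_exp_sums)
  have le: "pois \<theta> k * \<bar>real k - \<theta>\<bar> powr p \<le> g k" for k
  proof -
    define y where "y = u * \<bar>real k - \<theta>\<bar>"
    have "y \<ge> 0" using u by (simp add: y_def)
    have su: "sqrt \<theta> * u = 1" using \<theta> by (simp add: u_def)
    have "\<bar>real k - \<theta>\<bar> = sqrt \<theta> * y" using su by (simp add: y_def mult.assoc[symmetric])
    then have "\<bar>real k - \<theta>\<bar> powr p = (sqrt \<theta>) powr p * y powr p"
      using \<open>y \<ge> 0\<close> \<theta> by (simp add: powr_mult)
    also have "(sqrt \<theta>) powr p = \<theta> powr (p / 2)"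
      using \<theta> by (simp add: powr_half_sqrt[symmetric] powr_powr)
    also have "\<theta> powr (p / 2) * y powr p \<le> \<theta> powr (p / 2) * (?c * exp y)"
      by (intro mult_left_mono powr_le_exp \<open>y \<ge> 0\<close> p) auto
    also have "exp y \<le> exp (u * (real k - \<theta>)) + exp (- u * (real k - \<theta>))"
    proof (cases "real k \<ge> \<theta>")
      case True
      then have "exp y = exp (u * (real k - \<theta>))" by (simp add: y_def)
      then show ?thesis by simp
    next
      case False
      then have "exp y = exp (- u * (real k - \<theta>))" by (simp add: y_def algebra_simps)
      then show ?thesis by simp
    qed
    finally have "\<bar>real k - \<theta>\<bar> powr p \<le> \<theta> powr (p / 2) * (?c * (exp (u * (real k - \<theta>)) + exp (- u * (real k - \<theta>))))"
      by (simp add: mult_left_mono)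
    then have "pois \<theta> k * \<bar>real k - \<theta>\<bar> powr p \<le> pois \<theta> k * (\<theta> powr (p / 2) * (?c * (exp (u * (real k - \<theta>)) + exp (- u * (real k - \<theta>)))))"
      using \<theta> by (intro mult_left_mono pois_nonneg) auto
    then show ?thesis by (simp add: g_def algebra_simps)
  qed
  show s: "summable (\<lambda>k. pois \<theta> k * \<bar>real k - \<theta>\<bar> powr p)"
    using le \<theta> by (intro summable_comparison_test[OF _ sums_summable[OF gs]]) (auto simp: pois_nonneg)
  have "(\<Sum>k. pois \<theta> k * \<bar>real k - \<theta>\<bar> powr p) \<le> (\<Sum>k. g k)"
    by (intro suminf_le le s sums_summable[OF gs])
  also have "\<dots> = ?c * \<theta> powr (p / 2) * (exp (\<theta> * (exp u - 1 - u)) + exp (\<theta> * (exp (- u) - 1 - (- u))))"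
    using gs by (rule sums_unique[symmetric])
  also have "\<dots> \<le> ?c * \<theta> powr (p / 2) * (exp 1 + exp 1)"
  proof (intro mult_left_mono add_mono iffD2[OF exp_le_cancel_iff])
    have "\<theta> * (exp u - 1 - u) \<le> \<theta> * u\<^sup>2" "\<theta> * (exp (- u) - 1 - (- u)) \<le> \<theta> * (- u)\<^sup>2"
      using u \<theta> by (intro mult_left_mono exp_quadratic_bound; simp)+
    then show "\<theta> * (exp u - 1 - u) \<le> 1" "\<theta> * (exp (- u) - 1 - (- u)) \<le> 1"
      using u by (simp_all add: mult.commute)
  qed auto
  finally show "(\<Sum>k. pois \<theta> k * \<bar>real k - \<theta>\<bar> powr p) \<le> C * \<theta> powr (p / 2)"
    by (simp add: C_def mult_ac)
qed

text \<open>For fixed \<open>e\<close> the comparison factor is not 1. Hence \<open>e\<close> is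
  chosen first, with \<open>K1 p e\<close> close to 1, and then \<open>k\<close> so large that
  \<open>K2 p e * \<eta> k\<close> is small. This turns rounding errors into limits, for single
  costs as well as for their means.\<close>

lemma tendsto_K1_K2_sandwich:
  fixes w :: ennreal and g :: "nat \<Rightarrow> ennreal" and \<eta> :: "nat \<Rightarrow> real"
  assumes w: "\<And>e k. e > 0 \<Longrightarrow> w \<le> ennreal (K1 p e) * g k + ennreal (K2 p e) * ennreal (\<eta> k)"
    and g: "\<And>e k. e > 0 \<Longrightarrow> g k \<le> ennreal (K1 p e) * w + ennreal (K2 p e) * ennreal (\<eta> k)"
    and \<eta>: "\<eta> \<longlonglongrightarrow> 0" "\<And>k. \<eta> k \<ge> 0"
  shows "g \<longlonglongrightarrow> w"
proof (cases w)
  case top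
  \<comment> \<open>If \<open>w\<close> is infinite, the first inequality with \<open>e = 1\<close>
    makes every \<open>g k\<close> infinite.\<close>
  have "g k = \<top>" for k
    using w[of 1 k] by (auto simp: top ennreal_add_eq_top ennreal_mult_eq_top_iff top_unique)
  then have "g = (\<lambda>_. \<top>)" by auto
  then show ?thesis by (simp add: top)
next
  case (real v)
  have gk: "g k \<noteq> \<top>" for k
    using g[of 1 k] real by (auto simp: ennreal_add_eq_top ennreal_mult_eq_top_iff top_unique)
  define h where "h k = enn2real (g k)" for k
  have gh: "g k = ennreal (h k)" and h0: "h k \<ge> 0" for k
    using gk[of k] by (auto simp: h_def less_top)
  have W: "v \<le> K1 p e * h k + K2 p e * \<eta> k" and G: "h k \<le> K1 p e * v + K2 p e * \<eta> k" if "e > 0" for e k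
    using w[OF that, of k] g[OF that, of k] K1_pos[OF that, of p] K2_pos[OF that, of p] h0[of k] \<eta>(2)[of k] real
    by (simp_all add: gh ennreal_mult'[symmetric] ennreal_plus[symmetric] del: ennreal_plus)
  have lim: "(\<lambda>k. K2 p e * \<eta> k) \<longlonglongrightarrow> 0" for e
    by (rule tendsto_mult_right_zero[OF \<eta>(1)])
  have "((\<lambda>e. (1 + e) powr p) \<longlongrightarrow> (1 + 0) powr p) (at_right 0)"
    by (intro tendsto_intros) auto
  then have K1: "(K1 p \<longlongrightarrow> 1) (at_right 0)" by (simp add: K1_def[abs_def])
  have pos: "eventually (\<lambda>e. 0 < e) (at_right (0 :: real))" by (rule eventually_at_right_less)
  have "h \<longlonglongrightarrow> v"
  proof (rule order_tendstoI)
    fix y assume y: "v < y"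
    have "((\<lambda>e. K1 p e * v) \<longlongrightarrow> 1 * v) (at_right 0)" by (intro tendsto_intros K1)
    then have "eventually (\<lambda>e. K1 p e * v < y) (at_right 0)" using y by (intro order_tendstoD(2)) simp
    then obtain e where e: "K1 p e * v < y" "e > 0"
      using eventually_happens'[OF trivial_limit_at_right_real eventually_conj[OF _ pos]] by blast
    have "(\<lambda>k. K1 p e * v + K2 p e * \<eta> k) \<longlonglongrightarrow> K1 p e * v + 0" by (intro tendsto_intros lim)
    then have "eventually (\<lambda>k. K1 p e * v + K2 p e * \<eta> k < y) sequentially" using e by (intro order_tendstoD(2)) simp
    then show "eventually (\<lambda>k. h k < y) sequentially"
      by eventually_elim (use G[OF e(2)] in \<open>fastforce intro: le_less_trans\<close>)
  next
    fix y assume y: "y < v"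
    have "((\<lambda>e. v / K1 p e) \<longlongrightarrow> v / 1) (at_right 0)" by (intro tendsto_intros K1) simp
    then have "eventually (\<lambda>e. y < v / K1 p e) (at_right 0)" using y by (intro order_tendstoD(1)) simp
    then obtain e where e: "y < v / K1 p e" "e > 0"
      using eventually_happens'[OF trivial_limit_at_right_real eventually_conj[OF _ pos]] by blast
    have "(\<lambda>k. (v - K2 p e * \<eta> k) / K1 p e) \<longlonglongrightarrow> (v - 0) / K1 p e"
      using K1_pos[OF e(2), of p] by (intro tendsto_intros lim) simp
    then have "eventually (\<lambda>k. y < (v - K2 p e * \<eta> k) / K1 p e) sequentially" using e by (intro order_tendstoD(1)) simp
    moreover have "(v - K2 p e * \<eta> k) / K1 p e \<le> h k" for k
      using W[OF e(2), of k] K1_pos[OF e(2), of p] by (simp add: pos_divide_le_eq mult.commute)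
    ultimately show "eventually (\<lambda>k. y < h k) sequentially"
      by (auto elim!: eventually_mono intro: less_le_trans)
  qed
  then have "(\<lambda>k. ennreal (h k)) \<longlonglongrightarrow> ennreal v" by (rule tendsto_ennrealI)
  then show ?thesis using real by (simp add: gh[abs_def, symmetric] gh)
qed

section \<open>Laws of point configurations\<close>

text \<open>\<open>G\<close> is arbitrary: on a countable set with the discrete sigma-algebra every
  function is measurable, so nothing about the transport cost has to be known when it is inserted
  for \<open>G\<close>.\<close>

lemma
  fixes Y :: "'a \<Rightarrow> 'b" and G :: "'b \<Rightarrow> ennreal"
  assumes S: "countable S" and Y: "\<And>\<omega>. \<omega> \<in> space M \<Longrightarrow> Y \<omega> \<in> S"
    and m: "\<And>s. s \<in> S \<Longrightarrow> {\<omega>\<in>space M. Y \<omega> = s} \<in> sets M"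
  shows borel_measurable_discrete: "(\<lambda>\<omega>. G (Y \<omega>)) \<in> borel_measurable M"
    and nn_integral_discrete: "(\<integral>\<^sup>+\<omega>. G (Y \<omega>) \<partial>M) = (\<integral>\<^sup>+s. emeasure M {\<omega>\<in>space M. Y \<omega> = s} * G s \<partial>count_space S)"
proof -
  have eq: "Y -` {s} \<inter> space M = {\<omega>\<in>space M. Y \<omega> = s}" for s by auto
  have Ym: "Y \<in> measurable M (count_space S)"
    using Y m S by (subst measurable_count_space_eq_countable) (auto simp: eq)
  show "(\<lambda>\<omega>. G (Y \<omega>)) \<in> borel_measurable M"
    using measurable_compose[OF Ym, of G borel] by simp
  have "distr M (count_space S) Y = density (count_space S) (\<lambda>s. emeasure M {\<omega>\<in>space M. Y \<omega> = s})"
  proof (rule measure_eqI_countable[OF _ _ S])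
    fix s assume s: "s \<in> S"
    have "emeasure (density (count_space S) (\<lambda>s. emeasure M {\<omega>\<in>space M. Y \<omega> = s})) {s} =
       (\<integral>\<^sup>+x. emeasure M {\<omega>\<in>space M. Y \<omega> = x} * indicator {s} x \<partial>count_space S)"
      using s by (intro emeasure_density) auto
    also have "\<dots> = (\<integral>\<^sup>+x. emeasure M {\<omega>\<in>space M. Y \<omega> = s} * indicator {s} x \<partial>count_space S)"
      by (intro nn_integral_cong) (auto simp: indicator_def)
    also have "\<dots> = emeasure M {\<omega>\<in>space M. Y \<omega> = s}"
      using s by (subst nn_integral_cmult_indicator) auto
    finally show "emeasure (distr M (count_space S) Y) {s} =
       emeasure (density (count_space S) (\<lambda>s. emeasure M {\<omega>\<in>space M. Y \<omega> = s})) {s}"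
      using s by (simp add: emeasure_distr[OF Ym] eq)
  qed auto
  moreover have "(\<integral>\<^sup>+\<omega>. G (Y \<omega>) \<partial>M) = (\<integral>\<^sup>+s. G s \<partial>distr M (count_space S) Y)"
    by (intro nn_integral_distr[symmetric] Ym) simp
  ultimately show "(\<integral>\<^sup>+\<omega>. G (Y \<omega>) \<partial>M) = (\<integral>\<^sup>+s. emeasure M {\<omega>\<in>space M. Y \<omega> = s} * G s \<partial>count_space S)"
    by (simp add: nn_integral_density)
qed

definition msets_in :: "'a set \<Rightarrow> 'a multiset set"
  where "msets_in V = {C. set_mset C \<subseteq> V}"

lemma countable_msets_in: "countable V \<Longrightarrow> countable (msets_in V)"
proof -
  assume "countable V"
  moreover have "msets_in V \<subseteq> mset ` lists V"
  proof
    fix C assume "C \<in> msets_in V"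
    moreover obtain xs where "mset xs = C" using ex_mset by blast
    ultimately show "C \<in> mset ` lists V" by (auto simp: msets_in_def intro!: image_eqI[of _ _ xs])
  qed
  ultimately show ?thesis by (meson countable_image countable_lists countable_subset)
qed

text \<open>The number of distinct orderings of \<open>C\<close> is the multinomial coefficient, and
  the exponentials collect to \<open>exp (- \<theta>)\<close> because the weights \<open>q v\<close>
  sum to 1.\<close>

lemma prod_pois_multinomial:
  assumes V: "finite V" and C: "set_mset C \<subseteq> V" and q: "\<And>v. v \<in> V \<Longrightarrow> q v \<ge> 0" "(\<Sum>v\<in>V. q v) = 1"
  shows "(\<Prod>v\<in>V. pois (\<theta> * q v) (count C v)) =
    pois \<theta> (size C) * (real (card (permutations_of_multiset C)) * (\<Prod>v\<in>V. q v ^ count C v))"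
proof -
  have sz: "size C = (\<Sum>v\<in>V. count C v)"
    unfolding size_multiset_overloaded_eq using V C
    by (intro sum.mono_neutral_left) (auto simp: not_in_iff)
  have fc: "(\<Prod>v\<in>set_mset C. fact (count C v) :: nat) = (\<Prod>v\<in>V. fact (count C v))"
    using V C by (intro prod.mono_neutral_left) (auto simp: not_in_iff)
  have "real (card (permutations_of_multiset C)) * (\<Prod>v\<in>V. fact (count C v)) = fact (size C)"
    using arg_cong[OF card_permutations_of_multiset_aux[of C], of real] fc by simp
  moreover have F: "(\<Prod>v\<in>V. fact (count C v) :: real) > 0" by (intro prod_pos) simp
  ultimately have card: "real (card (permutations_of_multiset C)) = fact (size C) / (\<Prod>v\<in>V. fact (count C v))"
    by (simp add: field_simps)
  have "(\<Prod>v\<in>V. pois (\<theta> * q v) (count C v)) =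
      (\<Prod>v\<in>V. \<theta> ^ count C v) * (\<Prod>v\<in>V. q v ^ count C v) / (\<Prod>v\<in>V. fact (count C v)) * (\<Prod>v\<in>V. exp (- (\<theta> * q v)))"
    by (simp add: pois_def power_mult_distrib prod.distrib prod_dividef)
  also have "(\<Prod>v\<in>V. \<theta> ^ count C v) = \<theta> ^ size C"
    by (simp add: sz power_sum)
  also have "(\<Prod>v\<in>V. exp (- (\<theta> * q v))) = exp (- \<theta>)"
    using V by (simp add: exp_sum[symmetric] sum_negf sum_distrib_left[symmetric] q(2))
  finally show ?thesis
    using F by (simp add: card pois_def)
qed

context prob_space
begin

text \<open>The event is the disjoint union, over all orderings \<open>xs\<close> of
  \<open>C\<close>, of the events that the points take the values \<open>xs\<close> in this order;
  by independence these are equally likely.\<close>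

lemma prob_iid_mset:
  fixes Z :: "nat \<Rightarrow> 'a \<Rightarrow> 'b :: second_countable_topology"
  assumes ind: "indep_vars (\<lambda>_. borel) Z J" and js: "distinct js" "set js \<subseteq> J"
    and V: "finite V" and T: "\<And>v. v \<in> V \<Longrightarrow> T -` {v} \<in> sets borel"
    and q: "\<And>j v. j \<in> J \<Longrightarrow> v \<in> V \<Longrightarrow> prob {\<omega>\<in>space M. T (Z j \<omega>) = v} = q v"
    and C: "set_mset C \<subseteq> V"
  shows "{\<omega>\<in>space M. mset (map (\<lambda>j. T (Z j \<omega>)) js) = C} \<in> events"
    and "prob {\<omega>\<in>space M. mset (map (\<lambda>j. T (Z j \<omega>)) js) = C} =
      (if size C = length js then real (card (permutations_of_multiset C)) * (\<Prod>v\<in>V. q v ^ count C v) else 0)"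
proof -
  have Zm: "Z j \<in> borel_measurable M" if "j \<in> J" for j
    using ind that by (auto simp: indep_vars_def)
  define E where "E xs = {\<omega>\<in>space M. map (\<lambda>j. T (Z j \<omega>)) js = xs}" for xs
  have EC: "{\<omega>\<in>space M. mset (map (\<lambda>j. T (Z j \<omega>)) js) = C} = (\<Union>xs\<in>permutations_of_multiset C. E xs)"
    by (auto simp: E_def permutations_of_multiset_def)
  have E: "E xs \<in> events" "size C = length js \<Longrightarrow> prob (E xs) = (\<Prod>v\<in>V. q v ^ count C v)"
    if xs: "xs \<in> permutations_of_multiset C" for xs
  proof -
    have mx: "mset xs = C" using xs by (simp add: permutations_of_multiset_def)
    then have sx: "set xs \<subseteq> V" using C by (metis set_mset_mset)
    show "E xs \<in> events"
    proof (cases "length xs = length js")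
      case True
      have "E xs = {\<omega>\<in>space M. \<forall>i<length js. T (Z (js ! i) \<omega>) = xs ! i}"
        using True by (auto simp: E_def list_eq_iff_nth_eq)
      also have "\<dots> = {\<omega>\<in>space M. \<forall>i\<in>{..<length js}. \<omega> \<in> Z (js ! i) -` (T -` {xs ! i}) \<inter> space M}"
        by auto
      also have "\<dots> \<in> events"
      proof (intro sets.sets_Collect_finite_All)
        fix i assume "i \<in> {..<length js}"
        then have "js ! i \<in> J" "xs ! i \<in> V" using js sx True by (auto simp: subset_iff)
        then have "Z (js ! i) -` (T -` {xs ! i}) \<inter> space M \<in> events"
          using T by (intro measurable_sets[OF Zm]) auto
        then show "{\<omega> \<in> space M. \<omega> \<in> Z (js ! i) -` (T -` {xs ! i}) \<inter> space M} \<in> events"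
          by (simp add: Collect_conj_eq Int_absorb1 conj_commute) (simp add: Int_def vimage_def conj_commute)
      qed simp
      finally show ?thesis .
    next
      case False
      then have "E xs = {}" by (auto simp: E_def)
      then show ?thesis by simp
    qed
    assume len: "size C = length js"
    then have lx: "length xs = length js" using mx by auto
    have prodq: "(\<Prod>v\<in>V. q v ^ count C v) = prod_list (map q xs)"
    proof -
      have "prod_list (map q xs) = prod_mset (image_mset q C)"
        by (metis mset_map mx prod_mset_prod_list)
      also have "\<dots> = (\<Prod>v\<in>set_mset C. q v ^ count C v)"
        by (rule image_prod_mset_multiplicity)
      also have "\<dots> = (\<Prod>v\<in>V. q v ^ count C v)"
        using V C by (intro prod.mono_neutral_left) (auto simp: not_in_iff)
      finally show ?thesis ..
    qed
    show "prob (E xs) = (\<Prod>v\<in>V. q v ^ count C v)"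
    \<comment> \<open>The product formula for independent variables needs a nonempty index set, and
      an empty intersection would be \<open>UNIV\<close> instead of the whole space.\<close>
    proof (cases "js = []")
      case True
      then have "xs = []" using lx by simp
      then show ?thesis using True prodq by (simp add: E_def prob_space)
    next
      case False
      \<comment> \<open>Independence speaks of indices, the ordering of positions: \<open>h\<close>
        assigns to each index its prescribed value, which is well defined as \<open>js\<close> has
        no repetitions.\<close>
      define h where "h j = the (map_of (zip js xs) j)" for j
      have hnth: "h (js ! i) = xs ! i" if "i < length js" for i
        using that lx js(1) by (simp add: h_def map_of_zip_nth)
      have hV: "h j \<in> V" if "j \<in> set js" for j
        using that hnth sx lx by (auto simp: in_set_conv_nth subset_iff)
      have mh: "map h js = xs"
        using lx hnth by (auto simp: list_eq_iff_nth_eq)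
      have "E xs = (\<Inter>j\<in>set js. Z j -` (T -` {h j}) \<inter> space M)"
      proof -
        have "E xs = {\<omega>\<in>space M. \<forall>j\<in>set js. T (Z j \<omega>) = h j}"
          unfolding E_def mh[symmetric] by (simp only: map_eq_conv)
        then show ?thesis using False by auto
      qed
      then have "prob (E xs) = (\<Prod>j\<in>set js. prob (Z j -` (T -` {h j}) \<inter> space M))"
        using False js hV T by (simp only:) (intro indep_varsD[OF ind]; auto)
      also have "\<dots> = (\<Prod>j\<in>set js. q (h j))"
      proof (intro prod.cong refl)
        fix j assume j: "j \<in> set js"
        have "Z j -` (T -` {h j}) \<inter> space M = {\<omega>\<in>space M. T (Z j \<omega>) = h j}" by auto
        then show "prob (Z j -` (T -` {h j}) \<inter> space M) = q (h j)"
          using q[of j "h j"] j js hV by auto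
      qed
      also have "\<dots> = prod_list (map q (map h js))"
        using js by (simp add: prod.distinct_set_conv_list comp_def)
      finally show ?thesis using mh prodq by simp
    qed
  qed
  show "{\<omega>\<in>space M. mset (map (\<lambda>j. T (Z j \<omega>)) js) = C} \<in> events"
    unfolding EC using E by (intro sets.finite_UN) auto
  show "prob {\<omega>\<in>space M. mset (map (\<lambda>j. T (Z j \<omega>)) js) = C} =
      (if size C = length js then real (card (permutations_of_multiset C)) * (\<Prod>v\<in>V. q v ^ count C v) else 0)"
  proof (cases "size C = length js")
    case True
    have "prob (\<Union>xs\<in>permutations_of_multiset C. E xs) = (\<Sum>xs\<in>permutations_of_multiset C. prob (E xs))"
      using E by (intro finite_measure_finite_Union) (auto simp: disjoint_family_on_def E_def)
    then show ?thesis unfolding EC using True E by simp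
  next
    case False
    then have e: "{\<omega>\<in>space M. mset (map (\<lambda>j. T (Z j \<omega>)) js) = C} = {}" by auto
    show ?thesis unfolding e using False by simp
  qed
qed

end

section \<open>Configurations of a Poisson process in bounded sets\<close>

locale poisson_process =
  fixes M :: "'w measure" and N :: "'w \<Rightarrow> (real ^ 'd) measure"
  assumes ppp: "poisson_point_process M N"
begin

sublocale prob_space M
  using ppp by (simp add: poisson_point_process_def)

lemma N_dirac: "\<omega> \<in> space M \<Longrightarrow> \<exists>I Z. N \<omega> = dirac_sum I Z"
  and N_compact: "\<omega> \<in> space M \<Longrightarrow> compact K \<Longrightarrow> emeasure (N \<omega>) K < \<infinity>"
  and N_measurable: "A \<in> sets borel \<Longrightarrow> (\<lambda>\<omega>. emeasure (N \<omega>) A) \<in> borel_measurable M"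
  and N_indep: "\<And>(k::nat) A. \<lbrakk>\<And>i. i < k \<Longrightarrow> A i \<in> sets borel; disjoint_family_on A {..<k}\<rbrakk> \<Longrightarrow>
       indep_vars (\<lambda>_. borel) (\<lambda>i \<omega>. emeasure (N \<omega>) (A i)) {..<k}"
  and N_law: "\<And>k. A \<in> sets borel \<Longrightarrow> emeasure lborel A < \<infinity> \<Longrightarrow>
       prob {\<omega>\<in>space M. emeasure (N \<omega>) A = of_nat k} = pois (measure lborel A) k"
  using ppp by (auto simp: poisson_point_process_def pois_def)

lemma sets_N: "\<omega> \<in> space M \<Longrightarrow> sets (N \<omega>) = sets borel"
  using N_dirac by fastforce

text \<open>A bounded set lies in a compact ball, where the process has finite mass; hence only
  finitely many indices fall into \<open>A\<close>.\<close>

lemma config_ex: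
  assumes \<omega>: "\<omega> \<in> space M" and A: "A \<in> sets borel" "bounded A"
  shows "\<exists>B. density (N \<omega>) (indicator A) = atoms B \<and> set_mset B \<subseteq> A"
proof -
  obtain I Z where N: "N \<omega> = dirac_sum I Z" using N_dirac[OF \<omega>] by blast
  obtain x r where r: "A \<subseteq> cball x r" using A(2) unfolding bounded_subset_cball by blast
  have "emeasure (N \<omega>) A \<le> emeasure (N \<omega>) (cball x r)"
    using r by (intro emeasure_mono) (auto simp: N)
  also have "\<dots> < \<infinity>" by (intro N_compact \<omega>) simp
  finally have "emeasure (count_space I) (Z -` A \<inter> I) < \<infinity>"
    using A by (simp add: N emeasure_dirac_sum)
  then have fin: "finite (Z -` A \<inter> I)"
    by (cases "finite (Z -` A \<inter> I)") (simp_all add: emeasure_count_space)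
  define J where "J = Z -` A \<inter> I"
  have "density (N \<omega>) (indicator A) = atoms (image_mset Z (mset_set J))"
  proof (rule measure_eqI)
    fix C assume "C \<in> sets (density (N \<omega>) (indicator A))"
    then have C: "C \<in> sets borel" by (simp add: N)
    have "emeasure (density (N \<omega>) (indicator A)) C = emeasure (count_space I) (Z -` (C \<inter> A) \<inter> I)"
      using A C by (subst emeasure_density_indicator') (auto simp: N emeasure_dirac_sum)
    also have "\<dots> = of_nat (card (Z -` (C \<inter> A) \<inter> I))"
      using fin by (intro emeasure_count_space_finite) (auto elim: finite_subset[rotated])
    also have "Z -` (C \<inter> A) \<inter> I = Z -` C \<inter> J" by (auto simp: J_def)
    also have "of_nat (card (Z -` C \<inter> J)) = emeasure (dirac_sum J Z) C"
      unfolding emeasure_dirac_sum[OF C] by (intro emeasure_count_space_finite[symmetric]) (use fin in \<open>auto simp: J_def\<close>)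
    finally show "emeasure (density (N \<omega>) (indicator A)) C = emeasure (atoms (image_mset Z (mset_set J))) C"
      using fin by (simp add: dirac_sum_finite J_def)
  qed (simp add: N)
  moreover have "set_mset (image_mset Z (mset_set J)) \<subseteq> A"
    using fin by (auto simp: J_def)
  ultimately show ?thesis by blast
qed

text \<open>Chosen separately for each \<open>\<omega>\<close>, so measurability in
  \<open>\<omega>\<close> is never claimed for the configuration itself; it is recovered from the
  counts for its size and for its images under maps with finitely many values.\<close>

definition config :: "'w \<Rightarrow> (real ^ 'd) set \<Rightarrow> (real ^ 'd) multiset"
  where "config \<omega> A = (SOME B. density (N \<omega>) (indicator A) = atoms B \<and> set_mset B \<subseteq> A)"

lemma
  assumes \<omega>: "\<omega> \<in> space M" and A: "A \<in> sets borel" "bounded A"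
  shows density_config: "density (N \<omega>) (indicator A) = atoms (config \<omega> A)"
    and set_config: "set_mset (config \<omega> A) \<subseteq> A"
  using someI_ex[OF config_ex[OF assms]] by (auto simp: config_def)

lemma emeasure_config:
  assumes \<omega>: "\<omega> \<in> space M" and A: "A \<in> sets borel" "bounded A" and C: "C \<in> sets borel"
  shows "emeasure (N \<omega>) (A \<inter> C) = of_nat (size (filter_mset (\<lambda>x. x \<in> C) (config \<omega> A)))"
proof -
  have "emeasure (N \<omega>) (C \<inter> A) = emeasure (atoms (config \<omega> A)) C"
    unfolding density_config[OF \<omega> A, symmetric] using A C sets_N[OF \<omega>]
    by (intro emeasure_density_indicator'[symmetric]) auto
  then show ?thesis using C by (simp add: emeasure_atoms Int_commute)
qed

lemma emeasure_N_eq_size: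
  assumes \<omega>: "\<omega> \<in> space M" and A: "A \<in> sets borel" "bounded A"
  shows "emeasure (N \<omega>) A = of_nat (size (config \<omega> A))"
  using emeasure_config[OF assms, of UNIV] by simp

lemma
  assumes A: "A \<in> sets borel" "bounded A"
  shows size_config_event: "{\<omega>\<in>space M. size (config \<omega> A) = k} \<in> events"
    and prob_size_config: "prob {\<omega>\<in>space M. size (config \<omega> A) = k} = pois (measure lborel A) k"
proof -
  have eq: "{\<omega>\<in>space M. size (config \<omega> A) = k} = {\<omega>\<in>space M. emeasure (N \<omega>) A = of_nat k}"
    using A by (auto simp: emeasure_N_eq_size)
  have "(\<lambda>\<omega>. emeasure (N \<omega>) A) -` {of_nat k} \<inter> space M \<in> events"
    by (intro measurable_sets[OF N_measurable] A) simp
  also have "(\<lambda>\<omega>. emeasure (N \<omega>) A) -` {of_nat k} \<inter> space M = {\<omega>\<in>space M. emeasure (N \<omega>) A = of_nat k}" by auto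
  finally show "{\<omega>\<in>space M. size (config \<omega> A) = k} \<in> events" by (simp add: eq)
  show "prob {\<omega>\<in>space M. size (config \<omega> A) = k} = pois (measure lborel A) k"
    unfolding eq using A by (intro N_law emeasure_bounded_finite)
qed

lemma
  assumes A: "A \<in> sets borel" "bounded A"
  shows nn_integral_size_config: "(\<integral>\<^sup>+\<omega>. h (size (config \<omega> A)) \<partial>M) = (\<Sum>k. ennreal (pois (measure lborel A) k) * h k)"
    and measurable_size_config: "(\<lambda>\<omega>. h (size (config \<omega> A)) :: ennreal) \<in> borel_measurable M"
proof -
  show "(\<lambda>\<omega>. h (size (config \<omega> A)) :: ennreal) \<in> borel_measurable M"
    using size_config_event[OF A] by (intro borel_measurable_discrete[of UNIV]) auto
  have "(\<integral>\<^sup>+\<omega>. h (size (config \<omega> A)) \<partial>M) =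
    (\<integral>\<^sup>+k. emeasure M {\<omega>\<in>space M. size (config \<omega> A) = k} * h k \<partial>count_space UNIV)"
    using size_config_event[OF A] by (intro nn_integral_discrete) auto
  then show "(\<integral>\<^sup>+\<omega>. h (size (config \<omega> A)) \<partial>M) = (\<Sum>k. ennreal (pois (measure lborel A) k) * h k)"
    by (simp add: nn_integral_count_space_nat emeasure_eq_measure prob_size_config[OF A])
qed

text \<open>The fibres of \<open>T\<close> cut \<open>A\<close> into finitely many disjoint Borel
  cells. The image multiset is determined by the numbers of points in these cells, and those are
  independent Poisson variables.\<close>

lemma
  assumes A: "A \<in> sets borel" "bounded A" and V: "finite V" "T ` A \<subseteq> V"
    and T: "\<And>v. v \<in> V \<Longrightarrow> T -` {v} \<in> sets borel" and C: "set_mset C \<subseteq> V"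
  shows config_image_event: "{\<omega>\<in>space M. image_mset T (config \<omega> A) = C} \<in> events"
    and prob_config_image: "prob {\<omega>\<in>space M. image_mset T (config \<omega> A) = C} =
      (\<Prod>v\<in>V. pois (measure lborel (A \<inter> T -` {v})) (count C v))"
proof -
  obtain f where f: "bij_betw f {..<card V} V"
    using ex_bij_betw_nat_finite[OF V(1)] by (auto simp: atLeast0LessThan)
  have fV: "f i \<in> V" if "i < card V" for i using f that by (auto simp: bij_betw_def)
  define D where "D i = A \<inter> T -` {f i}" for i
  have D: "D i \<in> sets borel" "bounded (D i)" if "i < card V" for i
    using A T[OF fV[OF that]] by (auto simp: D_def intro: bounded_subset[OF A(2)])
  have cnt: "emeasure (N \<omega>) (D i) = of_nat (count (image_mset T (config \<omega> A)) (f i))" if "\<omega> \<in> space M" "i < card V" for i \<omega>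
  proof -
    have "count (image_mset T (config \<omega> A)) (f i) = size (filter_mset (\<lambda>x. x \<in> T -` {f i}) (config \<omega> A))"
      by (simp add: count_conv_size_mset filter_mset_image_mset) (metis (no_types, lifting))?
    then show ?thesis
      unfolding D_def using emeasure_config[OF that(1) A T[OF fV[OF that(2)]]] by simp
  qed
  have sub: "set_mset (image_mset T (config \<omega> A)) \<subseteq> V" if "\<omega> \<in> space M" for \<omega>
    using set_config[OF that A] V(2) by auto
  have iff: "image_mset T (config \<omega> A) = C \<longleftrightarrow> (\<forall>i<card V. emeasure (N \<omega>) (D i) = of_nat (count C (f i)))"
    if \<omega>: "\<omega> \<in> space M" for \<omega>
  proof
    assume R: "\<forall>i<card V. emeasure (N \<omega>) (D i) = of_nat (count C (f i))"
    show "image_mset T (config \<omega> A) = C"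
    proof (rule multiset_eqI)
      fix v show "count (image_mset T (config \<omega> A)) v = count C v"
      proof (cases "v \<in> V")
        case True
        then obtain i where "i < card V" "v = f i" using f by (auto simp: bij_betw_def)
        then show ?thesis using R cnt[OF \<omega>, of i] by simp
      next
        case False
        then have "v \<notin># image_mset T (config \<omega> A)" "v \<notin># C" using sub[OF \<omega>] C by blast+
        then show ?thesis by (simp only: not_in_iff)
      qed
    qed
  qed (use cnt \<omega> in auto)
  show ev: "{\<omega>\<in>space M. image_mset T (config \<omega> A) = C} \<in> events"
  proof -
    have "{\<omega>\<in>space M. image_mset T (config \<omega> A) = C} =
      {\<omega>\<in>space M. \<forall>i\<in>{..<card V}. emeasure (N \<omega>) (D i) = of_nat (count C (f i))}"
      using iff by auto
    also have "\<dots> \<in> events"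
    proof (intro sets.sets_Collect_finite_All)
      fix i assume "i \<in> {..<card V}"
      then have "(\<lambda>\<omega>. emeasure (N \<omega>) (D i)) -` {of_nat (count C (f i))} \<inter> space M \<in> events"
        using D by (intro measurable_sets[OF N_measurable]) auto
      then show "{\<omega> \<in> space M. emeasure (N \<omega>) (D i) = of_nat (count C (f i))} \<in> events"
        by (simp add: vimage_def Int_def conj_commute)
    qed simp
    finally show ?thesis .
  qed
  have prodeq: "(\<Prod>i<card V. pois (measure lborel (D i)) (count C (f i))) =
      (\<Prod>v\<in>V. pois (measure lborel (A \<inter> T -` {v})) (count C v))"
    unfolding D_def using prod.reindex_bij_betw[OF f, of "\<lambda>v. pois (measure lborel (A \<inter> T -` {v})) (count C v)"] by simp
  show "prob {\<omega>\<in>space M. image_mset T (config \<omega> A) = C} =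
      (\<Prod>v\<in>V. pois (measure lborel (A \<inter> T -` {v})) (count C v))"
  proof (cases "card V = 0")
    case True
    then have "V = {}" using V by simp
    moreover have "{\<omega>\<in>space M. image_mset T (config \<omega> A) = C} = space M"
      using iff True by auto
    ultimately show ?thesis by (simp add: prob_space)
  next
    case False
    have "{\<omega>\<in>space M. image_mset T (config \<omega> A) = C} =
       (\<Inter>i\<in>{..<card V}. (\<lambda>\<omega>. emeasure (N \<omega>) (D i)) -` {of_nat (count C (f i))} \<inter> space M)"
      using iff False by (auto simp: set_eq_iff)
    moreover have "prob (\<Inter>i\<in>{..<card V}. (\<lambda>\<omega>. emeasure (N \<omega>) (D i)) -` {of_nat (count C (f i))} \<inter> space M) =
       (\<Prod>i\<in>{..<card V}. prob ((\<lambda>\<omega>. emeasure (N \<omega>) (D i)) -` {of_nat (count C (f i))} \<inter> space M))"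
    proof (rule indep_varsD_finite[OF N_indep])
      show "disjoint_family_on D {..<card V}"
        using f by (auto simp: disjoint_family_on_def D_def bij_betw_def inj_on_def)
    qed (use D False in auto)
    moreover have "prob ((\<lambda>\<omega>. emeasure (N \<omega>) (D i)) -` {of_nat (count C (f i))} \<inter> space M) = pois (measure lborel (D i)) (count C (f i))"
      if "i < card V" for i
    proof -
      have "(\<lambda>\<omega>. emeasure (N \<omega>) (D i)) -` {of_nat (count C (f i))} \<inter> space M =
        {\<omega>\<in>space M. emeasure (N \<omega>) (D i) = of_nat (count C (f i))}" by auto
      then show ?thesis using N_law[OF D(1)[OF that] emeasure_bounded_finite[OF D(2)[OF that]]] by simp
    qed
    ultimately show ?thesis using prodeq by simp
  qed
qed

end

section \<open>Discretisation\<close>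

text \<open>Three properties matter: it is Borel, takes finitely many values on bounded sets, and
  displaces all points of the space by a uniformly small amount.\<close>

definition grid :: "nat \<Rightarrow> real ^ 'd \<Rightarrow> real ^ 'd"
  where "grid k x = (\<chi> i. of_int \<lfloor>real (Suc k) * x $ i\<rfloor> / real (Suc k))"

lemma norm_grid_diff: "norm (grid k (x :: real ^ 'd) - x) \<le> real CARD('d) / real (Suc k)"
proof -
  have "norm (grid k x - x) \<le> (\<Sum>i\<in>UNIV. \<bar>(grid k x - x) $ i\<bar>)"
    by (rule norm_le_l1_cart)
  also have "\<dots> \<le> (\<Sum>i\<in>(UNIV :: 'd set). 1 / real (Suc k))"
  proof (rule sum_mono)
    fix i
    have "(grid k x - x) $ i = (of_int \<lfloor>real (Suc k) * x $ i\<rfloor> - real (Suc k) * x $ i) / real (Suc k)"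
      by (simp add: grid_def diff_divide_distrib)
    moreover have "\<bar>of_int \<lfloor>real (Suc k) * x $ i\<rfloor> - real (Suc k) * x $ i\<bar> \<le> 1"
      by linarith
    ultimately show "\<bar>(grid k x - x) $ i\<bar> \<le> 1 / real (Suc k)"
      by (simp add: divide_right_mono)
  qed
  finally show ?thesis by simp
qed

lemma grid_measurable [measurable]: "grid k \<in> borel \<rightarrow>\<^sub>M (borel :: (real ^ 'd) measure)"
proof (rule borel_measurableI)
  fix S :: "(real ^ 'd) set" assume "open S"
  have eq: "grid k = (\<lambda>x. \<Sum>j\<in>Basis. (of_int \<lfloor>real (Suc k) * (x \<bullet> j)\<rfloor> / real (Suc k)) *\<^sub>R (j :: real ^ 'd))"
  proof
    fix x :: "real ^ 'd"
    show "grid k x = (\<Sum>j\<in>Basis. (of_int \<lfloor>real (Suc k) * (x \<bullet> j)\<rfloor> / real (Suc k)) *\<^sub>R (j :: real ^ 'd))"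
    proof (rule euclidean_eqI)
      fix b :: "real ^ 'd" assume b: "b \<in> Basis"
      then obtain i where i: "b = axis i 1" by (auto simp: Basis_vec_def)
      have "(\<Sum>j\<in>Basis. (of_int \<lfloor>real (Suc k) * (x \<bullet> j)\<rfloor> / real (Suc k)) *\<^sub>R (j :: real ^ 'd)) \<bullet> b =
        of_int \<lfloor>real (Suc k) * (x \<bullet> b)\<rfloor> / real (Suc k)"
        using b by (rule inner_sum_left_Basis)
      then show "grid k x \<bullet> b = (\<Sum>j\<in>Basis. (of_int \<lfloor>real (Suc k) * (x \<bullet> j)\<rfloor> / real (Suc k)) *\<^sub>R (j :: real ^ 'd)) \<bullet> b"
        by (simp add: i inner_axis grid_def)
    qed
  qed
  have "grid k \<in> borel \<rightarrow>\<^sub>M (borel :: (real ^ 'd) measure)"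
    unfolding eq by measurable
  from measurable_sets[OF this, of S] show "grid k -` S \<inter> space borel \<in> sets borel"
    using \<open>open S\<close> by simp
qed

lemma finite_grid_image:
  fixes A :: "(real ^ 'd) set"
  assumes "bounded A" shows "finite (grid k ` A)"
proof -
  obtain R where R: "\<And>x. x \<in> A \<Longrightarrow> norm x \<le> R" using assms by (auto simp: bounded_iff)
  define m where "m = \<lceil>real (Suc k) * (R + 1)\<rceil>"
  have "grid k ` A \<subseteq> (\<lambda>f. \<chi> i. of_int (f i) / real (Suc k)) ` (PiE (UNIV :: 'd set) (\<lambda>_. {-m..m}))"
  proof
    fix y assume "y \<in> grid k ` A"
    then obtain x where x: "x \<in> A" "y = grid k x" by auto
    define f where "f i = \<lfloor>real (Suc k) * x $ i\<rfloor>" for i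
    have "f i \<in> {-m..m}" for i
    proof -
      have "\<bar>x $ i\<bar> \<le> R" using component_le_norm_cart[of x i] R[OF x(1)] by simp
      then have "\<bar>real (Suc k) * x $ i\<bar> \<le> real (Suc k) * R"
        by (simp add: abs_mult mult_left_mono)
      moreover have "real (Suc k) * R + real (Suc k) \<le> of_int m"
        unfolding m_def by (metis le_of_int_ceiling mult.right_neutral distrib_left)
      moreover have "real (Suc k) \<ge> 1" by simp
      ultimately have "- of_int m \<le> real_of_int (f i)" "real_of_int (f i) \<le> of_int m"
        unfolding f_def by linarith+
      then show ?thesis by (simp del: of_int_minus add: of_int_minus[symmetric])
    qed
    then show "y \<in> (\<lambda>f. \<chi> i. of_int (f i) / real (Suc k)) ` (PiE (UNIV :: 'd set) (\<lambda>_. {-m..m}))"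
      by (intro image_eqI[of _ _ f]) (auto simp: x grid_def f_def)
  qed
  moreover have "finite (PiE (UNIV :: 'd set) (\<lambda>_. {-m..m}))"
    by (intro finite_PiE) auto
  ultimately show ?thesis using finite_subset by blast
qed

lemma ot_atoms_displace:
  fixes B :: "(real ^ 'd) multiset"
  assumes d: "\<And>x. norm (T x - x) \<le> \<delta>" and p: "p \<ge> 0" and e: "e > 0"
  shows "ot p (atoms (image_mset T B)) \<nu> \<le> ennreal (K1 p e) * ot p (atoms B) \<nu> + ennreal (K2 p e) * ennreal (\<delta> powr p * real (size B))"
    and "ot p (atoms B) \<nu> \<le> ennreal (K1 p e) * ot p (atoms (image_mset T B)) \<nu> + ennreal (K2 p e) * ennreal (\<delta> powr p * real (size B))"
proof -
  obtain xs where xs: "B = mset xs" using ex_mset by metis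
  have eq: "ennreal (K2 p e * \<delta> powr p) * of_nat (length xs) = ennreal (K2 p e) * ennreal (\<delta> powr p * real (size B))"
    using K2_pos[OF e, of p] by (simp add: xs ennreal_of_nat_eq_real_of_nat ennreal_mult[symmetric] mult_ac)
  show "ot p (atoms (image_mset T B)) \<nu> \<le> ennreal (K1 p e) * ot p (atoms B) \<nu> + ennreal (K2 p e) * ennreal (\<delta> powr p * real (size B))"
    using ot_atoms_perturb[of xs "map T xs" \<delta> p e \<nu>] d p e unfolding eq[symmetric] by (simp add: xs)
  show "ot p (atoms B) \<nu> \<le> ennreal (K1 p e) * ot p (atoms (image_mset T B)) \<nu> + ennreal (K2 p e) * ennreal (\<delta> powr p * real (size B))"
    using ot_atoms_perturb[of "map T xs" xs \<delta> p e \<nu>] d p e unfolding eq[symmetric] by (simp add: xs norm_minus_commute)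
qed

text \<open>The rounding error per point. The \<open>itself\<close> argument carries the dimension,
  which the other arguments do not determine.\<close>

definition grid_error :: "real \<Rightarrow> 'd :: finite itself \<Rightarrow> nat \<Rightarrow> real"
  where "grid_error p x k = (real CARD('d) / real (Suc k)) powr p"

lemma grid_error_nonneg: "grid_error p x k \<ge> 0" by (simp add: grid_error_def)

lemma grid_error_tendsto: "p > 0 \<Longrightarrow> grid_error p x \<longlonglongrightarrow> 0"
proof -
  assume p: "p > 0"
  have "(\<lambda>k. real CARD('a) / real (Suc k)) \<longlonglongrightarrow> 0"
    using LIMSEQ_Suc[OF lim_const_over_n[of "real CARD('a)"]] by simp
  then have "(\<lambda>k. (real CARD('a) / real (Suc k)) powr p) \<longlonglongrightarrow> 0 powr p"
    using p by (intro tendsto_powr2) (auto intro: always_eventually)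
  then show ?thesis by (simp add: grid_error_def[abs_def])
qed

lemma ot_grid_tendsto:
  fixes B :: "(real ^ 'd) multiset"
  assumes p: "p > 0"
  shows "(\<lambda>k. ot p (atoms (image_mset (grid k) B)) \<nu>) \<longlonglongrightarrow> ot p (atoms B) \<nu>"
proof (rule tendsto_K1_K2_sandwich[where p = p and \<eta> = "\<lambda>k. grid_error p TYPE('d) k * real (size B)"])
  show "(\<lambda>k. grid_error p TYPE('d) k * real (size B)) \<longlonglongrightarrow> 0"
    using tendsto_mult_left_zero[OF grid_error_tendsto[OF p, where x = "TYPE('d)"]] by simp
next
  fix e :: real and k :: nat assume e: "e > 0"
  show "ot p (atoms B) \<nu> \<le> ennreal (K1 p e) * ot p (atoms (image_mset (grid k) B)) \<nu> +
      ennreal (K2 p e) * ennreal (grid_error p TYPE('d) k * real (size B))"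
    using ot_atoms_displace(2)[OF norm_grid_diff less_imp_le[OF p] e] by (simp add: grid_error_def)
  show "ot p (atoms (image_mset (grid k) B)) \<nu> \<le> ennreal (K1 p e) * ot p (atoms B) \<nu> +
      ennreal (K2 p e) * ennreal (grid_error p TYPE('d) k * real (size B))"
    using ot_atoms_displace(1)[OF norm_grid_diff less_imp_le[OF p] e] by (simp add: grid_error_def)
qed (simp add: grid_error_nonneg)

text \<open>Costs of discretised configurations are functions of discrete random variables; measurability
  passes to the limit.\<close>

lemma
  fixes B :: "'a \<Rightarrow> (real ^ 'd) multiset"
  assumes p: "p > 0"
    and m: "\<And>k. (\<lambda>\<omega>. ot p (atoms (image_mset (grid k) (B \<omega>))) (\<nu> (size (B \<omega>)))) \<in> borel_measurable M"
  shows measurable_ot_grid: "(\<lambda>\<omega>. ot p (atoms (B \<omega>)) (\<nu> (size (B \<omega>)))) \<in> borel_measurable M"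
    and nn_integral_ot_grid_le: "(\<lambda>\<omega>. ennreal (real (size (B \<omega>)))) \<in> borel_measurable M \<Longrightarrow>
      (\<integral>\<^sup>+\<omega>. ennreal (real (size (B \<omega>))) \<partial>M) = ennreal c \<Longrightarrow> c \<ge> 0 \<Longrightarrow> e > 0 \<Longrightarrow>
      (\<integral>\<^sup>+\<omega>. ot p (atoms (B \<omega>)) (\<nu> (size (B \<omega>))) \<partial>M) \<le> ennreal (K1 p e) *
      (\<integral>\<^sup>+\<omega>. ot p (atoms (image_mset (grid k) (B \<omega>))) (\<nu> (size (B \<omega>))) \<partial>M) + ennreal (K2 p e) * ennreal (grid_error p TYPE('d) k * c)"
    and nn_integral_ot_grid_ge: "(\<lambda>\<omega>. ennreal (real (size (B \<omega>)))) \<in> borel_measurable M \<Longrightarrow>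
      (\<integral>\<^sup>+\<omega>. ennreal (real (size (B \<omega>))) \<partial>M) = ennreal c \<Longrightarrow> c \<ge> 0 \<Longrightarrow> e > 0 \<Longrightarrow>
      (\<integral>\<^sup>+\<omega>. ot p (atoms (image_mset (grid k) (B \<omega>))) (\<nu> (size (B \<omega>))) \<partial>M) \<le> ennreal (K1 p e) *
      (\<integral>\<^sup>+\<omega>. ot p (atoms (B \<omega>)) (\<nu> (size (B \<omega>))) \<partial>M) + ennreal (K2 p e) * ennreal (grid_error p TYPE('d) k * c)"
proof -
  show m': "(\<lambda>\<omega>. ot p (atoms (B \<omega>)) (\<nu> (size (B \<omega>)))) \<in> borel_measurable M"
    by (rule borel_measurable_LIMSEQ_order[OF _ m]) (rule ot_grid_tendsto[OF p])
  assume sm [measurable]: "(\<lambda>\<omega>. ennreal (real (size (B \<omega>)))) \<in> borel_measurable M"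
    and c: "(\<integral>\<^sup>+\<omega>. ennreal (real (size (B \<omega>))) \<partial>M) = ennreal c" "c \<ge> 0" and e: "e > 0"
  have int: "(\<integral>\<^sup>+\<omega>. f \<omega> \<partial>M) \<le> ennreal (K1 p e) * (\<integral>\<^sup>+\<omega>. g \<omega> \<partial>M) + ennreal (K2 p e) * ennreal (grid_error p TYPE('d) k * c)"
    if [measurable]: "g \<in> borel_measurable M"
      and le: "\<And>\<omega>. f \<omega> \<le> ennreal (K1 p e) * g \<omega> + ennreal (K2 p e) * ennreal (grid_error p TYPE('d) k * real (size (B \<omega>)))" for f g
  proof -
    have "(\<integral>\<^sup>+\<omega>. f \<omega> \<partial>M) \<le> (\<integral>\<^sup>+\<omega>. ennreal (K1 p e) * g \<omega> + ennreal (K2 p e) * (ennreal (grid_error p TYPE('d) k) * ennreal (real (size (B \<omega>)))) \<partial>M)"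
      using le grid_error_nonneg[of p "TYPE('d)" k] by (intro nn_integral_mono) (simp add: ennreal_mult)
    also have "\<dots> = ennreal (K1 p e) * (\<integral>\<^sup>+\<omega>. g \<omega> \<partial>M) + ennreal (K2 p e) * (ennreal (grid_error p TYPE('d) k) * ennreal c)"
    proof -
      define s where "s \<omega> = ennreal (real (size (B \<omega>)))" for \<omega>
      have [measurable]: "s \<in> borel_measurable M" using sm by (simp add: s_def[abs_def])
      have "(\<integral>\<^sup>+\<omega>. s \<omega> \<partial>M) = ennreal c" using c by (simp add: s_def)
      then show ?thesis
        unfolding s_def[symmetric] by (simp add: nn_integral_add nn_integral_cmult)
    qed
    finally show ?thesis using grid_error_nonneg[of p "TYPE('d)" k] c(2) by (simp add: ennreal_mult)
  qed
  show "(\<integral>\<^sup>+\<omega>. ot p (atoms (B \<omega>)) (\<nu> (size (B \<omega>))) \<partial>M) \<le> ennreal (K1 p e) *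
      (\<integral>\<^sup>+\<omega>. ot p (atoms (image_mset (grid k) (B \<omega>))) (\<nu> (size (B \<omega>))) \<partial>M) + ennreal (K2 p e) * ennreal (grid_error p TYPE('d) k * c)"
    using ot_atoms_displace(2)[OF norm_grid_diff less_imp_le[OF p] e] by (intro int m) (simp add: grid_error_def)
  show "(\<integral>\<^sup>+\<omega>. ot p (atoms (image_mset (grid k) (B \<omega>))) (\<nu> (size (B \<omega>))) \<partial>M) \<le> ennreal (K1 p e) *
      (\<integral>\<^sup>+\<omega>. ot p (atoms (B \<omega>)) (\<nu> (size (B \<omega>))) \<partial>M) + ennreal (K2 p e) * ennreal (grid_error p TYPE('d) k * c)"
    using ot_atoms_displace(1)[OF norm_grid_diff less_imp_le[OF p] e] by (intro int m') (simp add: grid_error_def)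
qed

section \<open>Independent uniform points\<close>

locale iid_points =
  fixes P :: "'v measure" and X :: "nat \<Rightarrow> 'v \<Rightarrow> real ^ 'd"
  assumes iid: "iid_uniform P X"
begin

sublocale prob_space P
  using iid by (simp add: iid_uniform_def)

text \<open>Modification on a null event, so that all points lie in the unit cube everywhere.\<close>

definition Y :: "nat \<Rightarrow> 'v \<Rightarrow> real ^ 'd"
  where "Y j \<omega> = (if X j \<omega> \<in> Q 1 then X j \<omega> else 0)"

lemma Q_sets [measurable, simp]: "(Q L :: (real ^ 'd) set) \<in> sets borel"
  by (simp add: Q_def)

lemma X_measurable [measurable]: "j \<ge> 1 \<Longrightarrow> X j \<in> borel_measurable P"
  using iid by (auto simp: iid_uniform_def indep_vars_def)

lemma Y_mem: "Y j \<omega> \<in> Q 1"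
  by (auto simp: Y_def Q_def mem_box_cart)

lemma Y_indep: "indep_vars (\<lambda>_. borel) Y {1..}"
proof -
  have "indep_vars (\<lambda>_. borel) (\<lambda>j \<omega>. (\<lambda>x. if x \<in> Q 1 then x else 0) (X j \<omega>)) {1..}"
    by (rule indep_vars_compose2[where M' = "\<lambda>_. borel"]) (use iid in \<open>auto simp: iid_uniform_def\<close>)
  then show ?thesis by (simp add: Y_def[abs_def])
qed

lemma AE_X_eq_Y: "j \<ge> 1 \<Longrightarrow> AE \<omega> in P. X j \<omega> = Y j \<omega>"
proof -
  assume j: "j \<ge> 1"
  have "AE x in uniform_measure lborel (Q 1). x \<in> (Q 1 :: (real ^ 'd) set)"
    by (intro AE_uniform_measureI) auto
  then have "AE x in distr P borel (X j). x \<in> Q 1"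
    using iid j unfolding iid_uniform_def by metis
  then have "AE \<omega> in P. X j \<omega> \<in> Q 1"
    using j by (subst (asm) AE_distr_iff) auto
  then show ?thesis by eventually_elim (simp add: Y_def)
qed

lemma prob_Y:
  assumes j: "j \<ge> 1" and A: "A \<in> sets borel"
  shows "prob {\<omega>\<in>space P. Y j \<omega> \<in> A} = measure lborel (A \<inter> Q 1)"
proof -
  have Ym: "Y j \<in> borel_measurable P" using Y_indep j by (auto simp: indep_vars_def)
  have "prob {\<omega>\<in>space P. Y j \<omega> \<in> A} = prob {\<omega>\<in>space P. X j \<omega> \<in> A}"
    using AE_X_eq_Y[OF j] j A Ym by (intro finite_measure_eq_AE) auto
  also have "{\<omega>\<in>space P. X j \<omega> \<in> A} = X j -` A \<inter> space P" by auto
  also have "prob (X j -` A \<inter> space P) = measure (distr P borel (X j)) A"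
    using j A by (simp add: measure_distr)
  also have "\<dots> = measure (uniform_measure lborel (Q 1)) A"
    using iid j by (simp add: iid_uniform_def)
  also have "\<dots> = measure lborel (A \<inter> Q 1)"
    using A by (simp add: measure_def emeasure_Q Int_commute divide_ennreal_def)
  finally show ?thesis .
qed

abbreviation pts :: "nat list \<Rightarrow> 'v \<Rightarrow> (real ^ 'd) multiset"
  where "pts js \<omega> \<equiv> mset (map (\<lambda>j. Y j \<omega>) js)"

text \<open>The right-hand side of the integral formula depends on \<open>js\<close> only through
  its length: this is exchangeability in the form used for \<open>alpha_eq\<close>. It is also the
  multinomial side of the comparison with the Poisson process.\<close>

lemma
  fixes T :: "real ^ 'd \<Rightarrow> 'b" and G :: "'b multiset \<Rightarrow> ennreal"
  assumes js: "distinct js" "set js \<subseteq> {1..}" and V: "finite V" "T ` Q 1 \<subseteq> V" and T: "\<And>v. v \<in> V \<Longrightarrow> T -` {v} \<in> sets borel"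
  shows measurable_pts_discrete: "(\<lambda>\<omega>. G (image_mset T (pts js \<omega>))) \<in> borel_measurable P"
    and nn_integral_pts_discrete: "(\<integral>\<^sup>+\<omega>. G (image_mset T (pts js \<omega>)) \<partial>P) =
      (\<integral>\<^sup>+C. ennreal (if size C = length js then real (card (permutations_of_multiset C)) *
         (\<Prod>v\<in>V. measure lborel (T -` {v} \<inter> Q 1) ^ count C v) else 0) * G C \<partial>count_space (msets_in V))"
proof -
  have q: "prob {\<omega>\<in>space P. T (Y j \<omega>) = v} = measure lborel (T -` {v} \<inter> Q 1)" if "j \<in> {1..}" "v \<in> V" for j v
    using prob_Y[of j "T -` {v}"] T that by simp
  note L = prob_iid_mset[OF Y_indep js V(1) T q]
  have eq: "image_mset T (pts js \<omega>) = mset (map (\<lambda>j. T (Y j \<omega>)) js)" for \<omega>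
    by (simp add: image_mset.compositionality comp_def)
  have mem: "image_mset T (pts js \<omega>) \<in> msets_in V" for \<omega>
    using V(2) Y_mem by (auto simp: msets_in_def)
  have ev: "{\<omega>\<in>space P. image_mset T (pts js \<omega>) = C} \<in> events" if "C \<in> msets_in V" for C
    using L(1)[of C] that unfolding eq by (simp add: msets_in_def)
  show "(\<lambda>\<omega>. G (image_mset T (pts js \<omega>))) \<in> borel_measurable P"
    by (rule borel_measurable_discrete[OF countable_msets_in[OF countable_finite[OF V(1)]] mem ev])
  have "(\<integral>\<^sup>+\<omega>. G (image_mset T (pts js \<omega>)) \<partial>P) =
     (\<integral>\<^sup>+C. emeasure P {\<omega>\<in>space P. image_mset T (pts js \<omega>) = C} * G C \<partial>count_space (msets_in V))"
    by (rule nn_integral_discrete[OF countable_msets_in[OF countable_finite[OF V(1)]] mem ev])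
  also have "\<dots> = (\<integral>\<^sup>+C. ennreal (if size C = length js then real (card (permutations_of_multiset C)) *
         (\<Prod>v\<in>V. measure lborel (T -` {v} \<inter> Q 1) ^ count C v) else 0) * G C \<partial>count_space (msets_in V))"
    using L(2) unfolding eq by (intro nn_integral_cong) (simp add: emeasure_eq_measure msets_in_def)
  finally show "(\<integral>\<^sup>+\<omega>. G (image_mset T (pts js \<omega>)) \<partial>P) = \<dots>" .
qed

end

section \<open>The cost on a cube\<close>

lemma tendsto_grid_error_mult: "p > 0 \<Longrightarrow> (\<lambda>k. grid_error p x k * c) \<longlonglongrightarrow> 0"
  by (rule tendsto_mult_left_zero[OF grid_error_tendsto])

lemma suminf_pois_mean:
  assumes "\<theta> \<ge> 0" shows "(\<Sum>n. ennreal (pois \<theta> n) * ennreal (real n)) = ennreal \<theta>"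
proof -
  have "(\<Sum>n. ennreal (pois \<theta> n) * ennreal (real n)) = (\<Sum>n. ennreal (pois \<theta> n * real n))"
    using assms by (simp add: ennreal_mult pois_nonneg)
  also have "\<dots> = ennreal (\<Sum>n. pois \<theta> n * real n)"
    using assms pois_mean[of \<theta>] by (intro suminf_ennreal2) (auto simp: pois_nonneg sums_iff)
  also have "(\<Sum>n. pois \<theta> n * real n) = \<theta>"
    using pois_mean[of \<theta>] by (simp add: sums_iff)
  finally show ?thesis .
qed

lemma distr_atoms: "T \<in> borel \<rightarrow>\<^sub>M borel \<Longrightarrow> distr (atoms B) borel T = atoms (image_mset T B)"
proof (rule measure_eqI)
  fix A assume T: "T \<in> borel \<rightarrow>\<^sub>M borel" and "A \<in> sets (distr (atoms B) borel T)"
  then have A: "A \<in> sets borel" by simp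
  have T': "T \<in> measurable (atoms B) borel" using T by (subst measurable_cong_sets[OF sets_atoms refl])
  have "T -` A \<in> sets borel" using measurable_sets[OF T A] by simp
  then show "emeasure (distr (atoms B) borel T) A = emeasure (atoms (image_mset T B)) A"
    using A by (simp add: emeasure_distr[OF T'] emeasure_atoms filter_mset_image_mset)
qed simp

lemma aff_eq_scaleR: "aff a (vec L) x = a + L *\<^sub>R x"
  by (simp add: vec_eq_iff)

lemma image_mset_aff_id: "image_mset (aff 0 (vec 1)) B = B" for B :: "(real ^ 'd) multiset"
proof -
  have "aff 0 (vec 1) = (\<lambda>x :: real ^ 'd. x)" by (auto simp: fun_eq_iff vec_eq_iff)
  then show ?thesis by simp
qed

text \<open>\<open>ot_affine_le\<close> is applied to the affine map and to its inverse. The density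
  is divided by the Jacobian so that the total mass is kept.\<close>

lemma ot_affine_cube:
  fixes a :: "real ^ 'd" and B :: "(real ^ 'd) multiset"
  assumes L: "L > 0"
  shows "ot p (atoms (image_mset (aff a (vec L)) B)) (unif (cbox a (a + vec L)) (c / ennreal (L ^ CARD('d)))) =
    ennreal (L powr p) * ot p (atoms B) (unif (Q 1) c)"
proof (rule antisym)
  have cb: "cbox a (a + vec L) = cbox (aff a (vec L) 0) (aff a (vec L) (\<chi> i. 1))"
    by (rule arg_cong2[where f = cbox]) (simp_all add: vec_eq_iff)
  have d1: "distr (atoms B) borel (\<lambda>x. a + L *\<^sub>R x) = atoms (image_mset (aff a (vec L)) B)"
    using distr_atoms[OF aff_measurable] by (simp add: aff_eq_scaleR[abs_def, symmetric])
  have d2: "distr (unif (Q 1) c) borel (\<lambda>x. a + L *\<^sub>R x) = unif (cbox a (a + vec L)) (c / ennreal (L ^ CARD('d)))"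
    unfolding cb Q_def aff_eq_scaleR[symmetric] using L by (subst distr_unif_aff) simp_all
  show "ot p (atoms (image_mset (aff a (vec L)) B)) (unif (cbox a (a + vec L)) (c / ennreal (L ^ CARD('d)))) \<le>
    ennreal (L powr p) * ot p (atoms B) (unif (Q 1) c)"
    using ot_affine_le[OF L, of p "atoms B" a "unif (Q 1) c"] by (simp only: d1 d2)
  let ?a = "- (1 / L) *\<^sub>R a"
  have comp: "distr (distr \<mu> borel (\<lambda>x. a + L *\<^sub>R x)) borel (\<lambda>x. ?a + (1 / L) *\<^sub>R x) = \<mu>" if s: "sets \<mu> = sets borel" for \<mu>
  proof -
    have "distr (distr \<mu> borel (\<lambda>x. a + L *\<^sub>R x)) borel (\<lambda>x. ?a + (1 / L) *\<^sub>R x) =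
       distr \<mu> borel ((\<lambda>x. ?a + (1 / L) *\<^sub>R x) \<circ> (\<lambda>x. a + L *\<^sub>R x))"
      by (intro distr_distr) (measurable, simp add: measurable_cong_sets[OF s refl])
    also have "(\<lambda>x. ?a + (1 / L) *\<^sub>R x) \<circ> (\<lambda>x. a + L *\<^sub>R x) = (\<lambda>x. x)"
      using L by (auto simp: algebra_simps)
    also have "distr \<mu> borel (\<lambda>x. x) = \<mu>"
      using distr_cong[OF refl s[symmetric] refl, of \<mu> "\<lambda>x. x"] by simp
    finally show ?thesis .
  qed
  have "ot p (atoms B) (unif (Q 1) c) \<le> ennreal ((1 / L) powr p) *
     ot p (atoms (image_mset (aff a (vec L)) B)) (unif (cbox a (a + vec L)) (c / ennreal (L ^ CARD('d))))"
    using ot_affine_le[of "1 / L" p "distr (atoms B) borel (\<lambda>x. a + L *\<^sub>R x)" ?a "distr (unif (Q 1) c) borel (\<lambda>x. a + L *\<^sub>R x)"] L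
    by (simp only: comp sets_atoms sets_unif) (simp add: d1 d2)
  then have "ennreal (L powr p) * ot p (atoms B) (unif (Q 1) c) \<le> ennreal (L powr p) * (ennreal ((1 / L) powr p) *
     ot p (atoms (image_mset (aff a (vec L)) B)) (unif (cbox a (a + vec L)) (c / ennreal (L ^ CARD('d)))))"
    by (intro mult_left_mono) auto
  also have "\<dots> = ot p (atoms (image_mset (aff a (vec L)) B)) (unif (cbox a (a + vec L)) (c / ennreal (L ^ CARD('d))))"
    using L by (simp add: mult.assoc[symmetric] ennreal_mult[symmetric] powr_mult[symmetric])
  finally show "ennreal (L powr p) * ot p (atoms B) (unif (Q 1) c) \<le>
     ot p (atoms (image_mset (aff a (vec L)) B)) (unif (cbox a (a + vec L)) (c / ennreal (L ^ CARD('d))))" .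
qed

context iid_points
begin

lemma pts_grid_facts:
  fixes a :: "real ^ 'd"
  assumes L: "L > 0"
  shows "finite (grid k ` cbox a (a + vec L))" "(grid k \<circ> aff a (vec L)) ` Q 1 \<subseteq> grid k ` cbox a (a + vec L)"
    "(grid k \<circ> aff a (vec L)) -` {v} \<in> sets borel"
proof -
  show "finite (grid k ` cbox a (a + vec L))" by (intro finite_grid_image) simp
  have cb: "cbox a (a + vec L) = cbox (aff a (vec L) 0) (aff a (vec L) (\<chi> i. 1))"
    by (rule arg_cong2[where f = cbox]) (simp_all add: vec_eq_iff)
  show "(grid k \<circ> aff a (vec L)) ` Q 1 \<subseteq> grid k ` cbox a (a + vec L)"
    unfolding cb using L aff_mem_cbox_iff[of "vec L :: real ^ 'd" a] by (auto simp: Q_def)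
  have "(grid k \<circ> aff a (vec L)) \<in> borel \<rightarrow>\<^sub>M borel"
    using measurable_comp[OF aff_measurable grid_measurable] .
  from measurable_sets[OF this, of "{v}"] show "(grid k \<circ> aff a (vec L)) -` {v} \<in> sets borel" by simp
qed

lemma measurable_pts_grid:
  assumes js: "distinct js" "set js \<subseteq> {1..}" and L: "L > 0"
  shows "(\<lambda>\<omega>. G (image_mset (grid k) (image_mset (aff a (vec L)) (pts js \<omega>))) :: ennreal) \<in> borel_measurable P"
  using measurable_pts_discrete[OF js pts_grid_facts(1)[OF L] pts_grid_facts(2)[OF L] pts_grid_facts(3)[OF L], where G = G]
  by (simp only: image_mset.compositionality)

lemma measurable_ot_pts:
  assumes js: "distinct js" "set js \<subseteq> {1..}" and p: "p > 0"
  shows "(\<lambda>\<omega>. ot p (atoms (pts js \<omega>)) \<nu>) \<in> borel_measurable P"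
proof -
  have "(\<lambda>\<omega>. ot p (atoms (image_mset (grid k) (pts js \<omega>))) \<nu>) \<in> borel_measurable P" for k
    using measurable_pts_grid[OF js, of 1 "\<lambda>C. ot p (atoms C) \<nu>" k 0] unfolding image_mset_aff_id by simp
  from measurable_ot_grid[OF p, where \<nu> = "\<lambda>_. \<nu>" and B = "pts js", OF this] show ?thesis .
qed

text \<open>The \<open>a n\<close> of the overview, with \<open>n\<close> unit masses and a target
  of density \<open>n\<close>. It is extended real until finiteness is known.\<close>

definition alpha :: "real \<Rightarrow> nat \<Rightarrow> ennreal"
  where "alpha p n = (\<integral>\<^sup>+\<omega>. ot p (atoms (pts [1..<Suc n] \<omega>)) (unif (Q 1) (of_nat n)) \<partial>P)"

text \<open>For rounded points the mean cost depends only on the number of points; the identity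
  survives the limit of fine grids.\<close>

lemma alpha_eq:
  assumes js: "distinct js" "set js \<subseteq> {1..}" "length js = n" and p: "p > 0"
  shows "(\<integral>\<^sup>+\<omega>. ot p (atoms (pts js \<omega>)) (unif (Q 1) (of_nat n)) \<partial>P) = alpha p n"
proof -
  have lim: "(\<lambda>k. \<integral>\<^sup>+\<omega>. ot p (atoms (image_mset (grid k) (pts js \<omega>))) (unif (Q 1) (of_nat n)) \<partial>P)
      \<longlonglongrightarrow> (\<integral>\<^sup>+\<omega>. ot p (atoms (pts js \<omega>)) (unif (Q 1) (of_nat n)) \<partial>P)"
    if js: "distinct js" "set js \<subseteq> {1..}" "length js = n" for js
  proof (rule tendsto_K1_K2_sandwich[where p = p and \<eta> = "\<lambda>k. grid_error p TYPE('d) k * real n"])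
    have m: "(\<lambda>\<omega>. ot p (atoms (image_mset (grid k) (pts js \<omega>))) (unif (Q 1) (of_nat n))) \<in> borel_measurable P" for k
      using measurable_pts_grid[OF js(1,2), of 1 "\<lambda>C. ot p (atoms C) (unif (Q 1) (of_nat n))" k 0] unfolding image_mset_aff_id by simp
    fix e :: real and k :: nat assume e: "e > 0"
    show "(\<integral>\<^sup>+\<omega>. ot p (atoms (pts js \<omega>)) (unif (Q 1) (of_nat n)) \<partial>P) \<le> ennreal (K1 p e) *
      (\<integral>\<^sup>+\<omega>. ot p (atoms (image_mset (grid k) (pts js \<omega>))) (unif (Q 1) (of_nat n)) \<partial>P) + ennreal (K2 p e) * ennreal (grid_error p TYPE('d) k * real n)"
      using m js e by (intro nn_integral_ot_grid_le[OF p, where \<nu> = "\<lambda>_. unif (Q 1) (of_nat n)"]) (simp_all add: emeasure_space_1)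
    show "(\<integral>\<^sup>+\<omega>. ot p (atoms (image_mset (grid k) (pts js \<omega>))) (unif (Q 1) (of_nat n)) \<partial>P) \<le> ennreal (K1 p e) *
      (\<integral>\<^sup>+\<omega>. ot p (atoms (pts js \<omega>)) (unif (Q 1) (of_nat n)) \<partial>P) + ennreal (K2 p e) * ennreal (grid_error p TYPE('d) k * real n)"
      using m js e by (intro nn_integral_ot_grid_ge[OF p, where \<nu> = "\<lambda>_. unif (Q 1) (of_nat n)"]) (simp_all add: emeasure_space_1)
  qed (simp_all add: tendsto_grid_error_mult p grid_error_nonneg)
  have js': "distinct [1..<Suc n]" "set [1..<Suc n] \<subseteq> {1..}" "length [1..<Suc n] = n" by auto
  have F: "finite (grid k ` (Q 1 :: (real ^ 'd) set))" for k by (intro finite_grid_image) (simp add: Q_def)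
  have G: "grid k -` {v} \<in> sets borel" for k and v :: "real ^ 'd"
    using measurable_sets[OF grid_measurable, of "{v}"] by simp
  have "(\<integral>\<^sup>+\<omega>. ot p (atoms (image_mset (grid k) (pts js \<omega>))) (unif (Q 1) (of_nat n)) \<partial>P) =
      (\<integral>\<^sup>+\<omega>. ot p (atoms (image_mset (grid k) (pts [1..<Suc n] \<omega>))) (unif (Q 1) (of_nat n)) \<partial>P)" for k
    unfolding nn_integral_pts_discrete[OF js(1,2) F subset_refl G, where G = "\<lambda>C. ot p (atoms C) (unif (Q 1) (of_nat n))"]
      nn_integral_pts_discrete[OF js'(1,2) F subset_refl G, where G = "\<lambda>C. ot p (atoms C) (unif (Q 1) (of_nat n))"] js(3) js'(3) ..
  then show ?thesis
    unfolding alpha_def using LIMSEQ_unique[OF lim[OF js] ] lim[OF js'] by simp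
qed

end

locale poisson_and_iid = poisson_process M N + iid: iid_points P X
  for M :: "'w measure" and N :: "'w \<Rightarrow> (real ^ 'd) measure" and P :: "'v measure" and X :: "nat \<Rightarrow> 'v \<Rightarrow> real ^ 'd"
begin

text \<open>Both sides are sums over the multisets of grid points: a product of Poisson weights is a Poisson
  weight for the total number times a multinomial weight.\<close>

lemma nn_integral_config_eq_poissonised:
  fixes a :: "real ^ 'd" and G :: "(real ^ 'd) multiset \<Rightarrow> ennreal"
  assumes L: "L > 0"
  defines "R \<equiv> cbox a (a + vec L)" and "\<theta> \<equiv> L ^ CARD('d)"
  shows "(\<integral>\<^sup>+\<omega>. G (image_mset (grid k) (config \<omega> R)) \<partial>M) =
    (\<Sum>n. ennreal (pois \<theta> n) * (\<integral>\<^sup>+\<omega>. G (image_mset (grid k) (image_mset (aff a (vec L)) (iid.pts [1..<Suc n] \<omega>))) \<partial>P))"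
    and "(\<lambda>\<omega>. G (image_mset (grid k) (config \<omega> R))) \<in> borel_measurable M"
proof -
  let ?T = "grid k :: real ^ 'd \<Rightarrow> _" and ?S = "grid k \<circ> aff a (vec L) :: real ^ 'd \<Rightarrow> _"
  define V where "V = ?T ` R"
  have V: "finite V" "?S ` Q 1 \<subseteq> V"
    using iid.pts_grid_facts(1,2)[OF L, of k a] by (simp_all only: V_def R_def)
  have Tm: "?T -` {v} \<in> sets borel" for v
    using measurable_sets[OF grid_measurable, of "{v}"] by simp
  have Sm: "?S -` {v} \<in> sets borel" for v by (rule iid.pts_grid_facts(3)[OF L])
  have R: "R \<in> sets borel" "bounded R" by (auto simp: R_def)
  have \<theta>: "\<theta> > 0" using L by (simp add: \<theta>_def)
  \<comment> \<open>The chance that a uniform point of the unit cube, scaled into \<open>R\<close>,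
    is rounded to \<open>v\<close>. The cell of \<open>v\<close> in \<open>R\<close> has volume
    \<open>\<theta> * q v\<close>, which matches the Poisson rate with the multinomial
    weight.\<close>
  define q where "q v = measure lborel (?S -` {v} \<inter> Q 1)" for v
  have q0: "q v \<ge> 0" for v by (simp add: q_def)
  have q1: "(\<Sum>v\<in>V. q v) = 1"
  proof -
    have Y1: "iid.Y 1 \<in> borel_measurable P" using iid.Y_indep by (auto simp: iid.indep_vars_def)
    have "(\<Sum>v\<in>V. q v) = (\<Sum>v\<in>V. iid.prob {\<omega>\<in>space P. iid.Y 1 \<omega> \<in> ?S -` {v}})"
      unfolding q_def by (intro sum.cong refl iid.prob_Y[symmetric] Sm) simp
    also have "\<dots> = iid.prob (\<Union>v\<in>V. {\<omega>\<in>space P. iid.Y 1 \<omega> \<in> ?S -` {v}})"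
    proof (intro iid.finite_measure_finite_Union[symmetric] V(1))
      have "{\<omega>\<in>space P. iid.Y 1 \<omega> \<in> ?S -` {v}} \<in> sets P" for v
        using measurable_sets[OF Y1 Sm[of v]] by (simp add: vimage_def Int_def conj_commute)
      then show "(\<lambda>v. {\<omega>\<in>space P. iid.Y 1 \<omega> \<in> ?S -` {v}}) ` V \<subseteq> sets P" by auto
    qed (auto simp: disjoint_family_on_def)
    also have "(\<Union>v\<in>V. {\<omega>\<in>space P. iid.Y 1 \<omega> \<in> ?S -` {v}}) = space P"
    proof -
      have "iid.Y 1 \<omega> \<in> (\<Union>v\<in>V. ?S -` {v})" for \<omega>
        using V(2) iid.Y_mem[of 1 \<omega>] by blast
      then show ?thesis by auto
    qed
    finally show ?thesis by (simp add: iid.prob_space)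
  qed
  have meas: "measure lborel (R \<inter> ?T -` {v}) = \<theta> * q v" for v
  proof -
    have cb: "R = cbox (aff a (vec L) 0) (aff a (vec L) (\<chi> i. 1))"
      unfolding R_def by (rule arg_cong2[where f = cbox]) (simp_all add: vec_eq_iff)
    have pre: "aff a (vec L) -` (R \<inter> ?T -` {v}) = ?S -` {v} \<inter> Q 1"
      unfolding cb using L aff_mem_cbox_iff[of "vec L :: real ^ 'd" a] by (auto simp: Q_def)
    have "emeasure lborel (R \<inter> ?T -` {v}) = ennreal \<theta> * emeasure lborel (?S -` {v} \<inter> Q 1)"
      using emeasure_aff_vimage[of "vec L :: real ^ 'd" "R \<inter> ?T -` {v}" a] L R Tm
      unfolding pre by (simp add: \<theta>_def)
    then show ?thesis using \<theta> by (simp add: measure_def q_def enn2real_mult)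
  qed
  have fact: "(\<Prod>v\<in>V. pois (measure lborel (R \<inter> ?T -` {v})) (count C v)) =
     pois \<theta> (size C) * (real (card (permutations_of_multiset C)) * (\<Prod>v\<in>V. q v ^ count C v))" if "C \<in> msets_in V" for C
    unfolding meas using that by (intro prod_pois_multinomial V q0 q1) (simp add: msets_in_def)
  have mem: "image_mset ?T (config \<omega> R) \<in> msets_in V" if "\<omega> \<in> space M" for \<omega>
    using set_config[OF that R] by (auto simp: msets_in_def V_def)
  have ev: "{\<omega>\<in>space M. image_mset ?T (config \<omega> R) = C} \<in> events" if "C \<in> msets_in V" for C
    using that by (intro config_image_event[OF R V(1) _ Tm]) (auto simp: msets_in_def V_def)
  note cV = countable_msets_in[OF countable_finite[OF V(1)]]
  show "(\<lambda>\<omega>. G (image_mset (grid k) (config \<omega> R))) \<in> borel_measurable M"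
    by (rule borel_measurable_discrete[OF cV mem ev])
  define r where "r C = real (card (permutations_of_multiset C)) * (\<Prod>v\<in>V. q v ^ count C v)" for C
  have r0: "r C \<ge> 0" for C by (auto simp: r_def q0 intro!: mult_nonneg_nonneg prod_nonneg)
  have "(\<integral>\<^sup>+\<omega>. G (image_mset ?T (config \<omega> R)) \<partial>M) =
     (\<integral>\<^sup>+C. emeasure M {\<omega>\<in>space M. image_mset ?T (config \<omega> R) = C} * G C \<partial>count_space (msets_in V))"
    by (rule nn_integral_discrete[OF cV mem ev])
  also have "\<dots> = (\<integral>\<^sup>+C. ennreal (pois \<theta> (size C) * r C) * G C \<partial>count_space (msets_in V))"
  proof (rule nn_integral_cong)
    fix C assume "C \<in> space (count_space (msets_in V))"
    then have C: "C \<in> msets_in V" by simp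
    then have "prob {\<omega>\<in>space M. image_mset ?T (config \<omega> R) = C} = pois \<theta> (size C) * r C"
      unfolding r_def fact[OF C, symmetric] by (intro prob_config_image[OF R V(1) _ Tm]) (auto simp: msets_in_def V_def)
    then show "emeasure M {\<omega>\<in>space M. image_mset ?T (config \<omega> R) = C} * G C = ennreal (pois \<theta> (size C) * r C) * G C"
      by (simp add: emeasure_eq_measure)
  qed
  \<comment> \<open>A sum over \<open>n\<close> with a single nonzero term,
    \<open>n = size C\<close>, is inserted, so that exchanging sum and integral splits the Poisson
    law according to the number of points.\<close>
  also have "\<dots> = (\<integral>\<^sup>+C. (\<Sum>n. ennreal (pois \<theta> n) * (ennreal (if size C = n then r C else 0) * G C)) \<partial>count_space (msets_in V))"
  proof (rule nn_integral_cong)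
    fix C
    have "(\<Sum>n. ennreal (pois \<theta> n) * (ennreal (if size C = n then r C else 0) * G C)) =
       (\<Sum>n\<in>{size C}. ennreal (pois \<theta> n) * (ennreal (if size C = n then r C else 0) * G C))"
      by (intro suminf_finite) auto
    also have "\<dots> = ennreal (pois \<theta> (size C) * r C) * G C"
      using \<theta> r0[of C] by (simp add: ennreal_mult pois_nonneg mult.assoc)
    finally show "ennreal (pois \<theta> (size C) * r C) * G C =
      (\<Sum>n. ennreal (pois \<theta> n) * (ennreal (if size C = n then r C else 0) * G C))" ..
  qed
  also have "\<dots> = (\<Sum>n. \<integral>\<^sup>+C. ennreal (pois \<theta> n) * (ennreal (if size C = n then r C else 0) * G C) \<partial>count_space (msets_in V))"
    by (intro nn_integral_suminf) simp
  also have "\<dots> = (\<Sum>n. ennreal (pois \<theta> n) * (\<integral>\<^sup>+\<omega>. G (image_mset ?S (iid.pts [1..<Suc n] \<omega>)) \<partial>P))"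
  proof (rule suminf_cong)
    fix n
    have js: "distinct [1..<Suc n]" "set [1..<Suc n] \<subseteq> {1..}" "length [1..<Suc n] = n" by auto
    have "(\<integral>\<^sup>+\<omega>. G (image_mset ?S (iid.pts [1..<Suc n] \<omega>)) \<partial>P) =
       (\<integral>\<^sup>+C. ennreal (if size C = n then r C else 0) * G C \<partial>count_space (msets_in V))"
      unfolding iid.nn_integral_pts_discrete[OF js(1,2) V Sm, where G = G] js(3) r_def q_def ..
    then show "(\<integral>\<^sup>+C. ennreal (pois \<theta> n) * (ennreal (if size C = n then r C else 0) * G C) \<partial>count_space (msets_in V)) =
       ennreal (pois \<theta> n) * (\<integral>\<^sup>+\<omega>. G (image_mset ?S (iid.pts [1..<Suc n] \<omega>)) \<partial>P)"
      by (simp add: nn_integral_cmult)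
  qed
  finally show "(\<integral>\<^sup>+\<omega>. G (image_mset (grid k) (config \<omega> R)) \<partial>M) =
    (\<Sum>n. ennreal (pois \<theta> n) * (\<integral>\<^sup>+\<omega>. G (image_mset (grid k) (image_mset (aff a (vec L)) (iid.pts [1..<Suc n] \<omega>))) \<partial>P))"
    by (simp only: image_mset.compositionality)
qed

end

text \<open>An error proportional to the number of points averages to
  \<open>\<eta> * \<theta>\<close>, because the Poisson mean is \<open>\<theta>\<close>.\<close>

lemma suminf_pois_affine_le:
  fixes f g :: "nat \<Rightarrow> ennreal"
  assumes le: "\<And>n. f n \<le> A * g n + B * ennreal (\<eta> * real n)" and \<eta>: "\<eta> \<ge> 0" and \<theta>: "\<theta> \<ge> 0"
  shows "(\<Sum>n. ennreal (pois \<theta> n) * f n) \<le> A * (\<Sum>n. ennreal (pois \<theta> n) * g n) + B * ennreal (\<eta> * \<theta>)"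
proof -
  have "(\<Sum>n. ennreal (pois \<theta> n) * f n) \<le> (\<Sum>n. A * (ennreal (pois \<theta> n) * g n) + (B * ennreal \<eta>) * (ennreal (pois \<theta> n) * ennreal (real n)))"
  proof (intro suminf_le summableI)
    fix n
    have "ennreal (pois \<theta> n) * f n \<le> ennreal (pois \<theta> n) * (A * g n + B * ennreal (\<eta> * real n))"
      by (intro mult_left_mono le) simp
    then show "ennreal (pois \<theta> n) * f n \<le> A * (ennreal (pois \<theta> n) * g n) + (B * ennreal \<eta>) * (ennreal (pois \<theta> n) * ennreal (real n))"
      using \<eta> by (simp add: ennreal_mult distrib_left mult_ac)
  qed
  also have "\<dots> = A * (\<Sum>n. ennreal (pois \<theta> n) * g n) + (B * ennreal \<eta>) * (\<Sum>n. ennreal (pois \<theta> n) * ennreal (real n))"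
    by (subst suminf_add[symmetric]) (simp_all add: ennreal_suminf_cmult)
  finally show ?thesis
    using \<eta> \<theta> by (simp add: suminf_pois_mean ennreal_mult mult.assoc)
qed

context poisson_process
begin

lemma measurable_config_grid:
  assumes A: "A \<in> sets borel" "bounded A"
  shows "(\<lambda>\<omega>. G (image_mset (grid k) (config \<omega> A)) :: ennreal) \<in> borel_measurable M"
proof (rule borel_measurable_discrete[where Y = "\<lambda>\<omega>. image_mset (grid k) (config \<omega> A)" and S = "msets_in (grid k ` A)"])
  have V: "finite (grid k ` A)" by (intro finite_grid_image A)
  show "countable (msets_in (grid k ` A))" by (intro countable_msets_in countable_finite V)
  show "image_mset (grid k) (config \<omega> A) \<in> msets_in (grid k ` A)" if "\<omega> \<in> space M" for \<omega>
    using set_config[OF that A] by (auto simp: msets_in_def)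
  have Tm: "grid k -` {v} \<in> sets borel" for v :: "real ^ 'd"
    using measurable_sets[OF grid_measurable, of "{v}"] by simp
  show "{\<omega>\<in>space M. image_mset (grid k) (config \<omega> A) = C} \<in> events" if "C \<in> msets_in (grid k ` A)" for C
    using that by (intro config_image_event[OF A V subset_refl Tm]) (auto simp: msets_in_def)
qed

lemma box_cost_config:
  assumes A: "A \<in> sets borel" "bounded A" and \<omega>: "\<omega> \<in> space M"
  shows "box_cost p (N \<omega>) A = ot p (atoms (config \<omega> A)) (unif A (of_nat (size (config \<omega> A)) / emeasure lborel A))"
  using A by (simp add: box_cost_eq density_config[OF \<omega> A] emeasure_N_eq_size[OF \<omega> A])

lemma measurable_ot_config:
  assumes A: "A \<in> sets borel" "bounded A" and p: "p > 0"
  shows "(\<lambda>\<omega>. ot p (atoms (config \<omega> A)) (\<nu> (size (config \<omega> A)))) \<in> borel_measurable M"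
proof -
  have "(\<lambda>\<omega>. ot p (atoms (image_mset (grid k) (config \<omega> A))) (\<nu> (size (config \<omega> A)))) \<in> borel_measurable M" for k
    using measurable_config_grid[OF A, of "\<lambda>C. ot p (atoms C) (\<nu> (size C))" k] by simp
  from measurable_ot_grid[OF p, where B = "\<lambda>\<omega>. config \<omega> A" and \<nu> = \<nu>, OF this] show ?thesis .
qed

lemma measurable_box_cost:
  assumes A: "A \<in> sets borel" "bounded A" and p: "p > 0"
  shows "(\<lambda>\<omega>. box_cost p (N \<omega>) A) \<in> borel_measurable M"
  by (subst measurable_cong[OF box_cost_config[OF A]], assumption)
    (rule measurable_ot_config[OF A p, where \<nu> = "\<lambda>s. unif A (of_nat s / emeasure lborel A)"])

end

section \<open>Mean cost of a fixed number of points: finiteness, convexity, lower bound\<close>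

context iid_points
begin

lemma alpha_0 [simp]: "alpha p 0 = 0"
proof -
  have "ot p (atoms {#}) (unif (Q 1 :: (real ^ 'd) set) 0) = 0"
    by (intro ot_null) (simp_all add: emeasure_unif)
  then show ?thesis by (simp add: alpha_def)
qed

text \<open>In the unit cube no distance exceeds the dimension. Together with
  \<open>alpha_Suc_le\<close> this makes every \<open>alpha p n\<close> finite.\<close>

lemma alpha_1_finite: "p \<ge> 0 \<Longrightarrow> alpha p 1 < \<top>"
proof -
  assume p: "p \<ge> 0"
  have "ot p (atoms {#Y 1 \<omega>#}) (unif (Q 1) 1) \<le> ennreal (real CARD('d) powr p)" for \<omega>
  proof -
    have u: "emeasure (unif (Q 1 :: (real ^ 'd) set) 1) UNIV = 1"
      by (simp add: emeasure_unif emeasure_Q)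
    have "ot p (atoms {#Y 1 \<omega>#}) (unif (Q 1) 1) \<le> (\<integral>\<^sup>+ z. ennreal (norm (Y 1 \<omega> - z) powr p) \<partial>unif (Q 1) 1)"
      by (intro ot_single_le u) simp
    also have "\<dots> \<le> (\<integral>\<^sup>+ z. ennreal (real CARD('d) powr p) \<partial>unif (Q 1 :: (real ^ 'd) set) 1)"
    proof (rule nn_integral_mono_AE)
      have bound: "norm (Y 1 \<omega> - z) \<le> real CARD('d)" if z: "z \<in> Q 1" for z
      proof -
        have "norm (Y 1 \<omega> - z) \<le> (\<Sum>i\<in>UNIV. \<bar>(Y 1 \<omega> - z) $ i\<bar>)"
          by (rule norm_le_l1_cart)
        also have "\<dots> \<le> (\<Sum>i\<in>(UNIV :: 'd set). 1)"
        proof (rule sum_mono)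
          fix i
          have "0 \<le> Y 1 \<omega> $ i" "Y 1 \<omega> $ i \<le> 1" "0 \<le> z $ i" "z $ i \<le> 1"
            using Y_mem[of 1 \<omega>] z by (auto simp: Q_def mem_box_cart)
          then show "\<bar>(Y 1 \<omega> - z) $ i\<bar> \<le> 1" by (simp add: abs_le_iff)
        qed
        finally show ?thesis by simp
      qed
      show "AE z in unif (Q 1) 1. ennreal (norm (Y 1 \<omega> - z) powr p) \<le> ennreal (real CARD('d) powr p)"
        unfolding unif_def using p bound
        by (subst AE_density) (auto intro!: AE_I2 ennreal_leI powr_mono2 simp: indicator_def)
    qed
    also have "\<dots> = ennreal (real CARD('d) powr p)" using u by simp
    finally show ?thesis .
  qed
  then have "alpha p 1 \<le> (\<integral>\<^sup>+\<omega>. ennreal (real CARD('d) powr p) \<partial>P)"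
    unfolding alpha_def by (intro nn_integral_mono) simp
  also have "\<dots> < \<top>" by (simp add: emeasure_space_1)
  finally show ?thesis .
qed

text \<open>The empirical measure of \<open>n + 1\<close> points is the average of the empirical measures obtained by
  leaving out one of them, and the transport cost is jointly convex.\<close>

lemma alpha_Suc_le:
  assumes n: "n \<ge> 1" and p: "p > 0"
  shows "alpha p (Suc n) \<le> of_nat (Suc n) / of_nat n * alpha p n"
proof -
  define I where "I = {1..Suc n}"
  define js where "js i = remove1 i [1..<Suc (Suc n)]" for i
  have js: "distinct (js i)" "set (js i) \<subseteq> {1..}" "length (js i) = n" if "i \<in> I" for i
    using that by (auto simp: js_def I_def length_remove1)
  \<comment> \<open>Each of the \<open>n + 1\<close> points belongs to exactly \<open>n\<close> of
    the sublists \<open>js i\<close>, so the weight \<open>1 / n\<close> counts it once in total.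
    The sum of the weights, \<open>(n + 1) / n\<close>, is the factor in the claim.\<close>
  define c where "c = (1 / of_nat n :: ennreal)"
  have c: "0 < c" "c < \<top>" "c * of_nat n = 1"
  proof -
    have "c = ennreal (1 / real n)" using n
      by (simp add: c_def ennreal_of_nat_eq_real_of_nat divide_ennreal[symmetric])
    then show "0 < c" "c < \<top>" "c * of_nat n = 1"
      using n by (simp_all add: ennreal_of_nat_eq_real_of_nat ennreal_mult[symmetric])
  qed
  have emm: "emeasure (atoms (mset (map f l))) A = (\<Sum>j\<in>set l. indicator A (f j))" if "A \<in> sets borel" "distinct l" for A l and f :: "nat \<Rightarrow> real ^ 'd"
  proof -
    have "emeasure (atoms (mset (map f l))) A = (\<Sum>i<length l. indicator A (f (l ! i)))"
      using emeasure_atoms_list[OF that(1), of "map f l"] by simp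
    also have "\<dots> = (\<Sum>j\<in>set l. indicator A (f j))"
      using sum.reindex_bij_betw[OF bij_betw_nth[OF that(2) refl refl], of "\<lambda>j. indicator A (f j) :: ennreal"] by simp
    finally show ?thesis .
  qed
  have "ot p (atoms (pts [1..<Suc (Suc n)] \<omega>)) (unif (Q 1) (of_nat (Suc n))) \<le>
      (\<Sum>i\<in>I. c * ot p (atoms (pts (js i) \<omega>)) (unif (Q 1) (of_nat n)))" for \<omega>
  proof (rule ot_wsum_le)
    fix A :: "(real ^ 'd) set" assume A: "A \<in> sets borel"
    let ?t = "\<lambda>j. indicator A (Y j \<omega>) :: ennreal"
    have "(\<Sum>i\<in>I. c * emeasure (atoms (pts (js i) \<omega>)) A) = (\<Sum>i\<in>I. c * (\<Sum>j\<in>I - {i}. ?t j))"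
    proof (intro sum.cong refl arg_cong2[where f = "(*)"])
      fix i assume i: "i \<in> I"
      have "set (js i) = I - {i}" by (auto simp: js_def I_def)
      then show "emeasure (atoms (pts (js i) \<omega>)) A = (\<Sum>j\<in>I - {i}. ?t j)"
        using emm[OF A js(1)[OF i], of "\<lambda>j. Y j \<omega>"] by simp
    qed
    also have "\<dots> = c * (\<Sum>i\<in>I. \<Sum>j\<in>I. if j \<noteq> i then ?t j else 0)"
      unfolding sum_distrib_left[symmetric]
      by (intro arg_cong2[where f = "(*)"] refl sum.cong sum.mono_neutral_cong_left) (auto simp: I_def)
    also have "(\<Sum>i\<in>I. \<Sum>j\<in>I. if j \<noteq> i then ?t j else 0) = (\<Sum>j\<in>I. \<Sum>i\<in>I. if j \<noteq> i then ?t j else 0)"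
      by (rule sum.swap)
    also have "\<dots> = (\<Sum>j\<in>I. of_nat n * ?t j)"
    proof (intro sum.cong refl)
      fix j assume j: "j \<in> I"
      have "(\<Sum>i\<in>I. if j \<noteq> i then ?t j else 0) = (\<Sum>i\<in>I - {j}. ?t j)"
        by (intro sum.mono_neutral_cong_right) (auto simp: I_def)
      also have "\<dots> = of_nat n * ?t j" using j by (simp add: I_def)
      finally show "(\<Sum>i\<in>I. if j \<noteq> i then ?t j else 0) = of_nat n * ?t j" .
    qed
    also have "c * \<dots> = (\<Sum>j\<in>I. ?t j)"
      unfolding sum_distrib_left[symmetric] mult.assoc[symmetric] c(3) by simp
    also have "\<dots> = emeasure (atoms (pts [1..<Suc (Suc n)] \<omega>)) A"
      using emm[OF A, of "[1..<Suc (Suc n)]" "\<lambda>j. Y j \<omega>"] unfolding I_def set_upt atLeastLessThanSuc_atLeastAtMost by (simp del: upt_Suc)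
    finally show "emeasure (atoms (pts [1..<Suc (Suc n)] \<omega>)) A = (\<Sum>i\<in>I. c * emeasure (atoms (pts (js i) \<omega>)) A)" ..
    show "emeasure (unif (Q 1) (of_nat (Suc n))) A = (\<Sum>i\<in>I. c * emeasure (unif (Q 1) (of_nat n)) A)"
      using A c(3) by (simp add: emeasure_unif I_def mult.assoc[symmetric])
  qed (use c in \<open>simp_all add: I_def\<close>)
  then have "alpha p (Suc n) \<le> (\<integral>\<^sup>+\<omega>. (\<Sum>i\<in>I. c * ot p (atoms (pts (js i) \<omega>)) (unif (Q 1) (of_nat n))) \<partial>P)"
    unfolding alpha_def by (intro nn_integral_mono) simp
  also have "\<dots> = (\<Sum>i\<in>I. c * (\<integral>\<^sup>+\<omega>. ot p (atoms (pts (js i) \<omega>)) (unif (Q 1) (of_nat n)) \<partial>P))"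
    using measurable_ot_pts[OF js(1,2) p] by (subst nn_integral_sum) (auto simp: nn_integral_cmult)
  also have "\<dots> = (\<Sum>i\<in>I. c * alpha p n)"
    using alpha_eq[OF js p] by simp
  also have "\<dots> = of_nat (Suc n) / of_nat n * alpha p n"
    by (simp add: I_def c_def divide_ennreal_def mult.assoc)
  finally show ?thesis .
qed

lemma ot_scale_le:
  fixes \<mu> \<nu> \<mu>' \<nu>' :: "(real ^ 'd) measure"
  assumes "sets \<mu> = sets borel" "sets \<nu> = sets borel"
    and "\<And>A. A \<in> sets borel \<Longrightarrow> emeasure \<mu> A = c * emeasure \<mu>' A"
    and "\<And>A. A \<in> sets borel \<Longrightarrow> emeasure \<nu> A = c * emeasure \<nu>' A"
    and "0 < c" "c < \<top>"
  shows "ot p \<mu> \<nu> \<le> c * ot p \<mu>' \<nu>'"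
  using ot_wsum_le[of "{()}" \<mu> \<nu> "\<lambda>_. c" "\<lambda>_. \<mu>'" "\<lambda>_. \<nu>'" p] assms by simp

text \<open>Almost surely the points \<open>X i\<close> agree with the modified points
  \<open>Y i\<close>, and the cost is homogeneous in the mass: \<open>ot_scale_le\<close> with the
  factors \<open>1 / n\<close> and \<open>n\<close> gives the two inequalities.\<close>

lemma nn_integral_empirical_cost:
  assumes n: "n \<ge> 1" and p: "p > 0"
  shows "(\<integral>\<^sup>+ \<omega>. transport_cost p (Q 1) (empirical_measure n (\<lambda>i. X i \<omega>)) lborel \<partial>P) = alpha p n / of_nat n"
proof -
  define c where "c = (1 / of_nat n :: ennreal)"
  have c: "0 < c" "c < \<top>" "c * of_nat n = 1"
  proof -
    have "c = ennreal (1 / real n)" using n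
      by (simp add: c_def ennreal_of_nat_eq_real_of_nat divide_ennreal[symmetric])
    then show "0 < c" "c < \<top>" "c * of_nat n = 1"
      using n by (simp_all add: ennreal_of_nat_eq_real_of_nat ennreal_mult[symmetric])
  qed
  have js: "distinct [1..<Suc n]" "set [1..<Suc n] \<subseteq> {1..}" by auto
  have eq: "transport_cost p (Q 1) (empirical_measure n (\<lambda>i. X i \<omega>)) lborel =
     c * ot p (atoms (pts [1..<Suc n] \<omega>)) (unif (Q 1) (of_nat n))" if XY: "\<forall>i\<in>{1..n}. X i \<omega> = Y i \<omega>" for \<omega>
  proof -
    define \<mu> where "\<mu> = density (empirical_measure n (\<lambda>i. X i \<omega>)) (indicator (Q 1))"
    have s: "sets (empirical_measure n (\<lambda>i. X i \<omega>)) = sets borel" by (simp add: empirical_measure_def)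
    have pe: "image_mset (\<lambda>i. X i \<omega>) (mset_set {1..n}) = pts [1..<Suc n] \<omega>"
    proof -
      have "image_mset (\<lambda>i. X i \<omega>) (mset_set {1..n}) = image_mset (\<lambda>i. Y i \<omega>) (mset_set {1..n})"
        using XY by (intro image_mset_cong) auto
      then show ?thesis by (simp only: mset_map mset_upt atLeastLessThanSuc_atLeastAtMost)
    qed
    have emp: "empirical_measure n (\<lambda>i. X i \<omega>) = scale_measure c (atoms (pts [1..<Suc n] \<omega>))"
      unfolding empirical_measure_def c_def by (simp only: dirac_sum_finite[OF finite_atLeastAtMost] pe)
    have \<mu>: "emeasure \<mu> A = c * emeasure (atoms (pts [1..<Suc n] \<omega>)) A" if A: "A \<in> sets borel" for A
    proof -
      have "emeasure \<mu> A = c * emeasure (atoms (pts [1..<Suc n] \<omega>)) (A \<inter> Q 1)"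
        unfolding \<mu>_def using A by (subst emeasure_density_indicator'[OF s])
          (simp_all add: emp del: upt_Suc)
      also have "emeasure (atoms (pts [1..<Suc n] \<omega>)) (A \<inter> Q 1) = emeasure (atoms (pts [1..<Suc n] \<omega>)) A"
      proof -
        have "filter_mset (\<lambda>x. x \<in> A \<inter> Q 1) (pts [1..<Suc n] \<omega>) = filter_mset (\<lambda>x. x \<in> A) (pts [1..<Suc n] \<omega>)"
          using Y_mem by (intro filter_mset_cong refl) auto
        then show ?thesis by (simp only: emeasure_atoms A sets.Int Q_sets)
      qed
      finally show ?thesis .
    qed
    have \<nu>: "density lborel (indicator (Q 1)) = unif (Q 1 :: (real ^ 'd) set) 1"
      by (simp add: unif_def)
    have "transport_cost p (Q 1) (empirical_measure n (\<lambda>i. X i \<omega>)) lborel = ot p \<mu> (unif (Q 1) 1)"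
      by (simp add: transport_cost_eq_ot \<mu>_def \<nu>)
    also have "\<dots> = c * ot p (atoms (pts [1..<Suc n] \<omega>)) (unif (Q 1) (of_nat n))"
    proof (rule antisym)
      show "ot p \<mu> (unif (Q 1) 1) \<le> c * ot p (atoms (pts [1..<Suc n] \<omega>)) (unif (Q 1) (of_nat n))"
        using c \<mu> by (intro ot_scale_le) (auto simp: emeasure_unif \<mu>_def s mult.assoc[symmetric])
      have "ot p (atoms (pts [1..<Suc n] \<omega>)) (unif (Q 1) (of_nat n)) \<le> of_nat n * ot p \<mu> (unif (Q 1) 1)"
      proof (rule ot_scale_le)
        have c': "of_nat n * c = 1" using c(3) by (simp only: mult.commute)
        fix A :: "(real ^ 'd) set" assume A: "A \<in> sets borel"
        show "emeasure (atoms (pts [1..<Suc n] \<omega>)) A = of_nat n * emeasure \<mu> A"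
          by (simp only: \<mu>[OF A] mult.assoc[symmetric] c' mult_1)
        show "emeasure (unif (Q 1 :: (real ^ 'd) set) (of_nat n)) A = of_nat n * emeasure (unif (Q 1) 1) A"
          using A by (simp add: emeasure_unif)
      qed (use n in \<open>simp_all add: ennreal_of_nat_eq_real_of_nat\<close>)
      then have "c * ot p (atoms (pts [1..<Suc n] \<omega>)) (unif (Q 1) (of_nat n)) \<le> c * (of_nat n * ot p \<mu> (unif (Q 1) 1))"
        by (intro mult_left_mono) auto
      then show "c * ot p (atoms (pts [1..<Suc n] \<omega>)) (unif (Q 1) (of_nat n)) \<le> ot p \<mu> (unif (Q 1) 1)"
        by (simp add: mult.assoc[symmetric] c(3))
    qed
    finally show ?thesis .
  qed
  have "AE \<omega> in P. \<forall>i\<in>{1..n}. X i \<omega> = Y i \<omega>"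
    using AE_X_eq_Y by (intro AE_finite_allI) auto
  then have "(\<integral>\<^sup>+ \<omega>. transport_cost p (Q 1) (empirical_measure n (\<lambda>i. X i \<omega>)) lborel \<partial>P) =
     (\<integral>\<^sup>+ \<omega>. c * ot p (atoms (pts [1..<Suc n] \<omega>)) (unif (Q 1) (of_nat n)) \<partial>P)"
    by (intro nn_integral_cong_AE) (erule eventually_mono, rule eq)
  also have "\<dots> = c * alpha p n"
    unfolding alpha_def by (intro nn_integral_cmult measurable_ot_pts js p)
  finally show ?thesis by (simp add: c_def divide_ennreal_def mult.commute)
qed

lemma alpha_lower:
  assumes n: "n \<ge> 1" and p: "p > 0"
  shows "ennreal (real n / 2 * ((2 * real n) powr (- 1 / CARD('d)) / 2) powr p) \<le> alpha p n"
proof -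
  let ?c = "ennreal (real n / 2 * ((2 * real n) powr (- 1 / CARD('d)) / 2) powr p)"
  have "?c = (\<integral>\<^sup>+\<omega>. ?c \<partial>P)" by (simp add: emeasure_space_1)
  also have "\<dots> \<le> alpha p n"
    unfolding alpha_def using n p by (intro nn_integral_mono ot_atoms_lower_bound) auto
  finally show ?thesis .
qed

end

context poisson_and_iid
begin

text \<open>For rounded configurations the identity is
  \<open>nn_integral_config_eq_poissonised\<close>. As the grid is refined both sides converge,
  since the rounding error has mean \<open>\<theta>\<close> times the error per point on either
  side, and limits are unique.\<close>

lemma nn_integral_box_cost_cube:
  fixes a :: "real ^ 'd"
  assumes L: "L > 0" and p: "p > 0"
  shows "(\<integral>\<^sup>+\<omega>. box_cost p (N \<omega>) (cbox a (a + vec L)) \<partial>M) =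
    (\<Sum>n. ennreal (pois (L ^ CARD('d)) n) * (ennreal (L powr p) * iid.alpha p n))"
proof -
  define R where "R = cbox a (a + vec L)"
  define \<theta> where "\<theta> = L ^ CARD('d)"
  have \<theta>: "\<theta> > 0" using L by (simp add: \<theta>_def)
  have R: "R \<in> sets borel" "bounded R" by (auto simp: R_def)
  have volR: "emeasure lborel R = ennreal \<theta>"
    unfolding R_def using L by (subst emeasure_cbox_cart) (auto simp: \<theta>_def)
  define \<nu> where "\<nu> s = unif R (of_nat s / ennreal \<theta>)" for s
  let ?B = "\<lambda>n \<omega>. image_mset (aff a (vec L)) (iid.pts [1..<Suc n] \<omega>)"
  define F where "F n = (\<integral>\<^sup>+\<omega>. ot p (atoms (?B n \<omega>)) (\<nu> n) \<partial>P)" for n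
  define Fk where "Fk k n = (\<integral>\<^sup>+\<omega>. ot p (atoms (image_mset (grid k) (?B n \<omega>))) (\<nu> n) \<partial>P)" for k n
  have js: "distinct [1..<Suc n]" "set [1..<Suc n] \<subseteq> {1..}" for n by auto
  have F_eq: "F n = ennreal (L powr p) * iid.alpha p n" for n
    unfolding F_def \<nu>_def R_def \<theta>_def ot_affine_cube[OF L] iid.alpha_def
    by (intro nn_integral_cmult iid.measurable_ot_pts js p)
  have mk: "(\<lambda>\<omega>. ot p (atoms (image_mset (grid k) (?B n \<omega>))) (\<nu> n)) \<in> borel_measurable P" for k n
    using iid.measurable_pts_grid[OF js L, of "\<lambda>C. ot p (atoms C) (\<nu> n)"] .
  have le1: "F n \<le> ennreal (K1 p e) * Fk k n + ennreal (K2 p e) * ennreal (grid_error p TYPE('d) k * real n)"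
    and le2: "Fk k n \<le> ennreal (K1 p e) * F n + ennreal (K2 p e) * ennreal (grid_error p TYPE('d) k * real n)"
    if "e > 0" for e k n
    unfolding F_def Fk_def
    by (rule nn_integral_ot_grid_le[OF p, where \<nu> = "\<lambda>_. \<nu> n" and B = "?B n", OF mk];
        use that in \<open>simp add: iid.emeasure_space_1\<close>)
      (rule nn_integral_ot_grid_ge[OF p, where \<nu> = "\<lambda>_. \<nu> n" and B = "?B n", OF mk];
        use that in \<open>simp add: iid.emeasure_space_1\<close>)
  have lim1: "(\<lambda>k. \<Sum>n. ennreal (pois \<theta> n) * Fk k n) \<longlonglongrightarrow> (\<Sum>n. ennreal (pois \<theta> n) * F n)"
  proof (rule tendsto_K1_K2_sandwich[where p = p and \<eta> = "\<lambda>k. grid_error p TYPE('d) k * \<theta>"])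
    fix e :: real and k :: nat assume e: "e > 0"
    show "(\<Sum>n. ennreal (pois \<theta> n) * F n) \<le> ennreal (K1 p e) * (\<Sum>n. ennreal (pois \<theta> n) * Fk k n) + ennreal (K2 p e) * ennreal (grid_error p TYPE('d) k * \<theta>)"
      using \<theta> by (intro suminf_pois_affine_le le1 e grid_error_nonneg) simp
    show "(\<Sum>n. ennreal (pois \<theta> n) * Fk k n) \<le> ennreal (K1 p e) * (\<Sum>n. ennreal (pois \<theta> n) * F n) + ennreal (K2 p e) * ennreal (grid_error p TYPE('d) k * \<theta>)"
      using \<theta> by (intro suminf_pois_affine_le le2 e grid_error_nonneg) simp
  qed (use \<theta> in \<open>simp_all add: tendsto_grid_error_mult grid_error_tendsto p grid_error_nonneg\<close>)
  have mM: "(\<lambda>\<omega>. ot p (atoms (image_mset (grid k) (config \<omega> R))) (\<nu> (size (config \<omega> R)))) \<in> borel_measurable M" for k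
    using measurable_config_grid[OF R, of "\<lambda>C. ot p (atoms C) (\<nu> (size C))" k] by simp
  have sm: "(\<lambda>\<omega>. ennreal (real (size (config \<omega> R)))) \<in> borel_measurable M"
    by (rule measurable_size_config[OF R])
  have si: "(\<integral>\<^sup>+\<omega>. ennreal (real (size (config \<omega> R))) \<partial>M) = ennreal \<theta>"
    using nn_integral_size_config[OF R, of "\<lambda>n. ennreal (real n)"] \<theta> volR
    by (simp add: measure_def suminf_pois_mean)
  have lim2: "(\<lambda>k. \<integral>\<^sup>+\<omega>. ot p (atoms (image_mset (grid k) (config \<omega> R))) (\<nu> (size (config \<omega> R))) \<partial>M) \<longlonglongrightarrow>
      (\<integral>\<^sup>+\<omega>. ot p (atoms (config \<omega> R)) (\<nu> (size (config \<omega> R))) \<partial>M)"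
  proof (rule tendsto_K1_K2_sandwich[where p = p and \<eta> = "\<lambda>k. grid_error p TYPE('d) k * \<theta>"])
    fix e :: real and k :: nat assume e: "e > 0"
    show "(\<integral>\<^sup>+\<omega>. ot p (atoms (config \<omega> R)) (\<nu> (size (config \<omega> R))) \<partial>M) \<le> ennreal (K1 p e) *
      (\<integral>\<^sup>+\<omega>. ot p (atoms (image_mset (grid k) (config \<omega> R))) (\<nu> (size (config \<omega> R))) \<partial>M) + ennreal (K2 p e) * ennreal (grid_error p TYPE('d) k * \<theta>)"
      using \<theta> by (intro nn_integral_ot_grid_le[OF p mM sm si _ e]) simp
    show "(\<integral>\<^sup>+\<omega>. ot p (atoms (image_mset (grid k) (config \<omega> R))) (\<nu> (size (config \<omega> R))) \<partial>M) \<le> ennreal (K1 p e) *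
      (\<integral>\<^sup>+\<omega>. ot p (atoms (config \<omega> R)) (\<nu> (size (config \<omega> R))) \<partial>M) + ennreal (K2 p e) * ennreal (grid_error p TYPE('d) k * \<theta>)"
      using \<theta> by (intro nn_integral_ot_grid_ge[OF p mM sm si _ e]) simp
  qed (use \<theta> in \<open>simp_all add: tendsto_grid_error_mult grid_error_tendsto p grid_error_nonneg\<close>)
  have "(\<integral>\<^sup>+\<omega>. ot p (atoms (image_mset (grid k) (config \<omega> R))) (\<nu> (size (config \<omega> R))) \<partial>M) = (\<Sum>n. ennreal (pois \<theta> n) * Fk k n)" for k
    using nn_integral_config_eq_poissonised(1)[OF L, of "\<lambda>C. ot p (atoms C) (\<nu> (size C))" k a]
    unfolding R_def[symmetric] \<theta>_def[symmetric] Fk_def by (simp del: upt_Suc)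
  then have "(\<integral>\<^sup>+\<omega>. ot p (atoms (config \<omega> R)) (\<nu> (size (config \<omega> R))) \<partial>M) = (\<Sum>n. ennreal (pois \<theta> n) * F n)"
    using LIMSEQ_unique[OF lim2] lim1 by simp
  also have "(\<integral>\<^sup>+\<omega>. ot p (atoms (config \<omega> R)) (\<nu> (size (config \<omega> R))) \<partial>M) = (\<integral>\<^sup>+\<omega>. box_cost p (N \<omega>) R \<partial>M)"
    using R by (intro nn_integral_cong) (simp add: box_cost_config \<nu>_def volR)
  finally show ?thesis by (simp add: F_eq R_def \<theta>_def)
qed

end

section \<open>Near-subadditivity\<close>

text \<open>The fraction \<open>n1 / N\<close> is unstable only for small \<open>N\<close>. If
  \<open>N \<ge> \<theta> / 2\<close>, the deviation is
  \<open>\<bar>n1 - \<alpha> * N\<bar> / N\<close> and \<open>N powr (1 - p)\<close> is at most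
  \<open>(\<theta> / 2) powr (1 - p)\<close>. Otherwise the deviation is at most 1 and
  \<open>\<bar>N - \<theta>\<bar>\<close> itself exceeds \<open>\<theta> / 2\<close>.\<close>

lemma split_error_le:
  fixes n1 n2 \<theta> \<alpha> p :: real
  assumes p: "p \<ge> 1" and \<alpha>: "0 \<le> \<alpha>" "\<alpha> \<le> 1" and \<theta>: "\<theta> > 0" and n: "n1 \<ge> 0" "n2 \<ge> 0"
  shows "\<bar>n1 / (n1 + n2) - \<alpha>\<bar> powr p * (n1 + n2) \<le>
    (\<theta> / 2) powr (1 - p) * (2 powr p * \<bar>n1 - \<alpha> * \<theta>\<bar> powr p + (2 powr p + 1) * \<bar>n1 + n2 - \<theta>\<bar> powr p)"
proof -
  define N where "N = n1 + n2"
  have N: "N \<ge> 0" using n by (simp add: N_def)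
  let ?R = "2 powr p * \<bar>n1 - \<alpha> * \<theta>\<bar> powr p + (2 powr p + 1) * \<bar>N - \<theta>\<bar> powr p"
  have "\<bar>n1 / N - \<alpha>\<bar> powr p * N \<le> (\<theta> / 2) powr (1 - p) * ?R"
  proof (cases "N \<ge> \<theta> / 2")
    case True
    then have N0: "N > 0" using \<theta> by linarith
    have "\<bar>n1 / N - \<alpha>\<bar> = \<bar>n1 - \<alpha> * N\<bar> / N"
      using N0 by (simp add: divide_simps abs_div_pos[symmetric])
    then have "\<bar>n1 / N - \<alpha>\<bar> powr p * N = \<bar>n1 - \<alpha> * N\<bar> powr p * (N powr 1 / N powr p)"
      using N0 by (simp add: powr_divide)
    also have "N powr 1 / N powr p = N powr (1 - p)"
      by (rule powr_diff[symmetric])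
    also have "\<bar>n1 - \<alpha> * N\<bar> powr p * N powr (1 - p) \<le> ?R * (\<theta> / 2) powr (1 - p)"
    proof (rule mult_mono)
      show "N powr (1 - p) \<le> (\<theta> / 2) powr (1 - p)"
        using True \<theta> p by (intro powr_mono2') auto
      have "\<bar>n1 - \<alpha> * N\<bar> powr p \<le> (\<bar>n1 - \<alpha> * \<theta>\<bar> + \<bar>N - \<theta>\<bar>) powr p"
      proof (intro powr_mono2)
        have "n1 - \<alpha> * N = (n1 - \<alpha> * \<theta>) - \<alpha> * (N - \<theta>)"
          by (simp add: algebra_simps)
        then have "\<bar>n1 - \<alpha> * N\<bar> \<le> \<bar>n1 - \<alpha> * \<theta>\<bar> + \<bar>\<alpha> * (N - \<theta>)\<bar>"
          by linarith
        also have "\<bar>\<alpha> * (N - \<theta>)\<bar> \<le> \<bar>N - \<theta>\<bar>"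
          using \<alpha> by (simp add: abs_mult mult_left_le_one_le)
        finally show "\<bar>n1 - \<alpha> * N\<bar> \<le> \<bar>n1 - \<alpha> * \<theta>\<bar> + \<bar>N - \<theta>\<bar>" by simp
      qed (use p in auto)
      also have "\<dots> \<le> 2 powr p * \<bar>n1 - \<alpha> * \<theta>\<bar> powr p + 2 powr p * \<bar>N - \<theta>\<bar> powr p"
        using powr_add_le_K1_K2[of "\<bar>n1 - \<alpha> * \<theta>\<bar>" "\<bar>N - \<theta>\<bar>" 1 p] p by (simp add: K1_def K2_def)
      also have "\<dots> \<le> ?R"
        by (simp add: distrib_right)
      finally show "\<bar>n1 - \<alpha> * N\<bar> powr p \<le> ?R" .
    qed auto
    finally show ?thesis by (simp only: mult.commute)
  next
    case False
    have le1: "\<bar>n1 / N - \<alpha>\<bar> \<le> 1"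
    proof -
      have "0 \<le> n1 / N" "n1 / N \<le> 1" using n N by (auto simp: N_def divide_simps)
      then show ?thesis using \<alpha> by (simp add: abs_le_iff)
    qed
    have "\<bar>n1 / N - \<alpha>\<bar> powr p * N \<le> 1 * N"
      using le1 p N powr_mono2[of p "\<bar>n1 / N - \<alpha>\<bar>" 1] by (intro mult_right_mono) auto
    also have "\<dots> \<le> (\<theta> / 2) powr 1" using False \<theta> by simp
    also have "\<dots> = (\<theta> / 2) powr (1 - p) * (\<theta> / 2) powr p"
      by (simp add: powr_add[symmetric])
    also have "\<dots> \<le> (\<theta> / 2) powr (1 - p) * \<bar>N - \<theta>\<bar> powr p"
      using False \<theta> p by (intro mult_left_mono powr_mono2) auto
    also have "\<dots> \<le> (\<theta> / 2) powr (1 - p) * ?R"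
      by (intro mult_left_mono) (auto simp: distrib_right)
    finally show ?thesis .
  qed
  then show ?thesis by (simp add: N_def)
qed

text \<open>The factors come from \<open>(\<theta> / 2) powr (1 - p)\<close>, from the two
  coefficients in \<open>split_error_le\<close> added up, and from
  \<open>poisson_central_moment\<close>.\<close>

definition cut_const :: "real \<Rightarrow> real"
  where "cut_const p = 2 powr (p - 1) * (2 * 2 powr p + 1) * (2 * exp 1 * fact (nat \<lceil>p\<rceil>))"

context poisson_process
begin

lemma central_moment_config:
  assumes A: "A \<in> sets borel" "bounded A" and \<theta>: "measure lborel A = \<theta>" "\<theta> \<ge> 1" and p: "p \<ge> 0"
  shows "(\<integral>\<^sup>+\<omega>. ennreal (\<bar>real (size (config \<omega> A)) - \<theta>\<bar> powr p) \<partial>M) \<le> ennreal (2 * exp 1 * fact (nat \<lceil>p\<rceil>) * \<theta> powr (p / 2))"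
proof -
  note pm = poisson_central_moment[OF \<theta>(2) p]
  have "(\<integral>\<^sup>+\<omega>. ennreal (\<bar>real (size (config \<omega> A)) - \<theta>\<bar> powr p) \<partial>M) = (\<Sum>k. ennreal (pois \<theta> k) * ennreal (\<bar>real k - \<theta>\<bar> powr p))"
    using nn_integral_size_config[OF A, of "\<lambda>k. ennreal (\<bar>real k - \<theta>\<bar> powr p)"] \<theta> by simp
  also have "\<dots> = (\<Sum>k. ennreal (pois \<theta> k * \<bar>real k - \<theta>\<bar> powr p))"
    using \<theta> by (simp add: ennreal_mult pois_nonneg)
  also have "\<dots> = ennreal (\<Sum>k. pois \<theta> k * \<bar>real k - \<theta>\<bar> powr p)"
    using \<theta> by (intro suminf_ennreal2 pm) (auto simp: pois_nonneg)
  also have "\<dots> \<le> ennreal (2 * exp 1 * fact (nat \<lceil>p\<rceil>) * \<theta> powr (p / 2))"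
    by (intro ennreal_leI pm)
  finally show ?thesis .
qed

definition mean_cost :: "real \<Rightarrow> real ^ 'd \<Rightarrow> real ^ 'd \<Rightarrow> ennreal"
  where "mean_cost p a b = (\<integral>\<^sup>+\<omega>. box_cost p (N \<omega>) (cbox a b) \<partial>M)"

lemma AE_null_set_N:
  assumes A: "A \<in> sets borel" "bounded A" "emeasure lborel A = 0"
  shows "AE \<omega> in M. emeasure (N \<omega>) A = 0"
proof -
  have "prob {\<omega>\<in>space M. emeasure (N \<omega>) A = of_nat 0} = 1"
    using A by (subst N_law) (auto simp: measure_def pois_def)
  then have "prob {\<omega>\<in>space M. emeasure (N \<omega>) A = 0} = 1" by simp
  moreover have "{\<omega>\<in>space M. emeasure (N \<omega>) A = 0} \<in> events"
    using measurable_sets[OF N_measurable[OF A(1)], of "{0}"] by (simp add: vimage_def Int_def conj_commute)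
  ultimately have "AE \<omega> in M. \<omega> \<in> {\<omega>\<in>space M. emeasure (N \<omega>) A = 0}"
    using AE_in_set_eq_1 by blast
  then show ?thesis by auto
qed

text \<open>The error of \<open>split_error_le\<close> is expressed by the counts of the whole box
  and of the first half; both have volume at least 1, so the moment bound applies to them. The
  powers of the volume combine as \<open>(1 - p) + p / 2 = 1 - p / 2\<close>.\<close>

lemma mean_cost_split:
  fixes a b :: "real ^ 'd"
  assumes ab: "\<And>k. a $ k < b $ k" and c: "a $ i < c" "c < b $ i"
    and p: "p \<ge> 1" and e: "e > 0" and vol1: "vol a (upd b i c) \<ge> 1"
  shows "mean_cost p a b \<le> ennreal (K1 p e) * (mean_cost p a (upd b i c) + mean_cost p (upd a i c) b)
     + ennreal (K2 p e * ((b $ i - a $ i) powr p * (cut_const p * vol a b powr (1 - p / 2))))"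
proof -
  define \<theta> where "\<theta> = vol a b"
  define \<alpha> where "\<alpha> = (c - a $ i) / (b $ i - a $ i)"
  define S where "S = b $ i - a $ i"
  have S: "S > 0" using ab[of i] by (simp add: S_def)
  have \<alpha>: "0 < \<alpha>" "\<alpha> < 1" using ab[of i] c by (auto simp: \<alpha>_def)
  have v1: "vol a (upd b i c) = \<alpha> * \<theta>"
    unfolding \<theta>_def vol_upd vol_split[where a = a and b = b and i = i] \<alpha>_def using ab[of i] by simp
  have \<theta>0: "\<theta> > 0" unfolding \<theta>_def using ab by (intro prod_pos) simp
  have \<alpha>\<theta>: "\<alpha> * \<theta> \<ge> 1" using vol1 v1 by simp
  have \<theta>1: "\<theta> \<ge> 1" using \<alpha>\<theta> \<alpha> \<theta>0 mult_left_le_one_le[of \<theta> \<alpha>] by linarith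
  let ?R = "cbox a b" and ?R1 = "cbox a (upd b i c)" and ?R2 = "cbox (upd a i c) b" and ?H = "cbox (upd a i c) (upd b i c)"
  have bnd: "?R \<in> sets borel" "bounded ?R" "?R1 \<in> sets borel" "bounded ?R1" "?R2 \<in> sets borel" "bounded ?R2" "?H \<in> sets borel" "bounded ?H"
    by auto
  have mR: "measure lborel ?R = \<theta>" "measure lborel ?R1 = \<alpha> * \<theta>"
  proof -
    have ab1: "a $ k < upd b i c $ k" for k using ab c by auto
    show "measure lborel ?R = \<theta>"
      using ab \<theta>0 by (simp add: measure_def emeasure_cbox_cart less_imp_le \<theta>_def)
    have "emeasure lborel ?R1 = ennreal (vol a (upd b i c))"
      using ab1 by (intro emeasure_cbox_cart less_imp_le)
    then show "measure lborel ?R1 = \<alpha> * \<theta>"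
      unfolding v1 using \<alpha>\<theta> by (simp add: measure_def)
  qed
  let ?f1 = "\<lambda>\<omega>. ennreal (\<bar>real (size (config \<omega> ?R1)) - \<alpha> * \<theta>\<bar> powr p)" and ?f = "\<lambda>\<omega>. ennreal (\<bar>real (size (config \<omega> ?R)) - \<theta>\<bar> powr p)"
  define k where "k = K2 p e * (S powr p * (\<theta> / 2) powr (1 - p))"
  have k0: "k \<ge> 0" using K2_pos[OF e, of p] by (simp add: k_def)
  have AE: "AE \<omega> in M. box_cost p (N \<omega>) ?R \<le> ennreal (K1 p e) * (box_cost p (N \<omega>) ?R1 + box_cost p (N \<omega>) ?R2)
     + (ennreal (k * 2 powr p) * ?f1 \<omega> + ennreal (k * (2 powr p + 1)) * ?f \<omega>)"
    using AE_null_set_N[OF bnd(7,8) emeasure_hyperplane_slab] AE_space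
  proof eventually_elim
    case (elim \<omega>)
    note \<omega> = elim(2)
    define n1 n2 where "n1 = real (size (config \<omega> ?R1))" and "n2 = real (size (config \<omega> ?R2))"
    have n1: "emeasure (N \<omega>) ?R1 = ennreal n1" "n1 \<ge> 0" and n2: "emeasure (N \<omega>) ?R2 = ennreal n2" "n2 \<ge> 0"
      using emeasure_N_eq_size[OF \<omega> bnd(3,4)] emeasure_N_eq_size[OF \<omega> bnd(5,6)]
      by (simp_all add: n1_def n2_def ennreal_of_nat_eq_real_of_nat)
    have nR: "n1 + n2 = real (size (config \<omega> ?R))"
    proof -
      have "emeasure (N \<omega>) ?R = emeasure (N \<omega>) ?R1 + emeasure (N \<omega>) ?R2"
        using emeasure_cut[of a i c b "N \<omega>" UNIV] c sets_N[OF \<omega>] elim(1) by simp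
      then have "ennreal (real (size (config \<omega> ?R))) = ennreal (n1 + n2)"
        using emeasure_N_eq_size[OF \<omega> bnd(1,2)] n1 n2 by (simp add: ennreal_of_nat_eq_real_of_nat)
      then show ?thesis using n1 n2 by (subst (asm) ennreal_inj) auto
    qed
    have "box_cost p (N \<omega>) ?R \<le> ennreal (K1 p e) * (box_cost p (N \<omega>) ?R1 + box_cost p (N \<omega>) ?R2)
     + ennreal (K2 p e * ((S * \<bar>n1 / (n1 + n2) - \<alpha>\<bar>) powr p * (n1 + n2)))"
      unfolding S_def \<alpha>_def using box_cost_split[OF ab c sets_N[OF \<omega>] elim(1) n1 n2 p e] .
    also have "ennreal (K2 p e * ((S * \<bar>n1 / (n1 + n2) - \<alpha>\<bar>) powr p * (n1 + n2))) \<le>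
      ennreal (k * 2 powr p) * ?f1 \<omega> + ennreal (k * (2 powr p + 1)) * ?f \<omega>"
    proof -
      have "K2 p e * ((S * \<bar>n1 / (n1 + n2) - \<alpha>\<bar>) powr p * (n1 + n2)) =
          K2 p e * (S powr p * (\<bar>n1 / (n1 + n2) - \<alpha>\<bar> powr p * (n1 + n2)))"
        using S by (simp add: powr_mult)
      also have "\<dots> \<le> K2 p e * (S powr p * ((\<theta> / 2) powr (1 - p) * (2 powr p * \<bar>n1 - \<alpha> * \<theta>\<bar> powr p + (2 powr p + 1) * \<bar>n1 + n2 - \<theta>\<bar> powr p)))"
        using \<alpha> \<theta>0 n1 n2 p K2_pos[OF e, of p] by (intro mult_left_mono split_error_le) auto
      also have "\<dots> = k * 2 powr p * \<bar>n1 - \<alpha> * \<theta>\<bar> powr p + k * (2 powr p + 1) * \<bar>n1 + n2 - \<theta>\<bar> powr p"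
        by (simp add: k_def algebra_simps)
      finally have "ennreal (K2 p e * ((S * \<bar>n1 / (n1 + n2) - \<alpha>\<bar>) powr p * (n1 + n2))) \<le>
         ennreal (k * 2 powr p * \<bar>n1 - \<alpha> * \<theta>\<bar> powr p + k * (2 powr p + 1) * \<bar>n1 + n2 - \<theta>\<bar> powr p)"
        by (rule ennreal_leI)
      also have "\<dots> = ennreal (k * 2 powr p) * ?f1 \<omega> + ennreal (k * (2 powr p + 1)) * ?f \<omega>"
        using k0 unfolding nR by (simp add: n1_def ennreal_mult)
      finally show ?thesis .
    qed
    finally show ?case by simp
  qed
  have p0: "p > 0" "p \<ge> 0" using p by auto
  note [measurable] = measurable_box_cost[OF bnd(3,4) p0(1)] measurable_box_cost[OF bnd(5,6) p0(1)]
  have f1m [measurable]: "?f1 \<in> borel_measurable M" and fm [measurable]: "?f \<in> borel_measurable M"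
    using measurable_size_config[OF bnd(3,4), of "\<lambda>k. ennreal (\<bar>real k - \<alpha> * \<theta>\<bar> powr p)"]
      measurable_size_config[OF bnd(1,2), of "\<lambda>k. ennreal (\<bar>real k - \<theta>\<bar> powr p)"] by simp_all
  define F1 where "F1 = ?f1"
  define F where "F = ?f"
  have [measurable]: "F1 \<in> borel_measurable M" "F \<in> borel_measurable M" using f1m fm by (simp_all only: F1_def F_def)
  define C0 :: real where "C0 = 2 * exp 1 * fact (nat \<lceil>p\<rceil>)"
  have C0: "C0 \<ge> 0" by (simp add: C0_def)
  have I1: "(\<integral>\<^sup>+\<omega>. F1 \<omega> \<partial>M) \<le> ennreal (C0 * \<theta> powr (p / 2))"
  proof -
    have "(\<integral>\<^sup>+\<omega>. F1 \<omega> \<partial>M) \<le> ennreal (C0 * (\<alpha> * \<theta>) powr (p / 2))"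
      unfolding F1_def C0_def by (rule central_moment_config[OF bnd(3,4) mR(2) \<alpha>\<theta> p0(2)])
    also have "\<dots> \<le> ennreal (C0 * \<theta> powr (p / 2))"
      using C0 p0 \<alpha> \<theta>0 by (intro ennreal_leI mult_left_mono powr_mono2) (auto simp: mult_left_le_one_le)
    finally show ?thesis .
  qed
  have I2: "(\<integral>\<^sup>+\<omega>. F \<omega> \<partial>M) \<le> ennreal (C0 * \<theta> powr (p / 2))"
    unfolding F_def C0_def by (rule central_moment_config[OF bnd(1,2) mR(1) \<theta>1 p0(2)])
  have "mean_cost p a b \<le> (\<integral>\<^sup>+\<omega>. ennreal (K1 p e) * (box_cost p (N \<omega>) ?R1 + box_cost p (N \<omega>) ?R2)
     + (ennreal (k * 2 powr p) * F1 \<omega> + ennreal (k * (2 powr p + 1)) * F \<omega>) \<partial>M)"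
    unfolding mean_cost_def F1_def F_def by (rule nn_integral_mono_AE[OF AE])
  also have "\<dots> = ennreal (K1 p e) * (mean_cost p a (upd b i c) + mean_cost p (upd a i c) b)
     + (ennreal (k * 2 powr p) * (\<integral>\<^sup>+\<omega>. F1 \<omega> \<partial>M) + ennreal (k * (2 powr p + 1)) * (\<integral>\<^sup>+\<omega>. F \<omega> \<partial>M))"
    unfolding mean_cost_def by (simp add: nn_integral_add nn_integral_cmult)
  also have "\<dots> \<le> ennreal (K1 p e) * (mean_cost p a (upd b i c) + mean_cost p (upd a i c) b)
     + (ennreal (k * 2 powr p) * ennreal (C0 * \<theta> powr (p / 2)) + ennreal (k * (2 powr p + 1)) * ennreal (C0 * \<theta> powr (p / 2)))"
    by (intro add_left_mono add_mono mult_left_mono I1 I2) auto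
  also have "ennreal (k * 2 powr p) * ennreal (C0 * \<theta> powr (p / 2)) + ennreal (k * (2 powr p + 1)) * ennreal (C0 * \<theta> powr (p / 2)) =
      ennreal (k * ((2 * 2 powr p + 1) * (C0 * \<theta> powr (p / 2))))"
    using k0 C0 by (simp add: ennreal_mult[symmetric] ennreal_plus[symmetric] algebra_simps del: ennreal_plus)
  also have "k * ((2 * 2 powr p + 1) * (C0 * \<theta> powr (p / 2))) = K2 p e * (S powr p * (cut_const p * \<theta> powr (1 - p / 2)))"
  proof -
    have "(\<theta> / 2) powr (1 - p) = 2 powr (p - 1) * \<theta> powr (1 - p)"
      using \<theta>0 by (simp add: powr_divide powr_diff field_simps)
    moreover have "\<theta> powr (1 - p) * \<theta> powr (p / 2) = \<theta> powr (1 - p / 2)"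
      using \<theta>0 by (simp add: powr_add[symmetric] field_simps)
    ultimately show ?thesis
      by (simp add: k_def cut_const_def C0_def mult_ac) (metis mult.left_commute mult.commute)?
  qed
  finally show ?thesis by (simp add: S_def \<theta>_def)
qed

end

section \<open>Boxes made of cubic cells and their recursive halving\<close>

lemma powr_lt_1: "0 < x \<Longrightarrow> x < 1 \<Longrightarrow> 0 < a \<Longrightarrow> x powr a < (1 :: real)"
  using powr_less_mono2[of a x 1] by simp

text \<open>Halving the longest side preserves this condition on the side lengths and reduces the volume by
  a factor of at most \<open>2 / 3\<close>; the diameter stays comparable to the \<open>d\<close>-th root of the volume.\<close>

definition fat :: "('d :: finite \<Rightarrow> nat) \<Rightarrow> bool"
  where "fat m \<longleftrightarrow> (\<forall>j k. 1 \<le> m k \<and> m k \<le> 3 * m j)"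

definition box_diag :: "real \<Rightarrow> ('d \<Rightarrow> nat) \<Rightarrow> real ^ 'd"
  where "box_diag L m = (\<chi> k. L * real (m k))"

lemma box_diag_nth [simp]: "box_diag L m $ k = L * real (m k)"
  by (simp add: box_diag_def)

abbreviation cells :: "('d :: finite \<Rightarrow> nat) \<Rightarrow> real"
  where "cells m \<equiv> (\<Prod>k\<in>UNIV. real (m k))"

lemma cells_upd: "cells (m(i := h)) = real h * (\<Prod>k\<in>UNIV - {i}. real (m k))"
  by (subst prod.remove[of UNIV i]) auto

lemma cells_split: "cells m = real (m i) * (\<Prod>k\<in>UNIV - {i}. real (m k))"
  by (subst prod.remove[of UNIV i]) auto

lemma fat_le_cells: assumes "fat m" shows "real (m i) \<le> cells m"
proof -
  have "(\<Prod>k\<in>UNIV - {i}. real (m k)) \<ge> 1"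
    using assms by (intro prod_ge_1) (auto simp: fat_def)
  then have "real (m i) * 1 \<le> real (m i) * (\<Prod>k\<in>UNIV - {i}. real (m k))"
    by (intro mult_left_mono) auto
  then show ?thesis by (simp add: cells_split[of m i])
qed

lemma fat_cells_ge_1: "fat m \<Longrightarrow> cells m \<ge> 1"
  by (intro prod_ge_1) (auto simp: fat_def)

text \<open>The extreme case is a side of three cells, cut into one and two: this is the origin of
  the ratio 3 in \<open>fat\<close>.\<close>

lemma fat_halves:
  assumes m: "fat m" and i: "\<And>k. m k \<le> m i" and 2: "m i \<ge> 2"
  shows "fat (m(i := m i div 2))" "fat (m(i := m i - m i div 2))"
proof -
  have h: "1 \<le> m i div 2" "m i \<le> 3 * (m i div 2)" "1 \<le> m i - m i div 2" "m i \<le> 3 * (m i - m i div 2)"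
    using 2 by linarith+
  have mk: "1 \<le> m k" "m k \<le> m i" "m i \<le> 3 * m k" for k
    using m i by (auto simp: fat_def)
  show "fat (m(i := m i div 2))"
    unfolding fat_def
  proof (intro allI conjI)
    fix j k
    show "1 \<le> (m(i := m i div 2)) k" using h(1) mk(1)[of k] by simp
    have "(m(i := m i div 2)) k \<le> m i" using mk(2)[of k] by simp
    moreover have "m i \<le> 3 * (m(i := m i div 2)) j" using h(2) mk(3)[of j] by simp
    ultimately show "(m(i := m i div 2)) k \<le> 3 * (m(i := m i div 2)) j" by (rule order_trans)
  qed
  show "fat (m(i := m i - m i div 2))"
    unfolding fat_def
  proof (intro allI conjI)
    fix j k
    show "1 \<le> (m(i := m i - m i div 2)) k" using h(3) mk(1)[of k] by simp
    have "(m(i := m i - m i div 2)) k \<le> m i" using mk(2)[of k] by simp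
    moreover have "m i \<le> 3 * (m(i := m i - m i div 2)) j" using h(4) mk(3)[of j] by simp
    ultimately show "(m(i := m i - m i div 2)) k \<le> 3 * (m(i := m i - m i div 2)) j" by (rule order_trans)
  qed
qed

lemma prod_ge_1_mono:
  fixes \<rho> \<delta> p :: real
  assumes "\<rho> > 0" "\<delta> > 0" "p \<ge> 0"
  shows "1 \<le> (\<Prod>j<K. (1 + \<delta> * \<rho> ^ j) powr p)"
  using assms by (intro prod_ge_1) (auto intro!: ge_one_powr_ge_zero)

context poisson_process
begin

text \<open>A box with about \<open>(3 / 2) ^ K\<close> cells is cut with \<open>e = \<delta> * \<rho> ^ K\<close>: the product of the factors
  \<open>K1 p e\<close> stays bounded, and \<open>K2 p e\<close> grows slowly enough for the errors, which decay like
  \<open>x ^ K\<close> because \<open>d > 2\<close>, to remain summable.\<close>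

lemma mean_cost_boxes:
  fixes L p \<delta> u :: real
  assumes d: "CARD('d) \<ge> 3" and p: "p \<ge> 1" and L: "L \<ge> 1" and \<delta>: "\<delta> > 0" and u: "u \<ge> 0"
    and base: "\<And>a. mean_cost p a (a + vec L) \<le> ennreal u"
  defines "\<gamma> \<equiv> p / 2 - p / real CARD('d)"
  defines "x \<equiv> (3 / 2) powr (- \<gamma>)"
  defines "\<rho> \<equiv> x powr (1 / (2 * p))" and "q \<equiv> x powr (1 / 2)"
  defines "D \<equiv> (1 + 1 / \<delta>) powr p * (3 powr p * cut_const p * L powr (p + real CARD('d) - real CARD('d) * p / 2))"
  assumes m: "fat m" and V: "cells m \<le> (3 / 2) ^ K"
  shows "mean_cost p a (a + box_diag L m) \<le> ennreal ((\<Prod>j<K. (1 + \<delta> * \<rho> ^ j) powr p) * (cells m * (u + D * (\<Sum>j<K. q ^ j))))"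
  using m V
proof (induction K arbitrary: a m)
  \<comment> \<open>A fat box with at most one cell is the single cube, to which \<open>base\<close>
    applies.\<close>
  case 0
  have "m k = 1" for k
  proof -
    have "real (m k) \<le> 1" using fat_le_cells[OF 0(1), of k] 0(2) by simp
    moreover have "m k \<ge> 1" using 0(1) by (auto simp: fat_def)
    ultimately show ?thesis by simp
  qed
  then have "a + box_diag L m = a + vec L" "cells m = 1" by (auto simp: vec_eq_iff)
  then show ?case using base[of a] by simp
next
  case (Suc K)
  have dpos: "real CARD('d) \<ge> 3" using d by simp
  have g: "\<gamma> > 0" using p dpos by (simp add: \<gamma>_def field_simps)
  have x: "0 < x" "x < 1" using g by (auto simp: x_def powr_less_one)
  have \<rho>: "0 < \<rho>" "\<rho> \<le> 1" using x p by (auto simp: \<rho>_def powr_le1)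
  have q: "0 < q" using x by (simp add: q_def)
  have C0: "cut_const p \<ge> 0" by (simp add: cut_const_def)
  have D: "D \<ge> 0" using C0 by (simp add: D_def)
  define PK where "PK = (\<Prod>j<K. (1 + \<delta> * \<rho> ^ j) powr p)"
  define SK where "SK = (\<Sum>j<K. q ^ j)"
  define e where "e = \<delta> * \<rho> ^ K"
  have e: "e > 0" using \<delta> \<rho> by (simp add: e_def)
  have PK: "PK \<ge> 1" unfolding PK_def using \<rho> \<delta> p by (intro prod_ge_1_mono) auto
  have SK: "SK \<ge> 0" unfolding SK_def using q by (intro sum_nonneg) auto
  have K1e: "K1 p e = (1 + \<delta> * \<rho> ^ K) powr p" by (simp add: K1_def e_def)
  have K1ge: "K1 p e \<ge> 1" unfolding K1_def using e p by (intro ge_one_powr_ge_zero) auto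
  define V where "V = cells m"
  have V1: "V \<ge> 1" unfolding V_def by (rule fat_cells_ge_1[OF Suc.prems(1)])
  have goal_eq: "(\<Prod>j<Suc K. (1 + \<delta> * \<rho> ^ j) powr p) * (cells m * (u + D * (\<Sum>j<Suc K. q ^ j))) =
      PK * K1 p e * (V * (u + D * (SK + q ^ K)))"
    by (simp add: PK_def SK_def V_def K1e)
  show ?case
  proof (cases "V \<le> (3 / 2) ^ K")
    \<comment> \<open>The box already fits the previous level, so it is not cut; the bound only
      grows with \<open>K\<close>.\<close>
    case True
    have "mean_cost p a (a + box_diag L m) \<le> ennreal (PK * (V * (u + D * SK)))"
      unfolding PK_def V_def SK_def using True by (intro Suc.IH Suc.prems(1)) (simp add: V_def)
    also have "\<dots> \<le> ennreal (PK * K1 p e * (V * (u + D * (SK + q ^ K))))"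
    proof (intro ennreal_leI mult_mono add_left_mono mult_left_mono)
      show "PK \<le> PK * K1 p e" using PK K1ge by (simp add: mult_le_cancel_left1)
    qed (use PK K1ge V1 u D SK q in \<open>auto intro!: add_nonneg_nonneg mult_nonneg_nonneg\<close>)
    finally show ?thesis unfolding goal_eq .
  next
    case False
    then have VK: "V > (3 / 2) ^ K" by simp
    obtain i where i: "m k \<le> m i" for k
    proof -
      have "Max (range m) \<in> range m" by (intro Max_in) auto
      then obtain i where i: "Max (range m) = m i" by blast
      have "m k \<le> m i" for k unfolding i[symmetric] by (intro Max_ge) auto
      then show ?thesis by (rule that)
    qed
    have one: "(1 :: real) \<le> (3 / 2) ^ K" by (intro one_le_power) simp
    \<comment> \<open>If the longest side had one cell, the whole box would have at most one,
      contrary to \<open>VK\<close>.\<close>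
    have M2: "m i \<ge> 2"
    proof (rule ccontr)
      assume "\<not> m i \<ge> 2"
      then have "m k \<le> 1" for k using i[of k] by linarith
      then have "V \<le> 1" unfolding V_def by (intro prod_le_1) auto
      then show False using VK one by linarith
    qed
    define h where "h = m i div 2"
    define W where "W = (\<Prod>k\<in>UNIV - {i}. real (m k))"
    define m1 where "m1 = m(i := h)"
    define m2 where "m2 = m(i := m i - h)"
    have hb: "h \<ge> 1" "h < m i" "3 * h \<le> 2 * m i" "m i \<le> 3 * h"
      using M2 unfolding h_def by linarith+
    have fm: "fat m1" "fat m2" unfolding m1_def m2_def h_def using fat_halves[OF Suc.prems(1) i M2] by auto
    have W: "W \<ge> 1" unfolding W_def using Suc.prems(1) by (intro prod_ge_1) (auto simp: fat_def)
    have c1: "cells m1 = real h * W" unfolding m1_def cells_upd W_def ..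
    have "cells m2 = real (m i - h) * W" unfolding m2_def cells_upd W_def ..
    then have c2: "cells m2 = (real (m i) - real h) * W" using hb(2) by (simp add: of_nat_diff)
    have c0: "V = real (m i) * W" unfolding V_def W_def by (rule cells_split)
    have sum12: "cells m1 + cells m2 = V" by (simp add: c1 c2 c0 algebra_simps)
    have small: "cells m1 \<le> (3 / 2) ^ K" "cells m2 \<le> (3 / 2) ^ K"
    proof -
      have r3: "real (m i) \<le> 3 * real h" using hb(4) by linarith
      have aux: "x \<le> 3 * y \<Longrightarrow> 3 * (x - y) \<le> 2 * x" for x y :: real by simp
      have "3 * real h \<le> 2 * real (m i)" using hb(3) by linarith
      moreover note aux[OF r3]
      ultimately have "(3 * real h) * W \<le> (2 * real (m i)) * W" "(3 * (real (m i) - real h)) * W \<le> (2 * real (m i)) * W"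
        by (insert W, (intro mult_right_mono; simp)+)
      then have "3 * cells m1 \<le> 2 * V" "3 * cells m2 \<le> 2 * V"
        by (simp_all add: c1 c2 c0 algebra_simps)
      moreover have "V \<le> 3 / 2 * (3 / 2) ^ K" using Suc.prems(2) by (simp add: V_def)
      ultimately show "cells m1 \<le> (3 / 2) ^ K" "cells m2 \<le> (3 / 2) ^ K" by - linarith+
    qed
    define b where "b = a + box_diag L m"
    define c where "c = a $ i + L * real h"
    have unif: "upd b i c = a + box_diag L m1" by (auto simp: vec_eq_iff b_def c_def m1_def)
    have b2: "b = upd a i c + box_diag L m2"
      using hb(2) by (auto simp: vec_eq_iff b_def c_def m2_def of_nat_diff algebra_simps)
    have mpos: "m k \<ge> 1" for k using Suc.prems(1) by (auto simp: fat_def)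
    have ab: "a $ k < b $ k" for k using mpos[of k] L by (simp add: b_def)
    have cc: "a $ i < c" "c < b $ i" using hb L by (simp_all add: c_def b_def)
    have volm: "vol a (a + box_diag L n) = L ^ CARD('d) * cells n" for n
      by (simp add: prod.distrib)
    have Ld: "L ^ CARD('d) \<ge> 1" using L by simp
    have v1: "vol a (upd b i c) \<ge> 1"
      unfolding unif volm using mult_mono[OF Ld fat_cells_ge_1[OF fm(1)]] Ld by simp
    have err: "K2 p e * ((b $ i - a $ i) powr p * (cut_const p * vol a b powr (1 - p / 2))) \<le> V * (D * q ^ K)"
    proof -
      define M where "M = real (m i)"
      have M: "M > 0" using M2 by (simp add: M_def)
      \<comment> \<open>By fatness all sides have at least \<open>M / 3\<close> cells, so the
        longest side is at most three times the \<open>d\<close>-th root of the number of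
        cells.\<close>
      have Md: "(M / 3) ^ CARD('d) \<le> V"
      proof -
        have "(\<Prod>k\<in>(UNIV :: 'd set). M / 3) \<le> (\<Prod>k\<in>UNIV. real (m k))"
        proof (intro prod_mono conjI)
          fix k
          have "m i \<le> 3 * m k" using Suc.prems(1) by (auto simp: fat_def)
          then have "real (m i) \<le> 3 * real (m k)" by linarith
          then show "M / 3 \<le> real (m k)" by (simp add: M_def)
        qed (use M in simp)
        then show ?thesis by (simp add: V_def)
      qed
      have M3: "M \<le> 3 * V powr (1 / real CARD('d))"
      proof -
        have "M / 3 = ((M / 3) powr real CARD('d)) powr (1 / real CARD('d))"
          using M by (simp add: powr_powr)
        also have "\<dots> = ((M / 3) ^ CARD('d)) powr (1 / real CARD('d))"
          using M by (simp add: powr_realpow)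
        also have "\<dots> \<le> V powr (1 / real CARD('d))"
          using Md M by (intro powr_mono2) auto
        finally show ?thesis by simp
      qed
      have t1: "(b $ i - a $ i) powr p \<le> L powr p * (3 powr p * V powr (p / real CARD('d)))"
      proof -
        have "(b $ i - a $ i) powr p = (L * M) powr p" by (simp add: b_def M_def)
        also have "\<dots> \<le> (L * (3 * V powr (1 / real CARD('d)))) powr p"
          using M3 L M p by (intro powr_mono2 mult_left_mono) auto
        also have "\<dots> = L powr p * (3 powr p * V powr (p / real CARD('d)))"
          using L V1 by (simp add: powr_mult powr_powr)
        finally show ?thesis .
      qed
      have t2: "vol a b powr (1 - p / 2) = L powr (real CARD('d) * (1 - p / 2)) * V powr (1 - p / 2)"
      proof -
        have "L ^ CARD('d) = L powr real CARD('d)" using L by (simp add: powr_realpow)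
        then show ?thesis
          unfolding b_def volm V_def[symmetric] using L V1 by (simp add: powr_mult powr_powr)
      qed
      have t3: "V powr (- \<gamma>) \<le> x ^ K"
      proof -
        have "V powr (- \<gamma>) \<le> ((3 / 2) ^ K) powr (- \<gamma>)"
          using VK g by (intro powr_mono2') auto
        also have "\<dots> = x ^ K"
          by (simp add: x_def powr_realpow[symmetric] powr_powr mult.commute)
        finally show ?thesis .
      qed
      \<comment> \<open>The exponent in \<open>\<rho> = x powr (1 / (2 * p))\<close> is made for
        this: the growth of \<open>K2 p e\<close> consumes half of the decay \<open>x ^ K\<close>,
        and \<open>q ^ K\<close> with \<open>q = sqrt x\<close> remains.\<close>
      have t4: "K2 p e \<le> (1 + 1 / \<delta>) powr p * x powr (- (real K / 2))"
      proof -
        have "1 + 1 / e \<le> (1 + 1 / \<delta>) * (1 / \<rho> ^ K)"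
        proof -
          have "\<rho> ^ K \<le> 1" using \<rho> by (simp add: power_le_one)
          then have "1 \<le> 1 / \<rho> ^ K" using \<rho> by simp
          moreover have "1 / e = 1 / \<delta> * (1 / \<rho> ^ K)" by (simp add: e_def)
          moreover have "(1 + 1 / \<delta>) * (1 / \<rho> ^ K) = 1 / \<rho> ^ K + 1 / \<delta> * (1 / \<rho> ^ K)" by (simp only: distrib_right mult_1)
          ultimately show ?thesis by linarith
        qed
        then have "K2 p e \<le> ((1 + 1 / \<delta>) * (1 / \<rho> ^ K)) powr p"
          unfolding K2_def using e p by (intro powr_mono2) (auto intro: add_nonneg_nonneg)
        also have "\<dots> = (1 + 1 / \<delta>) powr p * (1 / \<rho> ^ K) powr p"
          using \<delta> \<rho> by (intro powr_mult)
        also have "(1 / \<rho> ^ K) powr p = x powr (- (real K / 2))"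
        proof -
          have "\<rho> ^ K = x powr (real K / (2 * p))"
            using x p by (simp add: \<rho>_def powr_realpow[symmetric] powr_powr)
          then have "1 / \<rho> ^ K = x powr (- (real K / (2 * p)))" by (simp add: powr_minus_divide)
          then show ?thesis using p by (simp add: powr_powr)
        qed
        finally show ?thesis .
      qed
      have xq: "x powr (- (real K / 2)) * x ^ K = q ^ K"
        using x by (simp add: q_def powr_realpow[symmetric] powr_powr powr_add[symmetric])
      \<comment> \<open>Side length to the power \<open>p\<close> times volume to the power
        \<open>1 - p / 2\<close>, counted in cells, is the number of cells times
        \<open>V powr (- \<gamma>)\<close>; the error per cell decays with the size of the box since
        \<open>\<gamma> > 0\<close>.\<close>
      have Vp: "V powr (p / real CARD('d)) * V powr (1 - p / 2) = V * V powr (- \<gamma>)"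
      proof -
        have "V powr (p / real CARD('d)) * V powr (1 - p / 2) = V powr (1 + - \<gamma>)"
        proof -
          have "p / real CARD('d) + (1 - p / 2) = 1 + - \<gamma>" by (simp add: \<gamma>_def)
          then show ?thesis by (simp only: powr_add[symmetric])
        qed
        also have "\<dots> = V * V powr (- \<gamma>)" using V1 by (subst powr_add) simp
        finally show ?thesis .
      qed
      have Lp: "L powr p * L powr (real CARD('d) * (1 - p / 2)) = L powr (p + real CARD('d) - real CARD('d) * p / 2)"
        by (simp add: powr_add[symmetric] algebra_simps)
      have "K2 p e * ((b $ i - a $ i) powr p * (cut_const p * vol a b powr (1 - p / 2))) \<le>
        ((1 + 1 / \<delta>) powr p * x powr (- (real K / 2))) * ((L powr p * (3 powr p * V powr (p / real CARD('d)))) *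
          (cut_const p * vol a b powr (1 - p / 2)))"
        using C0 K2_pos[OF e, of p] by (intro mult_mono t4 t1 order_refl mult_nonneg_nonneg) auto
      also have "\<dots> = (1 + 1 / \<delta>) powr p * x powr (- (real K / 2)) * (3 powr p * cut_const p *
         (L powr p * L powr (real CARD('d) * (1 - p / 2))) * (V powr (p / real CARD('d)) * V powr (1 - p / 2)))"
        unfolding t2 by (simp only: mult_ac)
      also have "\<dots> = (D * V * x powr (- (real K / 2))) * V powr (- \<gamma>)"
        unfolding Vp Lp D_def by (simp only: mult_ac)
      also have "\<dots> \<le> (D * V * x powr (- (real K / 2))) * x ^ K"
        using D V1 by (intro mult_left_mono t3) auto
      also have "\<dots> = V * (D * (x powr (- (real K / 2)) * x ^ K))"
        by (simp only: mult_ac)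
      finally show ?thesis unfolding xq .
    qed
    have "mean_cost p a b \<le> ennreal (K1 p e) * (mean_cost p a (upd b i c) + mean_cost p (upd a i c) b)
     + ennreal (K2 p e * ((b $ i - a $ i) powr p * (cut_const p * vol a b powr (1 - p / 2))))"
      by (rule mean_cost_split[OF ab cc p e v1])
    also have "\<dots> \<le> ennreal (K1 p e) * (ennreal (PK * (cells m1 * (u + D * SK))) + ennreal (PK * (cells m2 * (u + D * SK))))
       + ennreal (V * (D * q ^ K))"
    proof (intro add_mono mult_left_mono ennreal_leI err)
      show "mean_cost p a (upd b i c) \<le> ennreal (PK * (cells m1 * (u + D * SK)))"
        unfolding unif PK_def SK_def by (intro Suc.IH fm small)
      show "mean_cost p (upd a i c) b \<le> ennreal (PK * (cells m2 * (u + D * SK)))"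
        unfolding b2 PK_def SK_def by (intro Suc.IH fm small)
    qed simp
    also have "\<dots> = ennreal (K1 p e * (PK * (V * (u + D * SK))) + V * (D * q ^ K))"
    proof -
      have n: "0 \<le> PK * (cells m1 * (u + D * SK))" "0 \<le> PK * (cells m2 * (u + D * SK))" "0 \<le> V * (D * q ^ K)"
        using PK u D SK V1 q by (auto intro!: mult_nonneg_nonneg add_nonneg_nonneg prod_nonneg)
      have "PK * (cells m1 * (u + D * SK)) + PK * (cells m2 * (u + D * SK)) = PK * (V * (u + D * SK))"
        by (simp only: sum12[symmetric] distrib_left distrib_right)
      then show ?thesis
        using n K1ge by (simp add: ennreal_plus[symmetric] ennreal_mult[symmetric] del: ennreal_plus)
    qed
    also have "\<dots> \<le> ennreal (PK * K1 p e * (V * (u + D * (SK + q ^ K))))"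
    proof (rule ennreal_leI)
      \<comment> \<open>All comparison factors are at least 1, so the new error may be multiplied by
        their product and absorbed into the sum of the errors.\<close>
      have "1 * (V * (D * q ^ K)) \<le> (PK * K1 p e) * (V * (D * q ^ K))"
        using mult_mono[OF PK K1ge] PK V1 D q by (intro mult_right_mono mult_nonneg_nonneg) auto
      then show "K1 p e * (PK * (V * (u + D * SK))) + V * (D * q ^ K) \<le> PK * K1 p e * (V * (u + D * (SK + q ^ K)))"
        by (simp add: algebra_simps)
    qed
    finally show ?thesis unfolding goal_eq b_def .
  qed
qed

text \<open>The order of the quantifiers is the point: \<open>C\<close> is fixed before
  \<open>L\<close>, \<open>u\<close> and \<open>m\<close>, because the bounds of
  \<open>mean_cost_boxes\<close> are uniform in the number of generations.\<close>

lemma mean_cost_multiple_le: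
  assumes d: "CARD('d) \<ge> 3" and p: "p \<ge> 1" and \<epsilon>: "\<epsilon> > 0"
  shows "\<exists>C\<ge>0. \<forall>L\<ge>1. \<forall>u\<ge>0. \<forall>m\<ge>1. (\<forall>a. mean_cost p a (a + vec L) \<le> ennreal u) \<longrightarrow>
    mean_cost p 0 (vec (real m * L)) \<le>
      ennreal (real m ^ CARD('d) * ((1 + \<epsilon>) * u + C * L powr (p + real CARD('d) - real CARD('d) * p / 2)))"
proof -
  define \<gamma> where "\<gamma> = p / 2 - p / real CARD('d)"
  define x where "x = (3 / 2) powr (- \<gamma>)"
  define \<rho> where "\<rho> = x powr (1 / (2 * p))"
  define q where "q = x powr (1 / 2)"
  have dpos: "real CARD('d) \<ge> 3" using d by simp
  have g: "\<gamma> > 0" using p dpos by (simp add: \<gamma>_def field_simps)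
  have x: "0 < x" "x < 1" using g by (auto simp: x_def powr_less_one)
  have \<rho>: "0 < \<rho>" "\<rho> < 1" using x p by (auto simp: \<rho>_def powr_lt_1)
  have q: "0 < q" "q < 1" using x by (auto simp: q_def powr_lt_1)
  \<comment> \<open>Chosen so that \<open>p * \<delta> / (1 - \<rho>) = ln (1 + \<epsilon>)\<close>;
    by \<open>1 + t \<le> exp t\<close> and the geometric series, the product of all comparison
    factors is then at most \<open>1 + \<epsilon>\<close>.\<close>
  define \<delta> where "\<delta> = ln (1 + \<epsilon>) * (1 - \<rho>) / p"
  have \<delta>: "\<delta> > 0" using \<epsilon> \<rho> p by (simp add: \<delta>_def)
  define C1 where "C1 = (1 + 1 / \<delta>) powr p * (3 powr p * cut_const p)"
  have C1: "C1 \<ge> 0" by (simp add: C1_def cut_const_def)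
  have geom: "(\<Sum>j<K. r ^ j) \<le> 1 / (1 - r)" if "0 < r" "r < 1" for r :: real and K
  proof -
    have "(\<Sum>j<K. r ^ j) \<le> (\<Sum>j. r ^ j)"
      using that by (intro sum_le_suminf summable_geometric) auto
    then show ?thesis using that by (simp add: suminf_geometric)
  qed
  have PK: "(\<Prod>j<K. (1 + \<delta> * \<rho> ^ j) powr p) \<le> 1 + \<epsilon>" for K
  proof -
    have "(\<Prod>j<K. (1 + \<delta> * \<rho> ^ j) powr p) \<le> (\<Prod>j<K. exp (p * (\<delta> * \<rho> ^ j)))"
    proof (intro prod_mono conjI)
      fix j
      have pos: "\<delta> * \<rho> ^ j \<ge> 0" using \<delta> \<rho> by simp
      then have "(1 + \<delta> * \<rho> ^ j) powr p \<le> exp (\<delta> * \<rho> ^ j) powr p"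
        using p exp_ge_add_one_self[of "\<delta> * \<rho> ^ j"] by (intro powr_mono2) auto
      then show "(1 + \<delta> * \<rho> ^ j) powr p \<le> exp (p * (\<delta> * \<rho> ^ j))"
        by (simp add: powr_def)
    qed auto
    also have "\<dots> = exp (p * \<delta> * (\<Sum>j<K. \<rho> ^ j))"
      by (simp add: exp_sum[symmetric] sum_distrib_left mult.assoc)
    also have "\<dots> \<le> exp (p * \<delta> * (1 / (1 - \<rho>)))"
      using geom[OF \<rho>] p \<delta> by (intro iffD2[OF exp_le_cancel_iff] mult_left_mono) auto
    also have "p * \<delta> * (1 / (1 - \<rho>)) = ln (1 + \<epsilon>)"
      using p \<rho> by (simp add: \<delta>_def)
    finally show ?thesis using \<epsilon> by simp
  qed
  show ?thesis
  proof (intro exI[of _ "(1 + \<epsilon>) * (C1 / (1 - q))"] conjI allI impI)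
    show "0 \<le> (1 + \<epsilon>) * (C1 / (1 - q))" using C1 q \<epsilon> by simp
    fix L u :: real and m :: nat
    assume L: "L \<ge> 1" and u: "u \<ge> 0" and m: "m \<ge> 1" and base: "\<forall>a. mean_cost p a (a + vec L) \<le> ennreal u"
    define lam where "lam = L powr (p + real CARD('d) - real CARD('d) * p / 2)"
    have lam: "lam \<ge> 0" by (simp add: lam_def)
    have f: "fat (\<lambda>_::'d. m)" using m by (simp add: fat_def)
    \<comment> \<open>Any number of generations that exhausts the \<open>m ^ d\<close> cells will
      do.\<close>
    obtain K where K: "real m ^ CARD('d) < (3 / 2) ^ K" using real_arch_pow[of "3 / 2 :: real"] by auto
    have "mean_cost p 0 (0 + box_diag L (\<lambda>_. m)) \<le> ennreal ((\<Prod>j<K. (1 + \<delta> * \<rho> ^ j) powr p) *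
       (cells (\<lambda>_::'d. m) * (u + (1 + 1 / \<delta>) powr p * (3 powr p * cut_const p * lam) * (\<Sum>j<K. q ^ j))))"
      unfolding \<rho>_def q_def x_def \<gamma>_def lam_def
      using K by (intro mean_cost_boxes[OF d p L \<delta> u _ f]) (use base in auto)
    also have "\<dots> \<le> ennreal ((1 + \<epsilon>) * (real m ^ CARD('d) * (u + C1 * lam * (1 / (1 - q)))))"
    proof (rule ennreal_leI)
      define t where "t = (1 + 1 / \<delta>) powr p * (3 powr p * cut_const p * lam) * (\<Sum>j<K. q ^ j)"
      have t: "t = C1 * lam * (\<Sum>j<K. q ^ j)" by (simp add: C1_def t_def)
      have t0: "t \<ge> 0" unfolding t using C1 lam q by (intro mult_nonneg_nonneg sum_nonneg) auto
      have tX: "t \<le> C1 * lam * (1 / (1 - q))"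
        unfolding t using geom[OF q] C1 lam by (intro mult_left_mono) auto
      have H: "cells (\<lambda>_::'d. m) * (u + t) \<le> real m ^ CARD('d) * (u + C1 * lam * (1 / (1 - q)))"
        unfolding prod_constant using tX by (intro mult_left_mono add_left_mono) auto
      show "(\<Prod>j<K. (1 + \<delta> * \<rho> ^ j) powr p) *
         (cells (\<lambda>_::'d. m) * (u + (1 + 1 / \<delta>) powr p * (3 powr p * cut_const p * lam) * (\<Sum>j<K. q ^ j))) \<le>
         (1 + \<epsilon>) * (real m ^ CARD('d) * (u + C1 * lam * (1 / (1 - q))))"
        unfolding t_def[symmetric] by (rule mult_mono[OF PK H]) (use u t0 \<epsilon> in \<open>auto intro!: mult_nonneg_nonneg prod_nonneg\<close>)
    qed
    also have "(1 + \<epsilon>) * (real m ^ CARD('d) * (u + C1 * lam * (1 / (1 - q)))) =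
       real m ^ CARD('d) * ((1 + \<epsilon>) * u + (1 + \<epsilon>) * (C1 / (1 - q)) * lam)"
      by (simp add: algebra_simps)
    also have "0 + box_diag L (\<lambda>_. m) = vec (real m * L)" by (simp add: vec_eq_iff mult.commute)
    finally show "mean_cost p 0 (vec (real m * L)) \<le> ennreal (real m ^ CARD('d) * ((1 + \<epsilon>) * u + (1 + \<epsilon>) * (C1 / (1 - q)) * lam))" .
  qed
qed

end

section \<open>Limits\<close>

text \<open>Choose \<open>L0\<close> with \<open>h L0\<close> close to the lower limit. For large \<open>L\<close> and \<open>m = \<lfloor>L / L0\<rfloor>\<close>, the
  quotient \<open>L / m\<close> is close to \<open>L0\<close>, and continuity applies.\<close>

lemma tendsto_of_near_subadditive:
  fixes h :: "real \<Rightarrow> real"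
  assumes h0: "\<And>L. L > 0 \<Longrightarrow> h L \<ge> 0" and cont: "continuous_on {0<..} h" and \<beta>: "\<beta> > 0"
    and sub: "\<And>\<epsilon>. \<epsilon> > 0 \<Longrightarrow> \<exists>C\<ge>0. \<forall>L\<ge>1. \<forall>m\<ge>1::nat. h (real m * L) \<le> (1 + \<epsilon>) * h L + C * L powr (- \<beta>)"
  shows "\<exists>l. (h \<longlongrightarrow> l) at_top"
proof -
  \<comment> \<open>The integer part of \<open>L / L0\<close>: the remainder, spread over
    \<open>m\<close> pieces, lengthens each by at most \<open>L0 / m\<close>.\<close>
  have fl: "\<exists>m::nat. m \<ge> 1 \<and> L0 \<le> L / real m \<and> L / real m \<le> L0 + L0 / real m \<and> real m > L / L0 - 1" if "L0 > 0" "L \<ge> L0" for L L0 :: real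
  proof -
    define m where "m = nat \<lfloor>L / L0\<rfloor>"
    have q: "L / L0 \<ge> 1" using that by simp
    then have m: "real m \<le> L / L0" "L / L0 < real m + 1" "m \<ge> 1" unfolding m_def by linarith+
    have "real m * L0 \<le> L" "L < (real m + 1) * L0" using m that by (simp_all add: field_simps)
    then show ?thesis using m that by (intro exI[of _ m]) (auto simp: field_simps)
  qed
  obtain C1 where C1: "C1 \<ge> 0" "\<And>L m. L \<ge> 1 \<Longrightarrow> m \<ge> 1 \<Longrightarrow> h (real m * L) \<le> (1 + 1) * h L + C1 * L powr (- \<beta>)"
    using sub[of 1] by auto
  have "\<exists>B. \<forall>L\<in>{1..2}. h L \<le> B"
  proof -
    have "continuous_on {1..2} h" by (rule continuous_on_subset[OF cont]) auto
    then have "bounded (h ` {1..2})" by (intro compact_imp_bounded compact_continuous_image) auto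
    then obtain B where "\<forall>L\<in>{1..2}. norm (h L) \<le> B" by (auto simp: bounded_iff)
    then have "\<forall>L\<in>{1..2}. h L \<le> B" by (auto simp: abs_le_iff)
    then show ?thesis by blast
  qed
  then obtain B where "\<forall>L\<in>{1..2}. h L \<le> B" by blast
  then have B: "h L \<le> B" if "1 \<le> L" "L \<le> 2" for L using that by simp
  \<comment> \<open>Every \<open>L \<ge> 1\<close> is a multiple of a length between 1 and 2, where
    \<open>h\<close> is bounded by continuity.\<close>
  have bd: "h L \<le> 2 * B + C1" if L: "L \<ge> 1" for L
  proof -
    obtain m :: nat where m: "m \<ge> 1" "1 \<le> L / real m" "L / real m \<le> 1 + 1 / real m"
      using fl[OF zero_less_one L] by blast
    have "1 / real m \<le> 1" using m(1) by simp
    then have L2: "L / real m \<le> 2" using m(3) by linarith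
    have "h L = h (real m * (L / real m))" using m by simp
    also have "\<dots> \<le> (1 + 1) * h (L / real m) + C1 * (L / real m) powr (- \<beta>)"
      using m by (intro C1) auto
    also have "\<dots> \<le> 2 * B + C1 * 1"
    proof (intro add_mono mult_left_mono)
      show "(1 + 1) * h (L / real m) \<le> 2 * B" using B[OF m(2) L2] by simp
      show "(L / real m) powr (- \<beta>) \<le> 1"
        using m(1,2) L \<beta> powr_mono[of "- \<beta>" 0 "L / real m"] by simp
    qed (use C1 in auto)
    finally show ?thesis by simp
  qed
  \<comment> \<open>The eventual lower bounds of \<open>h\<close>; their supremum is the lower limit
    at infinity, finite by \<open>bd\<close>.\<close>
  define A where "A = {x. eventually (\<lambda>L. x \<le> h L) at_top}"
  have A0: "0 \<in> A" unfolding A_def using eventually_mono[OF eventually_gt_at_top[of 0] h0] by simp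
  have Ab: "x \<le> 2 * B + C1" if "x \<in> A" for x
  proof -
    have "eventually (\<lambda>L. x \<le> h L \<and> L \<ge> 1) at_top"
      using that by (auto simp: A_def intro: eventually_conj eventually_ge_at_top)
    then obtain L where "x \<le> h L" "L \<ge> 1" using eventually_happens'[OF trivial_limit_at_top_linorder] by blast
    then show ?thesis using bd[of L] by linarith
  qed
  have bdd: "bdd_above A" using Ab by (rule bdd_aboveI)
  define l where "l = Sup A"
  have l0: "l \<ge> 0" unfolding l_def by (rule cSup_upper[OF A0 bdd])
  have lower: "eventually (\<lambda>L. l - \<eta> < h L) at_top" if "\<eta> > 0" for \<eta>
  proof -
    have "l - \<eta> < Sup A" using that by (simp add: l_def)
    then obtain x where x: "x \<in> A" "l - \<eta> < x" using less_cSup_iff[OF _ bdd] A0 by auto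
    then show ?thesis unfolding A_def by (auto elim: eventually_mono)
  qed
  have freq: "\<exists>L\<ge>X. h L < l + \<eta>" if "\<eta> > 0" for \<eta> X
  proof (rule ccontr)
    assume "\<not> (\<exists>L\<ge>X. h L < l + \<eta>)"
    then have "eventually (\<lambda>L. l + \<eta> \<le> h L) at_top"
      by (auto simp: eventually_at_top_linorder not_less)
    then have "l + \<eta> \<in> A" by (simp add: A_def)
    then have "l + \<eta> \<le> l" unfolding l_def by (rule cSup_upper[OF _ bdd])
    then show False using that by simp
  qed
  have upper: "eventually (\<lambda>L. h L < l + r) at_top" if r: "r > 0" for r
  proof -
    \<comment> \<open>With \<open>\<eta> \<le> r / 8\<close> and
      \<open>\<epsilon> * (l + 2) = r / 4\<close>, the final bound
      \<open>l + 2 * \<eta> + \<epsilon> * (l + 2)\<close> is at most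
      \<open>l + r / 2\<close>.\<close>
    define \<eta> where "\<eta> = min 1 (r / 8)"
    define \<epsilon> where "\<epsilon> = r / (4 * (l + 2))"
    have \<eta>: "\<eta> > 0" "\<eta> \<le> 1" "\<eta> \<le> r / 8" and \<epsilon>: "\<epsilon> > 0" using r l0 by (auto simp: \<eta>_def \<epsilon>_def)
    obtain C where C: "C \<ge> 0" "\<And>L m. L \<ge> 1 \<Longrightarrow> m \<ge> 1 \<Longrightarrow> h (real m * L) \<le> (1 + \<epsilon>) * h L + C * L powr (- \<beta>)"
      using sub[OF \<epsilon>] by auto
    have "((\<lambda>L. C * L powr (- \<beta>)) \<longlongrightarrow> C * 0) at_top"
      by (intro tendsto_intros tendsto_neg_powr filterlim_ident) (use \<beta> in auto)
    then have "eventually (\<lambda>L. C * L powr (- \<beta>) < \<eta>) at_top"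
      using order_tendstoD(2)[of _ 0] \<eta> by simp
    then obtain X where X: "\<And>L. L \<ge> X \<Longrightarrow> C * L powr (- \<beta>) < \<eta>"
      by (auto simp: eventually_at_top_linorder)
    obtain L0 where L0: "L0 \<ge> max X 1" "h L0 < l + \<eta>" using freq[OF \<eta>(1)] by blast
    have "isCont h L0"
      using cont L0 by (subst (asm) continuous_on_eq_continuous_at) auto
    then have "eventually (\<lambda>L. h L < l + \<eta>) (at L0)"
      using L0(2) by (auto simp: isCont_def dest: order_tendstoD(2))
    then obtain \<delta> where \<delta>: "\<delta> > 0" "\<And>L. L \<noteq> L0 \<Longrightarrow> dist L L0 < \<delta> \<Longrightarrow> h L < l + \<eta>"
      unfolding eventually_at by blast
    have near: "h L < l + \<eta>" if "L0 \<le> L" "L < L0 + \<delta>" for L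
      using \<delta>(2)[of L] L0(2) that by (cases "L = L0") (auto simp: dist_real_def)
    \<comment> \<open>The threshold makes \<open>m\<close> exceed \<open>L0 / \<delta>\<close>, so
      that \<open>L / m\<close> lies within \<open>\<delta>\<close> of \<open>L0\<close>.\<close>
    have "h L < l + r" if L: "L \<ge> L0 * (L0 / \<delta> + 2)" for L
    proof -
      have L00: "L0 \<ge> 1" using L0 by simp
      have "L0 * 1 \<le> L0 * (L0 / \<delta> + 2)" using L00 \<delta> by (intro mult_left_mono) auto
      then have LL: "L \<ge> L0" using L by simp
      have L0p: "L0 > 0" using L00 by simp
      then obtain m :: nat where m: "m \<ge> 1" "L0 \<le> L / real m" "L / real m \<le> L0 + L0 / real m" "real m > L / L0 - 1"
        using fl[OF L0p LL] by blast
      have "L / L0 \<ge> L0 / \<delta> + 2" using L L00 by (simp add: field_simps)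
      then have "real m > L0 / \<delta>" using m(4) by linarith
      then have "L0 / real m < \<delta>" using \<delta>(1) m(1) by (simp add: field_simps)
      then have nr: "h (L / real m) < l + \<eta>" using m by (intro near) auto
      have "h L = h (real m * (L / real m))" using m by simp
      also have "\<dots> \<le> (1 + \<epsilon>) * h (L / real m) + C * (L / real m) powr (- \<beta>)"
        using m(2) L00 by (intro C(2) m(1)) linarith
      also have "\<dots> < (1 + \<epsilon>) * (l + \<eta>) + \<eta>"
      proof (rule add_less_le_mono)
        show "(1 + \<epsilon>) * h (L / real m) < (1 + \<epsilon>) * (l + \<eta>)" using nr \<epsilon> by simp
        show "C * (L / real m) powr (- \<beta>) \<le> \<eta>" using X[OF order_trans[OF _ m(2)]] L0(1) by simp
      qed
      also have "\<dots> \<le> l + 2 * \<eta> + \<epsilon> * (l + 2)"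
        using \<epsilon> \<eta> by (simp add: algebra_simps)
      also have "\<epsilon> * (l + 2) = r / 4"
      proof -
        have aux: "r / (4 * w) * w = r / 4" if "w \<noteq> 0" for w :: real using that by simp
        show ?thesis unfolding \<epsilon>_def by (rule aux) (use l0 in simp)
      qed
      finally show ?thesis using \<eta>(3) r by linarith
    qed
    then show ?thesis by (auto simp: eventually_at_top_linorder)
  qed
  have "(h \<longlongrightarrow> l) at_top"
  proof (rule order_tendstoI)
    fix y assume "y < l"
    then show "eventually (\<lambda>L. y < h L) at_top" using lower[of "l - y"] by simp
  next
    fix y assume "l < y"
    then show "eventually (\<lambda>L. h L < y) at_top" using upper[of "y - l"] by simp
  qed
  then show ?thesis by blast
qed

section \<open>Poisson averages of sequences and a Tauberian theorem\<close>

lemma pois_summable_bounded: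
  assumes f: "\<And>k. \<bar>f k\<bar> \<le> A * real k + B" and \<theta>: "\<theta> \<ge> 0"
  shows "summable (\<lambda>k. pois \<theta> k * f k)"
proof (rule summable_comparison_test)
  show "summable (\<lambda>k. A * (pois \<theta> k * real k) + B * pois \<theta> k)"
    using pois_mean[of \<theta>] pois_sums[of \<theta>] by (intro summable_add summable_mult) (auto simp: sums_iff)
  show "\<exists>N. \<forall>n\<ge>N. norm (pois \<theta> n * f n) \<le> A * (pois \<theta> n * real n) + B * pois \<theta> n"
  proof (intro exI allI impI)
    fix n
    have "norm (pois \<theta> n * f n) = pois \<theta> n * \<bar>f n\<bar>" using pois_nonneg[OF \<theta>, of n] by (simp add: abs_mult)
    also have "\<dots> \<le> pois \<theta> n * (A * real n + B)" by (intro mult_left_mono f pois_nonneg \<theta>)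
    finally show "norm (pois \<theta> n * f n) \<le> A * (pois \<theta> n * real n) + B * pois \<theta> n" by (simp add: algebra_simps)
  qed
qed

text \<open>Up to the factor \<open>exp (- \<theta>)\<close> the average is a power series in
  \<open>\<theta>\<close>, which converges everywhere because \<open>f\<close> grows at most
  linearly.\<close>

lemma pois_continuous:
  fixes f :: "nat \<Rightarrow> real"
  assumes f: "\<And>k. \<bar>f k\<bar> \<le> A * real k + B"
  shows "isCont (\<lambda>\<theta>. \<Sum>k. pois \<theta> k * f k) \<theta>"
proof -
  define c where "c k = f k / fact k" for k
  have s: "summable (\<lambda>k. c k * K ^ k)" if "K \<ge> 0" for K
  proof -
    have "summable (\<lambda>k. exp K * (pois K k * f k))" by (intro summable_mult pois_summable_bounded[OF f that])
    moreover have "exp K * (pois K k * f k) = c k * K ^ k" for k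
      by (simp add: pois_def c_def exp_minus field_simps)
    ultimately show ?thesis by (simp only:)
  qed
  have "isCont (\<lambda>\<theta>. \<Sum>k. c k * \<theta> ^ k) \<theta>"
    using s[of "\<bar>\<theta>\<bar> + 1"] by (intro isCont_powser[where K = "\<bar>\<theta>\<bar> + 1"]) auto
  then have "isCont (\<lambda>\<theta>. exp (- \<theta>) * (\<Sum>k. c k * \<theta> ^ k)) \<theta>"
    by (intro isCont_mult isCont_exp isCont_minus) (auto intro: continuous_intros)
  moreover have "(\<lambda>\<theta>. \<Sum>k. pois \<theta> k * f k) = (\<lambda>\<theta>. exp (- \<theta>) * (\<Sum>k. c k * \<theta> ^ k))"
  proof
    fix \<theta> :: real
    have "summable (\<lambda>k. c k * \<theta> ^ k)"
      by (rule powser_inside[OF s[of "\<bar>\<theta>\<bar> + 1"]]) auto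
    then have "exp (- \<theta>) * (\<Sum>k. c k * \<theta> ^ k) = (\<Sum>k. exp (- \<theta>) * (c k * \<theta> ^ k))"
      by (rule suminf_mult[symmetric])
    then show "(\<Sum>k. pois \<theta> k * f k) = exp (- \<theta>) * (\<Sum>k. c k * \<theta> ^ k)"
      by (simp add: pois_def c_def mult_ac)
  qed
  ultimately show ?thesis by simp
qed

text \<open>Since \<open>(k + 1) * pois \<theta> (k + 1) = \<theta> * pois \<theta> k\<close>, an
  average of total costs becomes \<open>\<theta>\<close> times an average of costs per point, with
  the index shifted by one.\<close>

lemma pois_size_bias:
  fixes b :: "nat \<Rightarrow> real"
  assumes "\<And>k. k \<ge> 1 \<Longrightarrow> f k = real k * b k" "f 0 = 0" and B: "\<And>k. k \<ge> 1 \<Longrightarrow> \<bar>b k\<bar> \<le> B" and \<theta>: "\<theta> \<ge> 0"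
  shows "(\<Sum>k. pois \<theta> k * f k) = \<theta> * (\<Sum>k. pois \<theta> k * b (Suc k))"
proof -
  have bS: "summable (\<lambda>k. pois \<theta> k * b (Suc k))"
    using B by (intro pois_summable_bounded[where A = 0 and B = B] \<theta>) auto
  have e: "pois \<theta> (Suc k) * f (Suc k) = \<theta> * (pois \<theta> k * b (Suc k))" for k
    using assms(1)[of "Suc k"] unfolding pois_def power_Suc fact_Suc of_nat_mult by (simp add: field_simps del: of_nat_Suc)
  have "(\<lambda>k. pois \<theta> (Suc k) * f (Suc k)) sums (\<theta> * (\<Sum>k. pois \<theta> k * b (Suc k)))"
    unfolding e by (intro sums_mult summable_sums bS)
  then have "(\<lambda>k. pois \<theta> k * f k) sums (\<theta> * (\<Sum>k. pois \<theta> k * b (Suc k)))"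
    by (subst (asm) sums_Suc_iff) (simp add: assms(2))
  then show ?thesis by (rule sums_unique[symmetric])
qed

text \<open>Markov's inequality for the central moment of order \<open>r\<close>, which is left
  free: a large \<open>r\<close> gives decay faster than any prescribed power.\<close>

lemma pois_tail:
  assumes \<theta>: "\<theta> \<ge> 1" and r: "r \<ge> 0" and s: "s > 0"
  shows "summable (\<lambda>k. pois \<theta> k * (if \<bar>real k - \<theta>\<bar> \<ge> s then 1 else 0))"
    and "(\<Sum>k. pois \<theta> k * (if \<bar>real k - \<theta>\<bar> \<ge> s then 1 else 0)) \<le> 2 * exp 1 * fact (nat \<lceil>r\<rceil>) * \<theta> powr (r / 2) / s powr r"
proof -
  note m = poisson_central_moment[OF \<theta> r]
  show s1: "summable (\<lambda>k. pois \<theta> k * (if \<bar>real k - \<theta>\<bar> \<ge> s then 1 else 0))"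
    using \<theta> by (intro pois_summable_bounded[where A = 0 and B = 1]) auto
  have "(\<Sum>k. pois \<theta> k * (if \<bar>real k - \<theta>\<bar> \<ge> s then 1 else 0)) \<le> (\<Sum>k. pois \<theta> k * \<bar>real k - \<theta>\<bar> powr r / s powr r)"
  proof (intro suminf_le s1 summable_divide m(1))
    fix k
    have "(if \<bar>real k - \<theta>\<bar> \<ge> s then 1 else 0) \<le> \<bar>real k - \<theta>\<bar> powr r / s powr r"
    proof (cases "\<bar>real k - \<theta>\<bar> \<ge> s")
      case True
      then have "s powr r \<le> \<bar>real k - \<theta>\<bar> powr r" using s r by (intro powr_mono2) auto
      then show ?thesis using s by simp
    qed auto
    then have "pois \<theta> k * (if \<bar>real k - \<theta>\<bar> \<ge> s then 1 else 0) \<le> pois \<theta> k * (\<bar>real k - \<theta>\<bar> powr r / s powr r)"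
      using \<theta> by (intro mult_left_mono pois_nonneg) auto
    then show "pois \<theta> k * (if \<bar>real k - \<theta>\<bar> \<ge> s then 1 else 0) \<le> pois \<theta> k * \<bar>real k - \<theta>\<bar> powr r / s powr r"
      by simp
  qed
  also have "\<dots> = (\<Sum>k. pois \<theta> k * \<bar>real k - \<theta>\<bar> powr r) / s powr r"
    by (rule suminf_divide[OF m(1)])
  also have "\<dots> \<le> 2 * exp 1 * fact (nat \<lceil>r\<rceil>) * \<theta> powr (r / 2) / s powr r"
    by (intro divide_right_mono m(2)) auto
  finally show "(\<Sum>k. pois \<theta> k * (if \<bar>real k - \<theta>\<bar> \<ge> s then 1 else 0)) \<le> 2 * exp 1 * fact (nat \<lceil>r\<rceil>) * \<theta> powr (r / 2) / s powr r" .
qed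

text \<open>\<open>T\<close> is the probability of a deviation by at least \<open>s\<close>. Within
  the window every \<open>k\<close> lies on one side of \<open>n\<close>, so monotonicity compares
  \<open>b (Suc k)\<close> with \<open>b n\<close>; outside the window the bounds \<open>0\<close>
  and \<open>b 1\<close> are used.\<close>

lemma pois_antimono_bounds:
  fixes b :: "nat \<Rightarrow> real"
  assumes mono: "\<And>i j. 1 \<le> i \<Longrightarrow> i \<le> j \<Longrightarrow> b j \<le> b i" and b0: "\<And>k. b k \<ge> 0" and \<theta>: "\<theta> \<ge> 1" and n: "n \<ge> 1" and s: "s > 0"
  defines "T \<equiv> (\<Sum>k. pois \<theta> k * (if \<bar>real k - \<theta>\<bar> \<ge> s then 1 else 0))"
  shows "\<theta> + s \<le> real n \<Longrightarrow> b n * (1 - T) \<le> (\<Sum>k. pois \<theta> k * b (Suc k))"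
    and "real n + s \<le> \<theta> \<Longrightarrow> (\<Sum>k. pois \<theta> k * b (Suc k)) \<le> b n + b 1 * T"
proof -
  have sT: "summable (\<lambda>k. pois \<theta> k * (if \<bar>real k - \<theta>\<bar> \<ge> s then 1 else 0))"
    by (rule pois_tail(1)[OF \<theta> order_refl s])
  have sb: "summable (\<lambda>k. pois \<theta> k * b (Suc k))"
    using mono[of 1 "Suc k" for k] b0 \<theta> by (intro pois_summable_bounded[where A = 0 and B = "b 1"]) auto
  have s1: "summable (pois \<theta>)" "(\<Sum>k. pois \<theta> k) = 1" using pois_sums[of \<theta>] by (auto simp: sums_iff)
  have p0: "pois \<theta> k \<ge> 0" for k using \<theta> by (intro pois_nonneg) auto
  show "b n * (1 - T) \<le> (\<Sum>k. pois \<theta> k * b (Suc k))" if h: "\<theta> + s \<le> real n"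
  proof -
    have "b n * (1 - T) = (\<Sum>k. b n * (pois \<theta> k - pois \<theta> k * (if \<bar>real k - \<theta>\<bar> \<ge> s then 1 else 0)))"
      unfolding T_def using s1 sT by (simp only: suminf_mult summable_diff suminf_diff[symmetric])
    also have "\<dots> \<le> (\<Sum>k. pois \<theta> k * b (Suc k))"
    proof (intro suminf_le sb summable_mult summable_diff s1 sT)
      fix k
      show "b n * (pois \<theta> k - pois \<theta> k * (if \<bar>real k - \<theta>\<bar> \<ge> s then 1 else 0)) \<le> pois \<theta> k * b (Suc k)"
      proof (cases "\<bar>real k - \<theta>\<bar> \<ge> s")
        case True then show ?thesis using p0[of k] b0[of "Suc k"] by simp
      next
        case False
        then have "real k < real n" using h by linarith
        then have "b n \<le> b (Suc k)" by (intro mono) auto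
        then have "pois \<theta> k * b n \<le> pois \<theta> k * b (Suc k)" using p0 by (intro mult_left_mono) auto
        then show ?thesis using False by (simp add: mult.commute)
      qed
    qed
    finally show ?thesis .
  qed
  show "(\<Sum>k. pois \<theta> k * b (Suc k)) \<le> b n + b 1 * T" if h: "real n + s \<le> \<theta>"
  proof -
    have "(\<Sum>k. pois \<theta> k * b (Suc k)) \<le> (\<Sum>k. b n * pois \<theta> k + b 1 * (pois \<theta> k * (if \<bar>real k - \<theta>\<bar> \<ge> s then 1 else 0)))"
    proof (intro suminf_le sb summable_add summable_mult s1 sT)
      fix k
      show "pois \<theta> k * b (Suc k) \<le> b n * pois \<theta> k + b 1 * (pois \<theta> k * (if \<bar>real k - \<theta>\<bar> \<ge> s then 1 else 0))"
      proof (cases "\<bar>real k - \<theta>\<bar> \<ge> s")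
        case True
        have "pois \<theta> k * b (Suc k) \<le> pois \<theta> k * b 1" using mono[of 1 "Suc k"] p0 by (intro mult_left_mono) auto
        then show ?thesis using True mult_nonneg_nonneg[OF b0[of n] p0[of k]] by (simp add: mult.commute)
      next
        case False
        then have "real n \<le> real k" using h by linarith
        then have "b (Suc k) \<le> b n" using n by (intro mono) auto
        then have "pois \<theta> k * b (Suc k) \<le> pois \<theta> k * b n" using p0 by (intro mult_left_mono) auto
        then show ?thesis using False by (simp add: mult.commute)
      qed
    qed
    also have "\<dots> = b n + b 1 * T"
      unfolding T_def using s1 sT by (subst suminf_add[symmetric]) (auto simp: suminf_mult intro!: summable_mult)
    finally show ?thesis .
  qed
qed

text \<open>Monotonicity is the Tauberian condition. The value \<open>b n\<close> is compared with
  Poisson averages of rates \<open>(1 - \<delta>) * n\<close> and \<open>(1 + \<delta>) * n\<close>,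
  whose weights lie on one side of \<open>n\<close> up to a negligible tail. The limits
  \<open>(1 - \<delta>) powr (- q) * f\<close> and \<open>(1 + \<delta>) powr (- q) * f\<close> of
  these bounds both tend to \<open>f\<close> with \<open>\<delta>\<close>.\<close>

lemma tauber_poisson:
  fixes b :: "nat \<Rightarrow> real" and q f :: real
  assumes mono: "\<And>i j. 1 \<le> i \<Longrightarrow> i \<le> j \<Longrightarrow> b j \<le> b i" and b0: "\<And>k. b k \<ge> 0" and q: "q > 0"
    and lim: "((\<lambda>\<theta>. \<theta> powr q * (\<Sum>k. pois \<theta> k * b (Suc k))) \<longlongrightarrow> f) at_top"
  shows "(\<lambda>n. real n powr q * b n) \<longlonglongrightarrow> f"
proof -
  define F where "F \<theta> = (\<Sum>k. pois \<theta> k * b (Suc k))" for \<theta>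
  define T where "T \<theta> s = (\<Sum>k. pois \<theta> k * (if \<bar>real k - \<theta>\<bar> \<ge> s then 1 else 0))" for \<theta> s :: real
  have T0: "T \<theta> s \<ge> 0" if "\<theta> \<ge> 1" "s > 0" for \<theta> s
    unfolding T_def using that by (intro suminf_nonneg pois_tail(1)[OF that(1) order_refl that(2)]) (auto simp: pois_nonneg)
  have ev: "eventually (\<lambda>n. a * real n \<ge> 1 \<and> n \<ge> 1) sequentially" if "a > 0" for a :: real
  proof -
    have "filterlim (\<lambda>n. a * real n) at_top sequentially"
      using that by (intro filterlim_tendsto_pos_mult_at_top[OF tendsto_const] filterlim_real_sequentially)
    then show ?thesis
      by (auto simp: filterlim_at_top intro!: eventually_conj eventually_ge_at_top)
  qed
  have nT: "(\<lambda>n. real n powr q * T (a * real n) (\<delta> * real n)) \<longlonglongrightarrow> 0" if a: "a > 0" and \<delta>: "\<delta> > 0" for a \<delta>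
  proof (rule tendsto_sandwich[where f = "\<lambda>_. 0"])
    \<comment> \<open>The tail is of order \<open>n powr (r / 2 - r) = n powr (- q - 1)\<close>, so
      that even after multiplication by \<open>n powr q\<close> it is
      \<open>O(1 / n)\<close>.\<close>
    define r where "r = 2 * q + 2"
    define C where "C = 2 * exp 1 * fact (nat \<lceil>r\<rceil>) * (a powr (q + 1) / \<delta> powr r)"
    show "(\<lambda>n. C * (1 / real n)) \<longlonglongrightarrow> 0"
      using tendsto_mult_right_zero[OF lim_1_over_n] by simp
    show "eventually (\<lambda>n. 0 \<le> real n powr q * T (a * real n) (\<delta> * real n)) sequentially"
      using ev[OF a] by eventually_elim (auto intro!: mult_nonneg_nonneg T0 simp: \<delta>)
    show "eventually (\<lambda>n. real n powr q * T (a * real n) (\<delta> * real n) \<le> C * (1 / real n)) sequentially"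
      using ev[OF a]
    proof eventually_elim
      case (elim n)
      then have n: "real n > 0" by simp
      have "T (a * real n) (\<delta> * real n) \<le> 2 * exp 1 * fact (nat \<lceil>r\<rceil>) * (a * real n) powr (r / 2) / (\<delta> * real n) powr r"
        unfolding T_def using elim n \<delta> q by (intro pois_tail(2)) (auto simp: r_def)
      also have "(a * real n) powr (r / 2) = a powr (q + 1) * real n powr (q + 1)"
        using a n by (simp add: powr_mult r_def add_divide_distrib)
      also have "(\<delta> * real n) powr r = \<delta> powr r * real n powr r"
        using \<delta> n by (simp add: powr_mult)
      finally have "T (a * real n) (\<delta> * real n) \<le> C * (real n powr (q + 1) / real n powr r)"
        by (simp add: C_def)
      then have "real n powr q * T (a * real n) (\<delta> * real n) \<le> real n powr q * (C * (real n powr (q + 1) / real n powr r))"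
        by (intro mult_left_mono) auto
      also have "\<dots> = C * (real n powr (q + (q + 1) - r))"
        by (simp only: powr_add powr_diff times_divide_eq_right mult.left_commute[of _ C])
      also have "q + (q + 1) - r = - 1" by (simp add: r_def)
      also have "real n powr (- 1) = 1 / real n" using n by (simp add: powr_minus_divide)
      finally show ?case .
    qed
  qed auto
  have limF: "(\<lambda>n. (a * real n) powr q * F (a * real n)) \<longlonglongrightarrow> f" if a: "a > 0" for a
  proof -
    have "filterlim (\<lambda>n. a * real n) at_top sequentially"
      using a by (intro filterlim_tendsto_pos_mult_at_top[OF tendsto_const] filterlim_real_sequentially)
    from filterlim_compose[OF lim this] show ?thesis by (simp add: F_def)
  qed
  show ?thesis
  proof (rule order_tendstoI)
    fix y assume y: "f < y"
    have "((\<lambda>\<delta>. (1 - \<delta>) powr (- q) * f) \<longlongrightarrow> (1 - 0) powr (- q) * f) (at_right 0)"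
      by (intro tendsto_intros) auto
    then have "eventually (\<lambda>\<delta>. (1 - \<delta>) powr (- q) * f < y) (at_right 0)"
      using y by (auto dest: order_tendstoD(2))
    moreover have "eventually (\<lambda>\<delta>::real. 0 < \<delta> \<and> \<delta> < 1) (at_right 0)"
      by (rule eventually_at_rightI[of 0 1]) auto
    ultimately have "eventually (\<lambda>\<delta>. (1 - \<delta>) powr (- q) * f < y \<and> 0 < \<delta> \<and> \<delta> < 1) (at_right 0)"
      by (rule eventually_conj)
    then obtain \<delta> where \<delta>: "(1 - \<delta>) powr (- q) * f < y" "0 < \<delta>" "\<delta> < 1"
      using eventually_happens'[OF trivial_limit_at_right_real] by blast
    \<comment> \<open>The rate is below \<open>n\<close>: together with the window
      \<open>\<delta> * n\<close> it just reaches \<open>n\<close>, which bounds \<open>b n\<close>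
      from above.\<close>
    define a where "a = 1 - \<delta>"
    have a: "a > 0" using \<delta> by (simp add: a_def)
    have T1: "(\<lambda>n. T (a * real n) (\<delta> * real n)) \<longlonglongrightarrow> 0"
    proof (rule tendsto_sandwich[OF _ _ tendsto_const nT[OF a \<delta>(2)]])
      show "eventually (\<lambda>n. 0 \<le> T (a * real n) (\<delta> * real n)) sequentially"
        using ev[OF a] by eventually_elim (auto intro!: T0 simp: \<delta>)
      show "eventually (\<lambda>n. T (a * real n) (\<delta> * real n) \<le> real n powr q * T (a * real n) (\<delta> * real n)) sequentially"
        using ev[OF a]
      proof eventually_elim
        case (elim n)
        then have "1 \<le> real n powr q" using q by (intro ge_one_powr_ge_zero) auto
        then have "1 * T (a * real n) (\<delta> * real n) \<le> real n powr q * T (a * real n) (\<delta> * real n)"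
          using elim \<delta> by (intro mult_right_mono T0) auto
        then show ?case by simp
      qed
    qed
    have "(\<lambda>n. a powr (- q) * ((a * real n) powr q * F (a * real n)) / (1 - T (a * real n) (\<delta> * real n))) \<longlonglongrightarrow> a powr (- q) * f / (1 - 0)"
      by (intro tendsto_intros limF a T1) auto
    then have "eventually (\<lambda>n. a powr (- q) * ((a * real n) powr q * F (a * real n)) / (1 - T (a * real n) (\<delta> * real n)) < y) sequentially"
      using \<delta>(1) by (auto simp: a_def dest: order_tendstoD(2))
    moreover have "eventually (\<lambda>n. T (a * real n) (\<delta> * real n) < 1) sequentially"
      using order_tendstoD(2)[OF T1, of 1] by simp
    ultimately show "eventually (\<lambda>n. real n powr q * b n < y) sequentially"
      using ev[OF a]
    proof eventually_elim
      case (elim n)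
      have "b n * (1 - T (a * real n) (\<delta> * real n)) \<le> F (a * real n)"
        unfolding F_def T_def using elim \<delta>
        by (intro pois_antimono_bounds(1) mono b0) (auto simp: a_def algebra_simps)
      then have "b n \<le> F (a * real n) / (1 - T (a * real n) (\<delta> * real n))"
        using elim(2) by (simp add: pos_le_divide_eq)
      then have "real n powr q * b n \<le> real n powr q * (F (a * real n) / (1 - T (a * real n) (\<delta> * real n)))"
        by (intro mult_left_mono) auto
      also have "\<dots> = a powr (- q) * ((a * real n) powr q * F (a * real n)) / (1 - T (a * real n) (\<delta> * real n))"
        using a by (simp add: powr_mult powr_minus)
      finally show ?case using elim(1) by linarith
    qed
  next
    fix y assume y: "y < f"
    have "((\<lambda>\<delta>. (1 + \<delta>) powr (- q) * f) \<longlongrightarrow> (1 + 0) powr (- q) * f) (at_right 0)"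
      by (intro tendsto_intros) auto
    then have "eventually (\<lambda>\<delta>. y < (1 + \<delta>) powr (- q) * f) (at_right 0)"
      using y by (auto dest: order_tendstoD(1))
    then have "eventually (\<lambda>\<delta>. y < (1 + \<delta>) powr (- q) * f \<and> 0 < \<delta>) (at_right 0)"
      by (intro eventually_conj eventually_at_right_less)
    then obtain \<delta> where \<delta>: "y < (1 + \<delta>) powr (- q) * f" "0 < \<delta>"
      using eventually_happens'[OF trivial_limit_at_right_real] by blast
    \<comment> \<open>The rate is above \<open>n\<close>, for the bound from below. The tail now
      enters with the factor \<open>b 1\<close> outside the average, so its product with
      \<open>n powr q\<close> must vanish.\<close>
    define a where "a = 1 + \<delta>"
    have a: "a > 0" using \<delta> by (simp add: a_def)
    have "(\<lambda>n. a powr (- q) * ((a * real n) powr q * F (a * real n)) - b 1 * (real n powr q * T (a * real n) (\<delta> * real n))) \<longlonglongrightarrow> a powr (- q) * f - b 1 * 0"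
      by (intro tendsto_intros limF nT a \<delta>)
    then have "eventually (\<lambda>n. y < a powr (- q) * ((a * real n) powr q * F (a * real n)) - b 1 * (real n powr q * T (a * real n) (\<delta> * real n))) sequentially"
      using \<delta>(1) by (auto simp: a_def dest: order_tendstoD(1))
    then show "eventually (\<lambda>n. y < real n powr q * b n) sequentially"
      using ev[OF a]
    proof eventually_elim
      case (elim n)
      have "F (a * real n) \<le> b n + b 1 * T (a * real n) (\<delta> * real n)"
        unfolding F_def T_def using elim \<delta>
        by (intro pois_antimono_bounds(2) mono b0) (auto simp: a_def algebra_simps)
      then have "real n powr q * F (a * real n) \<le> real n powr q * (b n + b 1 * T (a * real n) (\<delta> * real n))"
        by (intro mult_left_mono) auto
      moreover have "a powr (- q) * ((a * real n) powr q * F (a * real n)) = real n powr q * F (a * real n)"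
        using a by (simp add: powr_mult powr_minus)
      moreover have "real n powr q * (b n + b 1 * T (a * real n) (\<delta> * real n)) =
          real n powr q * b n + b 1 * (real n powr q * T (a * real n) (\<delta> * real n))"
        by (simp only: distrib_left mult.left_commute)
      ultimately show ?case using elim(1) by linarith
    qed
  qed
qed

section \<open>The two limits and the positivity of their common value\<close>

theorem theorem6p2:
  fixes p :: real
    and M :: "'w measure" and N :: "'w \<Rightarrow> (real ^ 'd) measure"
    and P :: "'v measure" and X :: "nat \<Rightarrow> 'v \<Rightarrow> real ^ 'd"
  assumes "CARD('d) \<ge> 3" and "p \<ge> 1"
    and "poisson_point_process M N"
    and "iid_uniform P X"
  shows "\<exists>f_ref::real. 0 < f_ref \<and>
    ((\<lambda>L. \<integral>\<^sup>+ \<omega>. 1 / emeasure lborel (Q L :: (real ^ 'd) set) *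
        transport_cost p (Q L) (N \<omega>)
          (density lborel (\<lambda>_. emeasure (N \<omega>) (Q L) / emeasure lborel (Q L :: (real ^ 'd) set))) \<partial>M)
      \<longlongrightarrow> ennreal f_ref) at_top \<and>
    (\<lambda>n. ennreal (real n powr (p / real CARD('d))) *
        (\<integral>\<^sup>+ \<omega>. transport_cost p (Q 1) (empirical_measure n (\<lambda>i. X i \<omega>)) lborel \<partial>P))
      \<longlonglongrightarrow> ennreal f_ref"
proof -
  interpret poisson_and_iid M N P X
    using assms(3,4) by (simp add: poisson_and_iid_def poisson_process_def iid_points_def)
  let ?d = "CARD('d)"
  have p: "p \<ge> 1" "p > 0" "p \<ge> 0" using assms(2) by auto
  have d: "real ?d \<ge> 3" using assms(1) by simp
  have al_fin: "iid.alpha p n < \<top>" for n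
  proof (induction n)
    case (Suc n)
    show ?case
    proof (cases "n = 0")
      case True then show ?thesis using iid.alpha_1_finite[OF p(3)] by simp
    next
      case False
      then have "of_nat (Suc n) / of_nat n * iid.alpha p n < \<top>"
        using Suc.IH by (simp add: ennreal_mult_less_top ennreal_of_nat_eq_real_of_nat divide_ennreal del: of_nat_Suc)
      then show ?thesis using iid.alpha_Suc_le[of n p] False p by (simp add: order_le_less_trans del: of_nat_Suc)
    qed
  qed simp
  define av where "av n = enn2real (iid.alpha p n)" for n
  have av: "iid.alpha p n = ennreal (av n)" "av n \<ge> 0" for n
    using al_fin[of n] by (simp_all add: av_def)
  define b where "b n = av n / real n" for n
  have b0: "b n \<ge> 0" for n using av(2)[of n] by (simp add: b_def)
  have av_b: "av n = real n * b n" if "n \<ge> 1" for n using that by (simp add: b_def)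
  have av_0: "av 0 = 0" by (simp add: av_def)
  have bS: "b (Suc n) \<le> b n" if n: "n \<ge> 1" for n
  proof -
    have "ennreal (av (Suc n)) \<le> of_nat (Suc n) / of_nat n * ennreal (av n)"
      using iid.alpha_Suc_le[OF n p(2)] by (simp only: av)
    also have "\<dots> = ennreal (real (Suc n) / real n * av n)"
      using n av(2)[of n] by (simp add: ennreal_of_nat_eq_real_of_nat divide_ennreal ennreal_mult[symmetric] del: of_nat_Suc)
    finally have "av (Suc n) \<le> real (Suc n) / real n * av n"
      using av(2)[of n] by (subst (asm) ennreal_le_iff) auto
    then show ?thesis using n by (simp add: b_def field_simps del: of_nat_Suc)
  qed
  have mono: "b j \<le> b i" if "1 \<le> i" "i \<le> j" for i j
    using that(2)
  proof (induction rule: dec_induct)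
    case (step n)
    then show ?case using bS[of n] that(1) by simp
  qed simp
  \<comment> \<open>Linear growth, a consequence of the monotone cost per point, makes all Poisson
    averages of the costs finite and continuous in the rate.\<close>
  have av_lin: "\<bar>av k\<bar> \<le> b 1 * real k + 0" for k
  proof (cases "k = 0")
    case False
    then have "av k = real k * b k" "b k \<le> b 1" using av_b[of k] mono[of 1 k] by auto
    then show ?thesis using b0[of k] by (simp add: abs_mult mult.commute mult_left_mono)
  qed (simp add: av_0)
  define G where "G \<theta> = (\<Sum>k. pois \<theta> k * av k)" for \<theta>
  \<comment> \<open>The mean cost per unit volume on a cube of side \<open>L\<close>, as
    \<open>cube\<close> shows; the series makes it a real continuous function of
    \<open>L\<close>.\<close>
  define h where "h L = L powr p / L ^ ?d * G (L ^ ?d)" for L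
  have G0: "G \<theta> \<ge> 0" if "\<theta> \<ge> 0" for \<theta>
    unfolding G_def using pois_summable_bounded[OF av_lin that] that av(2) by (intro suminf_nonneg) (auto simp: pois_nonneg)
  have h0: "h L \<ge> 0" if "L > 0" for L
    using that by (simp add: h_def G0)
  have cube: "mean_cost p a (a + vec L) = ennreal (L ^ ?d * h L)" if L: "L > 0" for a :: "real ^ 'd" and L
  proof -
    have "mean_cost p a (a + vec L) = (\<Sum>n. ennreal (pois (L ^ ?d) n) * (ennreal (L powr p) * ennreal (av n)))"
      unfolding mean_cost_def nn_integral_box_cost_cube[OF L p(2)] av(1) ..
    also have "\<dots> = (\<Sum>n. ennreal (L powr p * (pois (L ^ ?d) n * av n)))"
      using L av(2) by (simp add: ennreal_mult[symmetric] pois_nonneg mult_ac)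
    also have "\<dots> = ennreal (\<Sum>n. L powr p * (pois (L ^ ?d) n * av n))"
      using L av(2) by (intro suminf_ennreal2 summable_mult pois_summable_bounded[OF av_lin]) (auto simp: pois_nonneg)
    also have "(\<Sum>n. L powr p * (pois (L ^ ?d) n * av n)) = L powr p * G (L ^ ?d)"
      unfolding G_def using L by (intro suminf_mult pois_summable_bounded[OF av_lin]) auto
    also have "\<dots> = L ^ ?d * h L" using L by (simp add: h_def)
    finally show ?thesis .
  qed
  \<comment> \<open>\<open>- \<beta> = p * (1 - d / 2)\<close>, the exponent of the loss per unit
    volume at scale \<open>L\<close>; it is negative because \<open>d > 2\<close>.\<close>
  define \<beta> where "\<beta> = real ?d * p / 2 - p"
  have "p * 3 \<le> p * real ?d" using d p by (intro mult_left_mono) auto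
  then have \<beta>: "\<beta> > 0" using p by (simp add: \<beta>_def mult.commute)
  have "\<exists>l. (h \<longlongrightarrow> l) at_top"
  proof (rule tendsto_of_near_subadditive[OF h0 _ \<beta>])
    have "isCont h L" if "L > 0" for L
    proof -
      have c: "isCont G (L ^ ?d)" unfolding G_def by (rule pois_continuous[OF av_lin])
      have c2: "isCont (\<lambda>L. G (L ^ ?d)) L"
        by (rule isCont_o2[where f = "\<lambda>L. L ^ ?d" and g = G]) (intro continuous_intros c)+
      show ?thesis unfolding h_def using that by (intro continuous_intros c2) auto
    qed
    then show "continuous_on {0<..} h" by (intro continuous_at_imp_continuous_on) auto
  next
    fix \<epsilon> :: real assume \<epsilon>: "\<epsilon> > 0"
    obtain C where C: "C \<ge> 0" "\<And>L u m. \<lbrakk>1 \<le> L; 0 \<le> u; 1 \<le> m; \<And>a. mean_cost p a (a + vec L) \<le> ennreal u\<rbrakk> \<Longrightarrow>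
       mean_cost p 0 (vec (real m * L)) \<le> ennreal (real m ^ ?d * ((1 + \<epsilon>) * u + C * L powr (p + real ?d - real ?d * p / 2)))"
      using mean_cost_multiple_le[OF assms(1) p(1) \<epsilon>] by blast
    show "\<exists>C\<ge>0. \<forall>L\<ge>1. \<forall>m\<ge>1::nat. h (real m * L) \<le> (1 + \<epsilon>) * h L + C * L powr (- \<beta>)"
    proof (intro exI[of _ C] conjI allI impI C(1))
      fix L :: real and m :: nat assume L: "1 \<le> L" and m: "1 \<le> m"
      have mL: "real m * L > 0" using L m by simp
      have Ld: "L ^ ?d > 0" using L by simp
      have md: "real m ^ ?d > 0" using m by simp
      have pois: "L powr (p + real ?d - real ?d * p / 2) = L ^ ?d * L powr (- \<beta>)"
      proof -
        have "L ^ ?d = L powr real ?d" using L by (simp add: powr_realpow)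
        then show ?thesis by (simp add: \<beta>_def powr_add[symmetric] algebra_simps)
      qed
      have "ennreal ((real m * L) ^ ?d * h (real m * L)) = mean_cost p 0 (vec (real m * L))"
        using cube[OF mL, of 0] by simp
      also have "\<dots> \<le> ennreal (real m ^ ?d * ((1 + \<epsilon>) * (L ^ ?d * h L) + C * L powr (p + real ?d - real ?d * p / 2)))"
        using L m h0[of L] by (intro C(2)) (auto simp: cube)
      finally have "(real m * L) ^ ?d * h (real m * L) \<le> real m ^ ?d * ((1 + \<epsilon>) * (L ^ ?d * h L) + C * L powr (p + real ?d - real ?d * p / 2))"
        using L h0[of L] C(1) \<epsilon> by (subst (asm) ennreal_le_iff) auto
      then have "(real m ^ ?d * L ^ ?d) * h (real m * L) \<le> (real m ^ ?d * L ^ ?d) * ((1 + \<epsilon>) * h L + C * L powr (- \<beta>))"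
        unfolding pois by (simp add: power_mult_distrib algebra_simps)
      then show "h (real m * L) \<le> (1 + \<epsilon>) * h L + C * L powr (- \<beta>)"
        using mult_pos_pos[OF md Ld] by (simp only: mult_le_cancel_left_pos)
    qed
  qed
  then obtain l where l: "(h \<longlongrightarrow> l) at_top" by blast
  define F where "F \<theta> = (\<Sum>k. pois \<theta> k * b (Suc k))" for \<theta>
  have GF: "G \<theta> = \<theta> * F \<theta>" if "\<theta> \<ge> 0" for \<theta>
    unfolding G_def F_def
    by (rule pois_size_bias[where B = "b 1"]) (use av_b av_0 b0 mono that in auto)
  \<comment> \<open>With \<open>L\<close> the \<open>d\<close>-th root of \<open>\<theta>\<close>,
    the factor \<open>\<theta>\<close> from size-biasing cancels the division by the volume.\<close>
  have hF: "h (\<theta> powr (1 / real ?d)) = \<theta> powr (p / real ?d) * F \<theta>" if \<theta>: "\<theta> > 0" for \<theta>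
  proof -
    have "(\<theta> powr (1 / real ?d)) ^ ?d = \<theta>"
      using \<theta> by (simp add: powr_realpow[symmetric] powr_powr)
    moreover have "(\<theta> powr (1 / real ?d)) powr p = \<theta> powr (p / real ?d)"
      by (simp add: powr_powr)
    ultimately show ?thesis using \<theta> by (simp add: h_def GF)
  qed
  have "filterlim (\<lambda>\<theta>. \<theta> powr (1 / real ?d)) at_top at_top"
    unfolding filterlim_at_top
  proof (intro allI)
    fix Z :: real
    show "eventually (\<lambda>\<theta>. Z \<le> \<theta> powr (1 / real ?d)) at_top"
    proof (rule eventually_at_top_linorderI)
      fix \<theta> assume \<theta>: "\<theta> \<ge> max Z 1 powr real ?d"
      have "Z \<le> (max Z 1 powr real ?d) powr (1 / real ?d)" by (simp add: powr_powr)
      also have "\<dots> \<le> \<theta> powr (1 / real ?d)" using \<theta> by (intro powr_mono2) auto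
      finally show "Z \<le> \<theta> powr (1 / real ?d)" .
    qed
  qed
  from filterlim_compose[OF l this]
  have "((\<lambda>\<theta>. \<theta> powr (p / real ?d) * F \<theta>) \<longlongrightarrow> l) at_top"
    by (rule Lim_transform_eventually) (rule eventually_mono[OF eventually_gt_at_top[of 0] hF])
  then have lim_b: "(\<lambda>n. real n powr (p / real ?d) * b n) \<longlonglongrightarrow> l"
    unfolding F_def using d p by (intro tauber_poisson mono b0) auto
  \<comment> \<open>The lower bound of \<open>alpha_lower\<close>, divided by \<open>n\<close> and
    multiplied by \<open>n powr (p / d)\<close>, is independent of \<open>n\<close>; this is its
    value.\<close>
  define c0 where "c0 = 1 / 2 * ((2 powr (- 1 / real ?d) / 2) powr p)"
  have c0: "c0 > 0" by (simp add: c0_def)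
  have low: "c0 \<le> real n powr (p / real ?d) * b n" if n: "n \<ge> 1" for n
  proof -
    have "ennreal (real n / 2 * ((2 * real n) powr (- 1 / real ?d) / 2) powr p) \<le> ennreal (av n)"
      using iid.alpha_lower[OF n p(2)] by (simp only: av)
    then have "real n / 2 * ((2 * real n) powr (- 1 / real ?d) / 2) powr p \<le> real n * b n"
      using av(2)[of n] av_b[OF n] by (subst (asm) ennreal_le_iff) auto
    then have "1 / 2 * ((2 * real n) powr (- 1 / real ?d) / 2) powr p \<le> b n"
      using n by simp
    then have "real n powr (p / real ?d) * (1 / 2 * ((2 * real n) powr (- 1 / real ?d) / 2) powr p) \<le> real n powr (p / real ?d) * b n"
      by (intro mult_left_mono) auto
    moreover have "real n powr (p / real ?d) * (1 / 2 * ((2 * real n) powr (- 1 / real ?d) / 2) powr p) = c0"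
    proof -
      have "((2 * real n) powr (- 1 / real ?d) / 2) powr p = (2 powr (- 1 / real ?d) / 2 * real n powr (- 1 / real ?d)) powr p"
        using n by (simp add: powr_mult)
      also have "\<dots> = (2 powr (- 1 / real ?d) / 2) powr p * real n powr (- (p / real ?d))"
        by (subst powr_mult) (simp_all add: powr_powr)
      finally show ?thesis using n by (simp add: c0_def powr_minus)
    qed
    ultimately show ?thesis by simp
  qed
  have "c0 \<le> l"
    using low by (intro tendsto_lowerbound[OF lim_b]) (auto intro: eventually_sequentiallyI[of 1])
  then have lpos: "l > 0" using c0 by simp
  have one: "(\<integral>\<^sup>+ \<omega>. 1 / emeasure lborel (Q L :: (real ^ 'd) set) *
        transport_cost p (Q L) (N \<omega>)
          (density lborel (\<lambda>_. emeasure (N \<omega>) (Q L) / emeasure lborel (Q L :: (real ^ 'd) set))) \<partial>M) = ennreal (h L)" if L: "L > 0" for L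
  proof -
    have QL: "(Q L :: (real ^ 'd) set) = cbox 0 (0 + vec L)"
      unfolding Q_def by (rule arg_cong2[where f = cbox]) (simp_all add: vec_eq_iff)
    have I: "(\<integral>\<^sup>+ \<omega>. 1 / emeasure lborel (Q L :: (real ^ 'd) set) * box_cost p (N \<omega>) (Q L) \<partial>M) =
       1 / emeasure lborel (Q L :: (real ^ 'd) set) * (\<integral>\<^sup>+ \<omega>. box_cost p (N \<omega>) (Q L) \<partial>M)"
      by (intro nn_integral_cmult measurable_box_cost p) (auto simp: QL)
    have J: "(\<integral>\<^sup>+ \<omega>. box_cost p (N \<omega>) (Q L) \<partial>M) = ennreal (L ^ ?d * h L)"
      unfolding QL using cube[OF L, of 0] by (simp only: mean_cost_def)
    have e1: "1 / emeasure lborel (Q L :: (real ^ 'd) set) = ennreal (1 / L ^ ?d)"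
      using L by (simp add: emeasure_Q divide_ennreal[symmetric])
    have e3: "ennreal (1 / L ^ ?d) * ennreal (L ^ ?d * h L) = ennreal (h L)"
      using L h0[OF L] by (simp add: ennreal_mult[symmetric])
    show ?thesis using I unfolding box_cost_def[symmetric] J e1 e3 .
  qed
  have two: "ennreal (real n powr (p / real ?d)) *
        (\<integral>\<^sup>+ \<omega>. transport_cost p (Q 1) (empirical_measure n (\<lambda>i. X i \<omega>)) lborel \<partial>P) = ennreal (real n powr (p / real ?d) * b n)" if n: "n \<ge> 1" for n
    unfolding iid.nn_integral_empirical_cost[OF n p(2)] using n av(2)[of n]
    by (simp add: av(1) b_def ennreal_of_nat_eq_real_of_nat divide_ennreal ennreal_mult[symmetric])
  show ?thesis
  proof (intro exI[of _ l] conjI lpos)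
    show "((\<lambda>L. \<integral>\<^sup>+ \<omega>. 1 / emeasure lborel (Q L :: (real ^ 'd) set) *
        transport_cost p (Q L) (N \<omega>)
          (density lborel (\<lambda>_. emeasure (N \<omega>) (Q L) / emeasure lborel (Q L :: (real ^ 'd) set))) \<partial>M)
      \<longlongrightarrow> ennreal l) at_top"
      by (rule Lim_transform_eventually[OF tendsto_ennrealI[OF l]])
        (rule eventually_mono[OF eventually_gt_at_top[of 0] one[symmetric]])
    show "(\<lambda>n. ennreal (real n powr (p / real CARD('d))) *
        (\<integral>\<^sup>+ \<omega>. transport_cost p (Q 1) (empirical_measure n (\<lambda>i. X i \<omega>)) lborel \<partial>P))
      \<longlonglongrightarrow> ennreal l"
      by (rule Lim_transform_eventually[OF tendsto_ennrealI[OF lim_b]])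
        (rule eventually_mono[OF eventually_ge_at_top[of 1] two[symmetric]])
  qed
qed

end
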